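(* Let $0<M\le L<\infty$. There exist $C_1>0$, $C_2\in(0,1]$ and $C_3>0$ depending only on $M$ and $L$ such that for every $k\in\mathbb{N}$ and every $\delta=(\delta_j)_{j=1}^k\in(0,\infty)^k$ the following holds. Suppose that each $f\in\{f_\rho,f_\pi\}$ satisfies: (a) $f\in C^0(\mathcal{B}_\delta(U_1)\times U;\mathbb{C})$ and $f:U\to\mathbb{R}_+$ is a probability density with respect to $\mu$; (b) $x\mapsto f(x,y)\in C^1(\mathcal{B}_\delta(U_1);\mathbb{C})$ for all $y\in U$; (c) $M\le|f(y)|\le L$ for all $y\in\mathcal{B}_\delta(U_1)\times U$; (d) $\sup_{y\in\mathcal{B}_\delta\times\{0\}^{\mathbb{N}}}|f(x+y)-f(x)|\le C_1$ for all $x\in U$; (e) $\sup_{y\in\mathcal{B}_{\delta_{[j]}}\times\{0\}^{\mathbb{N}}}|f(x+y)-f(x)|\le C_1\delta_{j+1}$ for all $x\in U$ and $j\in\{1,\dots,k-1\}$. Let $T$ be the Knothe–Rosenblatt transport pushing forward $\rho$ (with $\mu$-density $f_\rho$) to $\pi$ (with $\mu$-density $f_\pi$), set $R_j:=\partial_jT_j$, and define $\zeta=(\zeta_j)_{j=1}^k$ by $\zeta_j:=C_2\delta_j$. Then for all $j\in\{1,\dots,k\}$ ($R_j$ being identified with its complex extension): (i) $R_j\in C^1(\mathcal{B}_{\zeta_{[j]}}(U_1);\mathcal{B}_{C_3}(1))$ and $\Re(R_j(x))\ge\frac1{C_3}$ for all $x\in\mathcal{B}_{\zeta_{[j]}}(U_1)$;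 (ii) if $j\ge2$, then $R_j:\mathcal{B}_{\zeta_{[j-1]}}(U_1)\times U_1\to\mathcal{B}_{C_3/\delta_j}(1)$.
   Context: Notation. $\mathbb{N}=\{1,2,\dots\}$, $\mathbb{R}_+=(0,\infty)$, $U_k=[-1,1]^k$, $U=[-1,1]^{\mathbb{N}}$ with the product topology. $\lambda$ is Lebesgue measure on $[-1,1]$, $\mu=\bigotimes_{j\in\mathbb{N}}\frac\lambda2$ on $U$ (and $\mu=\bigotimes_{j=1}^k\frac\lambda2$ on $U_k$). $y_{[k]}=(y_1,\dots,y_k)$, and similarly $\delta_{[j]}=(\delta_1,\dots,\delta_j)$. For $\delta>0$ and $D\subseteq\mathbb{C}$: $\mathcal{B}_\delta=\{z\in\mathbb{C}:|z|<\delta\}$, $\mathcal{B}_\delta(D)=\{z+y:z\in\mathcal{B}_\delta,y\in D\}$, and $\mathcal{B}_r(1)=\mathcal{B}_r(\{1\})$. For $\delta\in(0,\infty)^k$: $\mathcal{B}_\delta=\prod_{j=1}^k\mathcal{B}_{\delta_j}$ and $\mathcal{B}_\delta(D)=\prod_{j=1}^k\mathcal{B}_{\delta_j}(D)$, subsets of $\mathbb{C}^k$. $\mathcal{B}_\delta(U_1)\times U$ is the set of $y\in\mathbb{C}^{\mathbb{N}}$ with $y_j\in\mathcal{B}_{\delta_j}(U_1)$ for $j\le k$ and $y_j\in U_1$ otherwise, with the product topology. $C^1$ on an open subset of $\mathbb{C}^k$ means (continuously) complex differentiable. Knothe–Rosenblatt transport. For $*\in\{\rho,\pi\}$ set $\hat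 f_{*,0}=1$ and for $k\in\mathbb{N}$, $\hat f_{*,k}(y_{[k]})=\int_Uf_*(y_{[k]},t)\,d\mu(t)$, $f_{*,k}(y_{[k]})=\hat f_{*,k}(y_{[k]})/\hat f_{*,k-1}(y_{[k-1]})$. Let $\rho_1,\pi_1$ be the measures on $U_1$ with $\mu$-densities $\hat f_{\rho,1},\hat f_{\pi,1}$, and $\rho_{k+1}^{y_{[k]}},\pi_{k+1}^{y_{[k]}}$ those with $\mu$-densities $f_{\rho,k+1}(y_{[k]},\cdot),f_{\pi,k+1}(y_{[k]},\cdot)$. $T_1:U_1\to U_1$ is the unique monotonically increasing map with $(T_1)_\sharp\rho_1=\pi_1$, and inductively, with $T_{[k]}=(T_j)_{j=1}^k$, $T_{k+1}(y_{[k]},\cdot):U_1\to U_1$ is the unique monotonically increasing map with $(T_{k+1}(y_{[k]},\cdot))_\sharp\rho_{k+1}^{y_{[k]}}=\pi_{k+1}^{T_{[k]}(y_{[k]})}$. $T=(T_k)_{k\in\mathbb{N}}$. Here $F_\sharp\nu$ denotes the pushforward. *)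

theory Defs
  imports "HOL-Probability.Probability"
begin

text \<open>
  Coordinates are numbered from 0: the 1-based \<open>y\<^sub>j\<close>, \<open>\<delta>\<^sub>j\<close>, \<open>T\<^sub>j\<close>, \<open>R\<^sub>j\<close> (\<open>j \<ge> 1\<close>) are \<open>y (j - 1)\<close>,
  \<open>\<delta> (j - 1)\<close>, \<open>T (j - 1)\<close>, \<open>R (j - 1)\<close> here.  A point of a k-dimensional space is a sequence that
  vanishes from index \<open>k\<close> on, so that \<open>D \<subseteq> \<complex>\<^sup>k\<close> and \<open>D \<times> {0}\<^sup>\<nat>\<close> are the same set of sequences.
  \<open>nat \<Rightarrow> complex\<close> carries the product topology, and \<open>comb_seq k x t\<close> is
  \<open>(x\<^sub>1, \<dots>, x\<^sub>k, t\<^sub>1, t\<^sub>2, \<dots>)\<close>.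
\<close>

definition trunc :: "nat \<Rightarrow> (nat \<Rightarrow> 'a::zero) \<Rightarrow> nat \<Rightarrow> 'a" where
  "trunc k y = comb_seq k y (\<lambda>_. 0)"

definition cpx :: "(nat \<Rightarrow> real) \<Rightarrow> nat \<Rightarrow> complex" where
  "cpx y = (\<lambda>i. complex_of_real (y i))"

definition U1 :: "real set" where
  "U1 = {-1..1}"

definition U :: "(nat \<Rightarrow> real) set" where
  "U = {y. \<forall>i. y i \<in> U1}"

definition lam :: "real measure" where
  "lam = scale_measure (1/2) (restrict_space lborel U1)"

definition mu :: "(nat \<Rightarrow> real) measure" where
  "mu = PiM UNIV (\<lambda>_. lam)"


subsection \<open>Complex neighbourhoods\<close>

definition nbhd :: "real \<Rightarrow> complex set \<Rightarrow> complex set" where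
  "nbhd r D = {z + y | z y. cmod z < r \<and> y \<in> D}"

definition U1c :: "complex set" where
  "U1c = complex_of_real ` U1"

definition prod_tail :: "nat \<Rightarrow> (nat \<Rightarrow> complex set) \<Rightarrow> complex set \<Rightarrow> (nat \<Rightarrow> complex) set" where
  "prod_tail k A B = {x. (\<forall>i<k. x i \<in> A i) \<and> (\<forall>i\<ge>k. x i \<in> B)}"

text \<open>\<open>\<B>\<^sub>\<delta> \<times> {0}\<^sup>\<nat>\<close>, \<open>\<B>\<^sub>\<delta>(U\<^sub>1)\<close> and \<open>\<B>\<^sub>\<delta>(U\<^sub>1) \<times> U\<close> for the first \<open>k\<close> entries of \<open>\<delta>\<close>.\<close>

definition polydisc :: "nat \<Rightarrow> (nat \<Rightarrow> real) \<Rightarrow> (nat \<Rightarrow> complex) set" where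
  "polydisc k \<delta> = prod_tail k (\<lambda>i. {z. cmod z < \<delta> i}) {0}"

definition cube_nbhd :: "nat \<Rightarrow> (nat \<Rightarrow> real) \<Rightarrow> (nat \<Rightarrow> complex) set" where
  "cube_nbhd k \<delta> = prod_tail k (\<lambda>i. nbhd (\<delta> i) U1c) {0}"

definition cube_nbhd_U :: "nat \<Rightarrow> (nat \<Rightarrow> real) \<Rightarrow> (nat \<Rightarrow> complex) set" where
  "cube_nbhd_U k \<delta> = prod_tail k (\<lambda>i. nbhd (\<delta> i) U1c) U1c"

text \<open>\<open>\<B>\<^sub>\<delta>(U\<^sub>1) \<times> U\<^sub>1 \<subseteq> \<complex>\<^sup>k\<^sup>+\<^sup>1\<close>, with \<open>\<delta>\<close> of length \<open>k\<close>.\<close>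

definition cube_nbhd_U1 :: "nat \<Rightarrow> (nat \<Rightarrow> real) \<Rightarrow> (nat \<Rightarrow> complex) set" where
  "cube_nbhd_U1 k \<delta> = prod_tail (Suc k) (\<lambda>i. if i < k then nbhd (\<delta> i) U1c else U1c) {0}"

text \<open>
  Continuous complex (Frechet) differentiability on an open \<open>S \<subseteq> \<complex>\<^sup>k\<close>; \<open>D 0 x, \<dots>, D (k-1) x\<close> are the
  components of the derivative at \<open>x\<close>.
\<close>

definition C1_on :: "nat \<Rightarrow> (nat \<Rightarrow> complex) set \<Rightarrow> ((nat \<Rightarrow> complex) \<Rightarrow> complex) \<Rightarrow> bool" where
  "C1_on k S F \<longleftrightarrow> (\<exists>D :: nat \<Rightarrow> (nat \<Rightarrow> complex) \<Rightarrow> complex.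
     (\<forall>i<k. continuous_on S (D i)) \<and>
     (\<forall>x\<in>S. \<forall>\<epsilon>>0. \<exists>\<eta>>0. \<forall>h. (\<forall>i\<ge>k. h i = 0) \<and> L2_set (\<lambda>i. cmod (h i)) {..<k} < \<eta> \<and>
          (\<lambda>i. x i + h i) \<in> S \<longrightarrow>
          cmod (F (\<lambda>i. x i + h i) - F x - (\<Sum>i<k. D i x * h i))
            \<le> \<epsilon> * L2_set (\<lambda>i. cmod (h i)) {..<k}))"


subsection \<open>Knothe--Rosenblatt transport\<close>

text \<open>\<open>marg f k\<close> is the k-th hatted marginal, \<open>cond_dens f k\<close> the k-th conditional density (\<open>k \<ge> 1\<close>);
  both depend on the first \<open>k\<close> coordinates only.\<close>

definition marg :: "((nat \<Rightarrow> real) \<Rightarrow> real) \<Rightarrow> nat \<Rightarrow> (nat \<Rightarrow> real) \<Rightarrow> real" where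
  "marg f k y = (if k = 0 then 1 else (\<integral>t. f (comb_seq k y t) \<partial>mu))"

definition cond_dens :: "((nat \<Rightarrow> real) \<Rightarrow> real) \<Rightarrow> nat \<Rightarrow> (nat \<Rightarrow> real) \<Rightarrow> real" where
  "cond_dens f k y = marg f k y / marg f (k - 1) y"

definition cond_measure :: "((nat \<Rightarrow> real) \<Rightarrow> real) \<Rightarrow> nat \<Rightarrow> (nat \<Rightarrow> real) \<Rightarrow> real measure" where
  "cond_measure f k y = density lam (\<lambda>s. ennreal (cond_dens f (Suc k) (y(k := s))))"

definition mono_transport :: "real measure \<Rightarrow> real measure \<Rightarrow> (real \<Rightarrow> real) \<Rightarrow> bool" where
  "mono_transport \<nu> \<nu>' g \<longleftrightarrow> g ` U1 \<subseteq> U1 \<and> mono_on U1 g \<and> distr \<nu> lam g = \<nu>'"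

text \<open>\<open>T k\<close> is only ever evaluated at points of \<open>U\<^sub>k\<^sub>+\<^sub>1\<close>; its values there are determined by this
  predicate, because monotone transport maps between the (positive) conditional densities are
  unique.\<close>

definition KR_transport ::
  "((nat \<Rightarrow> real) \<Rightarrow> real) \<Rightarrow> ((nat \<Rightarrow> real) \<Rightarrow> real) \<Rightarrow> (nat \<Rightarrow> (nat \<Rightarrow> real) \<Rightarrow> real) \<Rightarrow> bool" where
  "KR_transport f\<rho> f\<pi> T \<longleftrightarrow>
     (\<forall>k. \<forall>y\<in>U. mono_transport
        (cond_measure f\<rho> k y)
        (cond_measure f\<pi> k (\<lambda>j. T j (trunc (Suc j) y)))
        (\<lambda>s. T k (trunc (Suc k) (y(k := s)))))"

text \<open>\<open>R\<close> extends \<open>\<partial>\<^sub>jT\<^sub>j : U\<^sub>j \<rightarrow> \<real>\<close> to complex arguments (one-sided derivatives at the end points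
  of \<open>U\<^sub>1\<close>).\<close>

definition extends_partial ::
  "(nat \<Rightarrow> (nat \<Rightarrow> real) \<Rightarrow> real) \<Rightarrow> nat \<Rightarrow> ((nat \<Rightarrow> complex) \<Rightarrow> complex) \<Rightarrow> bool" where
  "extends_partial T j R \<longleftrightarrow>
     (\<forall>x\<in>U. \<exists>r. ((\<lambda>s. T j (trunc (Suc j) (x(j := s)))) has_real_derivative r) (at (x j) within U1) \<and>
                 R (cpx (trunc (Suc j) x)) = complex_of_real r)"


subsection \<open>Hypotheses on the densities\<close>

definition density_hyps ::
  "real \<Rightarrow> real \<Rightarrow> real \<Rightarrow> nat \<Rightarrow> (nat \<Rightarrow> real) \<Rightarrow> ((nat \<Rightarrow> complex) \<Rightarrow> complex) \<Rightarrow> bool" where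
  "density_hyps M L C1 k \<delta> f \<longleftrightarrow>
     continuous_on (cube_nbhd_U k \<delta>) f \<and>
     (\<forall>y\<in>U. f (cpx y) \<in> \<real> \<and> Re (f (cpx y)) > 0) \<and>
     has_bochner_integral mu (\<lambda>y. Re (f (cpx y))) 1 \<and>
     (\<forall>y\<in>U. C1_on k (cube_nbhd k \<delta>) (\<lambda>x. f (comb_seq k x (cpx y)))) \<and>
     (\<forall>y\<in>cube_nbhd_U k \<delta>. M \<le> cmod (f y) \<and> cmod (f y) \<le> L) \<and>
     (\<forall>x\<in>U. \<forall>y\<in>polydisc k \<delta>. cmod (f (\<lambda>i. cpx x i + y i) - f (cpx x)) \<le> C1) \<and>
     (\<forall>x\<in>U. \<forall>j\<in>{1..<k}. \<forall>y\<in>polydisc j \<delta>.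
        cmod (f (\<lambda>i. cpx x i + y i) - f (cpx x)) \<le> C1 * \<delta> j)"

end

theory Submission
  imports Defs "HOL-Complex_Analysis.Complex_Analysis"
begin

text \<open>
  The marginals extend holomorphically, stay within \<open>C\<^sub>1\<close> of positive numbers in \<open>[M, L]\<close>, and hence have
  real part at least \<open>M / 2\<close>.  So the primitive in the last variable of the marginal of \<open>f\<^sub>\<pi>\<close> is injective and
  maps the disc of radius \<open>r\<close> about a real point onto a set containing a disc of radius \<open>M r / 2\<close>.
  The equation that defines \<open>T\<^sub>j\<^sub>+\<^sub>1\<close> through \<open>T\<^sub>[\<^sub>j\<^sub>]\<close> is, by hypothesis (e), an \<open>O(C\<^sub>1 + C\<^sub>2) \<delta>\<^sub>j\<^sub>+\<^sub>1\<close>-perturbation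
  of a real equation, which is solvable; therefore it has a unique solution within distance \<open>\<delta>\<^sub>j\<^sub>+\<^sub>1\<close> of \<open>U\<^sub>1\<close>,
  and the induction does not lose constants.  Uniqueness makes the solution continuous and
  holomorphic, and \<open>\<partial>\<^sub>jT\<^sub>j\<close> is the quotient of the conditional densities along it.  For large \<open>\<delta>\<^sub>j\<close>,
  Schwarz' lemma shows that both conditional densities are nearly constant in the last variable, hence nearly 1.
\<close>

subsection \<open>Integrals depending on a parameter and holomorphy along curves\<close>

text \<open>A primitive of a marginal in its last variable involves a choice for each value of the
  other variables, which hides its regularity in all of them together. It is therefore replaced by
  its divided difference \<open>smean j x a b\<close>, the mean of the marginal over the segment
  from \<open>a\<close> to \<open>b\<close>. This mean is continuous and holomorphic in all
  arguments, makes sense for \<open>a = b\<close>, has modulus at most \<open>L\<close> and real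
  part at least \<open>M / 2\<close>. Subtracting two instances of the defining equation and
  dividing by such a mean gives uniqueness, continuity and differentiability of the solution and its
  distance from -1, in place of an implicit function theorem.

  The perturbation argument is centred at real points \<open>u\<close> near \<open>x\<close> and
  \<open>v\<close> near the image of \<open>x\<close>. They are chosen independently of each other,
  since the real equation is solvable for every such pair. So all that a step uses of the earlier
  components is that they lie within the full radii \<open>\<delta>\<close>, and a solution has this
  property by definition. The factor \<open>C2\<close> is paid only in \<open>x\<close>. Hypothesis
  (e) is decisive because the disc that absorbs the error has radius proportional to the current
  radius, however small.\<close>

lemma tendsto_fun_coordinatewise:
  fixes f :: "'b \<Rightarrow> 'i \<Rightarrow> 'a::topological_space"
  assumes "\<And>i. ((\<lambda>x. f x i) \<longlongrightarrow> l i) F"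
  shows "(f \<longlongrightarrow> l) F"
proof -
  have "limitin (product_topology (\<lambda>i::'i. euclidean::'a topology) UNIV) f l F"
    using assms by (simp add: limitin_componentwise limitin_canonical_iff)
  then show ?thesis
    by (simp add: euclidean_product_topology limitin_canonical_iff)
qed

lemma tendsto_fun_coordinate:
  fixes f :: "'b \<Rightarrow> 'i \<Rightarrow> 'a::topological_space"
  assumes "(f \<longlongrightarrow> l) F"
  shows "((\<lambda>x. f x i) \<longlongrightarrow> l i) F"
proof -
  have "limitin (product_topology (\<lambda>i::'i. euclidean::'a topology) UNIV) f l F"
    using assms by (simp add: euclidean_product_topology limitin_canonical_iff)
  then show ?thesis
    by (simp add: limitin_componentwise limitin_canonical_iff)
qed

text \<open>Schwarz' lemma for \<open>h - h c\<close>, rescaled to the unit disc. It serves twice: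
  it dominates difference quotients under an integral, and its factor \<open>1 / d\<close> is the
  source of the decay in \<open>1 / \<delta> j\<close>.\<close>

lemma holomorphic_increment_bound:
  assumes hol: "h holomorphic_on ball c d"
    and B: "\<And>z. z \<in> ball c d \<Longrightarrow> norm (h z) \<le> B"
    and z: "z \<in> ball c d"
  shows "norm (h z - h c) \<le> 2 * B / d * norm (z - c)"
proof (cases "z = c")
  case False
  have d: "d > 0" using z by (metis ball_eq_empty empty_iff not_le)
  have B0: "0 \<le> B" using B[OF z] norm_ge_zero order_trans by blast
  \<comment> \<open>Schwarz' lemma asks for values in the open unit disc, so the strict bound
    \<open>B' > B\<close> is used first and then \<open>B'\<close> is lowered to
    \<open>B\<close>.\<close>
  have *: "norm (h z - h c) * d / (2 * norm (z - c)) \<le> B'" if "B' > B" for B'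
  proof -
    define \<phi> where "\<phi> = (\<lambda>\<xi>. (h (c + of_real d * \<xi>) - h c) / of_real (2 * B'))"
    have inb: "c + of_real d * \<xi> \<in> ball c d" if "norm \<xi> < 1" for \<xi>
      using d that by (simp add: dist_norm norm_mult)
    have B'0: "B' > 0" using that B0 by simp
    have "(h \<circ> (\<lambda>\<xi>. c + of_real d * \<xi>)) holomorphic_on ball 0 1"
      by (rule holomorphic_on_compose_gen[OF _ hol]) (use inb in \<open>auto intro!: holomorphic_intros\<close>)
    then have hol\<phi>: "\<phi> holomorphic_on ball 0 1"
      unfolding \<phi>_def o_def using B'0 by (auto intro!: holomorphic_intros)
    have "norm (\<phi> \<xi>) < 1" if "norm \<xi> < 1" for \<xi>
    proof -
      have "norm (h (c + of_real d * \<xi>) - h c) \<le> B + B"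
        using norm_triangle_ineq4 B[OF inb[OF that]] B[of c] d
        by (smt (verit) centre_in_ball)
      then show ?thesis unfolding \<phi>_def using \<open>B' > B\<close> B'0
        by (simp add: norm_divide field_simps)
    qed
    moreover have "norm ((z - c) / of_real d) < 1"
      using z d by (simp add: norm_divide dist_norm norm_minus_commute)
    ultimately have "norm (\<phi> ((z - c) / of_real d)) \<le> norm ((z - c) / of_real d)"
      by (intro Schwarz_Lemma(1)[OF hol\<phi>]) (auto simp: \<phi>_def)
    then show ?thesis
      using d B'0 False by (simp add: \<phi>_def norm_divide field_simps norm_mult)
  qed
  have "norm (h z - h c) * d / (2 * norm (z - c)) \<le> B"
    by (rule dense_ge) (use * in auto)
  then show ?thesis using d False by (simp add: field_simps)
qed auto

text \<open>Dominated convergence along sequences, which decide continuity because the parameter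
  space is first countable; sequences of complex numbers form such a space.\<close>

lemma continuous_on_lebesgue_integral:
  fixes h :: "'b::{first_countable_topology,t2_space} \<Rightarrow> 'a \<Rightarrow> complex"
  assumes fin: "finite_measure \<nu>"
    and cont: "\<And>\<omega>. \<omega> \<in> space \<nu> \<Longrightarrow> continuous_on S (\<lambda>x. h x \<omega>)"
    and meas: "\<And>x. x \<in> S \<Longrightarrow> h x \<in> borel_measurable \<nu>"
    and bnd: "\<And>x \<omega>. x \<in> S \<Longrightarrow> \<omega> \<in> space \<nu> \<Longrightarrow> norm (h x \<omega>) \<le> B"
  shows "continuous_on S (\<lambda>x. \<integral>\<omega>. h x \<omega> \<partial>\<nu>)"
proof (rule continuous_on_sequentiallyI)
  fix u a assume u: "\<forall>n. u n \<in> S" "a \<in> S" "u \<longlonglongrightarrow> (a::'b)"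
  interpret finite_measure \<nu> by fact
  show "(\<lambda>n. \<integral>\<omega>. h (u n) \<omega> \<partial>\<nu>) \<longlonglongrightarrow> (\<integral>\<omega>. h a \<omega> \<partial>\<nu>)"
  proof (rule integral_dominated_convergence[where w = "\<lambda>_. B"])
    show "AE \<omega> in \<nu>. (\<lambda>n. h (u n) \<omega>) \<longlonglongrightarrow> h a \<omega>"
      using cont u by (intro AE_I2) (auto simp: continuous_on_sequentially o_def)
  qed (use meas bnd u in auto)
qed

text \<open>Differentiation under the integral sign. A bound on \<open>h\<close> alone suffices,
  since Schwarz' lemma turns it into the constant majorant \<open>2 * B / d\<close> of the
  difference quotients.\<close>

lemma holomorphic_on_lebesgue_integral:
  fixes h :: "complex \<Rightarrow> 'a \<Rightarrow> complex"
  assumes fin: "finite_measure \<nu>" and V: "open V"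
    and hol: "\<And>\<omega>. \<omega> \<in> space \<nu> \<Longrightarrow> (\<lambda>z. h z \<omega>) holomorphic_on V"
    and meas: "\<And>z. z \<in> V \<Longrightarrow> h z \<in> borel_measurable \<nu>"
    and bnd: "\<And>z \<omega>. z \<in> V \<Longrightarrow> \<omega> \<in> space \<nu> \<Longrightarrow> norm (h z \<omega>) \<le> B"
  shows "(\<lambda>z. \<integral>\<omega>. h z \<omega> \<partial>\<nu>) holomorphic_on V"
proof (rule holomorphic_onI)
  interpret finite_measure \<nu> by fact
  fix z0 assume z0: "z0 \<in> V"
  then obtain d where d: "d > 0" "ball z0 d \<subseteq> V" using V open_contains_ball by blast
  define q where "q = (\<lambda>z \<omega>. (h z \<omega> - h z0 \<omega>) / (z - z0))"
  define D where "D = (\<lambda>\<omega>. deriv (\<lambda>z. h z \<omega>) z0)"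
  have int: "integrable \<nu> (h z)" if "z \<in> V" for z
    using meas bnd that by (intro integrable_const_bound[of _ B]) auto
  have qlim: "(\<lambda>n. q (X n) \<omega>) \<longlonglongrightarrow> D \<omega>"
    if "\<omega> \<in> space \<nu>" "\<forall>n. X n \<in> ball z0 d - {z0}" "X \<longlonglongrightarrow> z0" for X \<omega>
  proof -
    have "((\<lambda>z. h z \<omega>) has_field_derivative D \<omega>) (at z0 within ball z0 d)"
      unfolding D_def using hol[OF that(1)] z0 V
      by (meson has_field_derivative_at_within holomorphic_derivI)
    then have "((\<lambda>z. q z \<omega>) \<longlongrightarrow> D \<omega>) (at z0 within ball z0 d)"
      unfolding q_def has_field_derivative_iff .
    then show ?thesis using that(2,3)
      by (auto simp: tendsto_at_iff_sequentially o_def)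
  qed
  have qmeas: "q z \<in> borel_measurable \<nu>" if "z \<in> V" for z
    unfolding q_def using meas[OF that] meas[OF z0] by measurable
  \<comment> \<open>A concrete sequence of quotients, needed to see that their limit
    \<open>D\<close> is measurable. The summand 2 keeps even the first point strictly inside the
    ball.\<close>
  have "(\<lambda>n. z0 + of_real (d / (real n + 2))) \<longlonglongrightarrow> z0 + of_real 0"
    by (intro tendsto_intros) real_asymp
  then have X0: "(\<lambda>n. z0 + of_real (d / (real n + 2))) \<longlonglongrightarrow> z0" by simp
  have X0': "z0 + of_real (d / (real n + 2)) \<in> ball z0 d - {z0}" for n
  proof -
    have "0 < d / (real n + 2)" using d by (intro divide_pos_pos) auto
    moreover have "d * 1 < d * (real n + 2)" using d by (intro mult_strict_left_mono) auto
    then have "d / (real n + 2) < d" by (subst pos_divide_less_eq) auto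
    ultimately have *: "0 < d / (real n + 2)" "d / (real n + 2) < d" by blast+
    have "norm (of_real (d / (real n + 2)) :: complex) = d / (real n + 2)"
      using *(1) by (subst norm_of_real) linarith
    then have "norm (of_real (d / (real n + 2)) :: complex) < d"
      "(of_real (d / (real n + 2)) :: complex) \<noteq> 0" using * by (metis, metis less_irrefl norm_zero)
    then show ?thesis unfolding mem_ball dist_norm Diff_iff singleton_iff
      by (metis add_cancel_right_right add_diff_cancel_left' norm_minus_commute)
  qed
  have Dmeas: "D \<in> borel_measurable \<nu>"
  proof (rule borel_measurable_LIMSEQ_metric)
    show "q (z0 + of_real (d / (real n + 2))) \<in> borel_measurable \<nu>" for n
      using qmeas X0' d by blast
    show "(\<lambda>n. q (z0 + of_real (d / (real n + 2))) \<omega>) \<longlonglongrightarrow> D \<omega>" if "\<omega> \<in> space \<nu>" for \<omega>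
      using qlim[OF that _ X0] X0' by blast
  qed
  have qbnd: "norm (q z \<omega>) \<le> 2 * B / d" if "z \<in> ball z0 d - {z0}" "\<omega> \<in> space \<nu>" for z \<omega>
  proof -
    have "norm (h z \<omega> - h z0 \<omega>) \<le> 2 * B / d * norm (z - z0)"
      by (rule holomorphic_increment_bound[where h = "\<lambda>z. h z \<omega>"])
        (use that d bnd holomorphic_on_subset[OF hol] in auto)
    then show ?thesis using that by (simp add: q_def norm_divide field_simps)
  qed
  have "((\<lambda>z. \<integral>\<omega>. q z \<omega> \<partial>\<nu>) \<longlongrightarrow> (\<integral>\<omega>. D \<omega> \<partial>\<nu>)) (at z0 within ball z0 d)"
    unfolding tendsto_at_iff_sequentially o_def
  proof (intro allI impI)
    fix X assume X: "\<forall>n. X n \<in> ball z0 d - {z0}" "X \<longlonglongrightarrow> z0"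
    show "(\<lambda>n. \<integral>\<omega>. q (X n) \<omega> \<partial>\<nu>) \<longlonglongrightarrow> (\<integral>\<omega>. D \<omega> \<partial>\<nu>)"
    proof (rule integral_dominated_convergence[where w = "\<lambda>_. 2 * B / d"])
      show "q (X n) \<in> borel_measurable \<nu>" for n using qmeas X d by blast
      show "AE \<omega> in \<nu>. (\<lambda>n. q (X n) \<omega>) \<longlonglongrightarrow> D \<omega>" using qlim X by auto
      show "AE \<omega> in \<nu>. norm (q (X n) \<omega>) \<le> 2 * B / d" for n using qbnd X by auto
    qed (use Dmeas in auto)
  qed
  moreover have "\<forall>\<^sub>F z in at z0 within ball z0 d. (\<integral>\<omega>. q z \<omega> \<partial>\<nu>) =
      ((\<integral>\<omega>. h z \<omega> \<partial>\<nu>) - (\<integral>\<omega>. h z0 \<omega> \<partial>\<nu>)) / (z - z0)"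
    unfolding q_def eventually_at_filter
    by (rule always_eventually) (use int d z0 in \<open>auto intro!: Bochner_Integration.integral_diff\<close>)
  ultimately have "((\<lambda>z. \<integral>\<omega>. h z \<omega> \<partial>\<nu>) has_field_derivative (\<integral>\<omega>. D \<omega> \<partial>\<nu>)) (at z0 within ball z0 d)"
    unfolding has_field_derivative_iff by (rule Lim_transform_eventually)
  then have "((\<lambda>z. \<integral>\<omega>. h z \<omega> \<partial>\<nu>) has_field_derivative (\<integral>\<omega>. D \<omega> \<partial>\<nu>)) (at z0)"
    using d by (simp add: at_within_open[OF _ open_ball])
  then show "(\<lambda>z. \<integral>\<omega>. h z \<omega> \<partial>\<nu>) field_differentiable at z0 within V"
    using field_differentiable_at_within field_differentiable_def by blast
qed

text \<open>
  Unlike Frechet differentiability, this property passes to compositions and to integrals over a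
  parameter with no estimates; continuity is all that is missing from it to \<open>C\<^sup>1\<close>.
\<close>

definition hol_along ::
  "nat \<Rightarrow> (nat \<Rightarrow> complex) set \<Rightarrow> ((nat \<Rightarrow> complex) \<Rightarrow> complex) \<Rightarrow> bool" where
  "hol_along n A F \<longleftrightarrow> (\<forall>V \<gamma>. open V \<longrightarrow> (\<forall>z\<in>V. \<gamma> z \<in> A) \<longrightarrow>
     (\<forall>i<n. (\<lambda>z. \<gamma> z i) holomorphic_on V) \<longrightarrow> (\<lambda>z. F (\<gamma> z)) holomorphic_on V)"

lemma hol_alongD:
  assumes "hol_along n A F" "open V" "\<And>z. z \<in> V \<Longrightarrow> \<gamma> z \<in> A"
    "\<And>i. i < n \<Longrightarrow> (\<lambda>z. \<gamma> z i) holomorphic_on V"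
  shows "(\<lambda>z. F (\<gamma> z)) holomorphic_on V"
  using assms by (auto simp: hol_along_def)

text \<open>Chain rule for a curve. \<open>C1_on\<close> only controls increments that vanish from
  index \<open>k\<close> on, hence the demand that these coordinates of the curve be
  constant.\<close>

lemma C1_on_holomorphic_compose:
  assumes C1: "C1_on k S F" and V: "open V" and \<gamma>: "\<And>z. z \<in> V \<Longrightarrow> \<gamma> z \<in> S"
    and hol: "\<And>i. i < k \<Longrightarrow> (\<lambda>z. \<gamma> z i) holomorphic_on V"
    and const: "\<And>i z z'. k \<le> i \<Longrightarrow> z \<in> V \<Longrightarrow> z' \<in> V \<Longrightarrow> \<gamma> z i = \<gamma> z' i"
  shows "(\<lambda>z. F (\<gamma> z)) holomorphic_on V"
proof (rule holomorphic_onI)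
  fix z0 assume z0: "z0 \<in> V"
  obtain D where D: "\<And>x \<epsilon>. x \<in> S \<Longrightarrow> \<epsilon> > 0 \<Longrightarrow> \<exists>\<eta>>0. \<forall>h. (\<forall>i\<ge>k. h i = 0) \<and>
       L2_set (\<lambda>i. cmod (h i)) {..<k} < \<eta> \<and> (\<lambda>i. x i + h i) \<in> S \<longrightarrow>
          cmod (F (\<lambda>i. x i + h i) - F x - (\<Sum>i<k. D i x * h i))
            \<le> \<epsilon> * L2_set (\<lambda>i. cmod (h i)) {..<k}"
    using C1 unfolding C1_on_def by blast
  define x where "x = \<gamma> z0"
  define g where "g = (\<lambda>i. deriv (\<lambda>z. \<gamma> z i) z0)"
  define h where "h = (\<lambda>z i. \<gamma> z i - x i)"
  have der: "((\<lambda>z. \<gamma> z i) has_field_derivative g i) (at z0)" if "i < k" for i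
    unfolding g_def using hol[OF that] V z0 by (rule holomorphic_derivI)
  have evV: "\<forall>\<^sub>F z in at z0. z \<in> V" using V z0 by (meson eventually_at_topological)
  have ev1: "\<forall>\<^sub>F z in at z0. \<forall>i<k. norm (h z i - g i * (z - z0)) \<le> e * norm (z - z0)" if "e > 0" for e
  proof -
    have "\<forall>\<^sub>F z in at z0. norm (h z i - g i * (z - z0)) \<le> e * norm (z - z0)" if "i < k" for i
      using der[OF that] \<open>e > 0\<close>
      by (simp add: has_field_derivative_def has_derivative_within_alt2 h_def x_def)
    then have "\<forall>\<^sub>F z in at z0. \<forall>i\<in>{..<k}. norm (h z i - g i * (z - z0)) \<le> e * norm (z - z0)"
      by (intro eventually_ball_finite) auto
    then show ?thesis by (rule eventually_mono) auto
  qed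
  define C where "C = (\<Sum>i<k. norm (g i) + 1)"
  have C0: "C \<ge> 0" unfolding C_def by (intro sum_nonneg) auto
  have L2: "\<forall>\<^sub>F z in at z0. L2_set (\<lambda>i. cmod (h z i)) {..<k} \<le> C * norm (z - z0)"
    using ev1[of 1, simplified]
  proof eventually_elim
    case (elim z)
    have "norm (h z i) \<le> (norm (g i) + 1) * norm (z - z0)" if "i < k" for i
    proof -
      have "norm (h z i) \<le> norm (h z i - g i * (z - z0)) + norm (g i * (z - z0))"
        by (metis diff_add_cancel norm_triangle_ineq)
      moreover have "norm (h z i - g i * (z - z0)) \<le> norm (z - z0)" using elim that by simp
      ultimately show ?thesis unfolding norm_mult distrib_right by linarith
    qed
    then have "(\<Sum>i<k. norm (h z i)) \<le> C * norm (z - z0)"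
      unfolding C_def sum_distrib_right by (intro sum_mono) auto
    moreover have "L2_set (\<lambda>i. cmod (h z i)) {..<k} \<le> (\<Sum>i<k. norm (h z i))"
      by (rule L2_set_le_sum) auto
    ultimately show ?case by linarith
  qed
  have "((\<lambda>z. F (\<gamma> z)) has_field_derivative (\<Sum>i<k. D i x * g i)) (at z0)"
    unfolding has_field_derivative_def has_derivative_within_alt2
  proof (intro conjI allI impI)
    show "bounded_linear ((*) (\<Sum>i<k. D i x * g i))" by (rule bounded_linear_mult_right)
    fix e :: real assume e: "e > 0"
    define N where "N = (\<Sum>i<k. norm (D i x))"
    have N0: "N \<ge> 0" unfolding N_def by (intro sum_nonneg) auto
    \<comment> \<open>The error \<open>e\<close> is split evenly: \<open>e1 * C\<close> pays for the
      remainder of \<open>F\<close>, \<open>e2 * N\<close> for the remainders of the coordinates of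
      the curve. The summands 1 exclude division by 0.\<close>
    define e1 where "e1 = e / (2 * (C + 1))"
    define e2 where "e2 = e / (2 * (N + 1))"
    have e1: "e1 > 0" "e1 * C \<le> e / 2" and e2: "e2 > 0" "e2 * N \<le> e / 2"
      using e C0 N0 by (auto simp: e1_def e2_def field_simps)
    obtain \<eta> where \<eta>: "\<eta> > 0" "\<And>h. (\<forall>i\<ge>k. h i = 0) \<Longrightarrow>
       L2_set (\<lambda>i. cmod (h i)) {..<k} < \<eta> \<Longrightarrow> (\<lambda>i. x i + h i) \<in> S \<Longrightarrow>
          cmod (F (\<lambda>i. x i + h i) - F x - (\<Sum>i<k. D i x * h i))
            \<le> e1 * L2_set (\<lambda>i. cmod (h i)) {..<k}"
      using D[of x e1] \<gamma>[OF z0] e1 unfolding x_def by blast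
    have "((\<lambda>z. C * norm (z - z0)) \<longlongrightarrow> C * norm (z0 - z0)) (at z0)"
      by (intro tendsto_intros)
    then have "\<forall>\<^sub>F z in at z0. C * norm (z - z0) < \<eta>"
      by (rule order_tendstoD) (use \<eta> in simp)
    with L2 evV ev1[OF e2(1)]
    show "\<forall>\<^sub>F z in at z0. cmod (F (\<gamma> z) - F (\<gamma> z0) - (\<Sum>i<k. D i x * g i) * (z - z0)) \<le> e * cmod (z - z0)"
    proof eventually_elim
      case (elim z)
      have xh: "(\<lambda>i. x i + h z i) = \<gamma> z" by (auto simp: h_def)
      have 1: "cmod (F (\<gamma> z) - F x - (\<Sum>i<k. D i x * h z i)) \<le> e1 * L2_set (\<lambda>i. cmod (h z i)) {..<k}"
        using \<eta>(2)[of "h z"] elim \<gamma> const[of _ z z0] z0 unfolding xh by (auto simp: h_def x_def)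
      also have "\<dots> \<le> e1 * (C * norm (z - z0))"
        using elim e1 by (intro mult_left_mono) auto
      also have "\<dots> \<le> e / 2 * norm (z - z0)"
        using mult_right_mono[OF e1(2), of "norm (z - z0)"] by (simp add: mult.assoc)
      finally have 2: "cmod (F (\<gamma> z) - F x - (\<Sum>i<k. D i x * h z i)) \<le> e / 2 * norm (z - z0)" .
      have "(\<Sum>i<k. D i x * h z i) - (\<Sum>i<k. D i x * g i) * (z - z0)
          = (\<Sum>i<k. D i x * (h z i - g i * (z - z0)))"
        by (simp add: sum_distrib_right sum_subtractf right_diff_distrib mult.assoc)
      also have "norm \<dots> \<le> (\<Sum>i<k. norm (D i x) * (e2 * norm (z - z0)))"
        using elim by (intro sum_norm_le) (auto simp: norm_mult intro!: mult_left_mono)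
      also have "\<dots> = e2 * N * norm (z - z0)"
        by (simp add: N_def sum_distrib_right sum_distrib_left algebra_simps)
      also have "\<dots> \<le> e / 2 * norm (z - z0)" using e2 by (intro mult_right_mono) auto
      finally have 3: "norm ((\<Sum>i<k. D i x * h z i) - (\<Sum>i<k. D i x * g i) * (z - z0)) \<le> e / 2 * norm (z - z0)" .
      have "F (\<gamma> z) - F (\<gamma> z0) - (\<Sum>i<k. D i x * g i) * (z - z0) =
        (F (\<gamma> z) - F x - (\<Sum>i<k. D i x * h z i)) +
        ((\<Sum>i<k. D i x * h z i) - (\<Sum>i<k. D i x * g i) * (z - z0))"
        by (simp add: x_def)
      then show ?case using 2 3 norm_triangle_ineq[of "F (\<gamma> z) - F x - (\<Sum>i<k. D i x * h z i)"
          "(\<Sum>i<k. D i x * h z i) - (\<Sum>i<k. D i x * g i) * (z - z0)"] by (simp add: field_simps)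
    qed
  qed
  then show "(\<lambda>z. F (\<gamma> z)) field_differentiable at z0 within V"
    using field_differentiable_at_within field_differentiable_def by blast
qed

section \<open>From continuity and holomorphy along curves to continuous differentiability\<close>

lemma open_cylinder:
  fixes S :: "nat \<Rightarrow> 'a::topological_space set"
  assumes "\<And>i. i < n \<Longrightarrow> open (S i)"
  shows "open {x. \<forall>i<n. x i \<in> S i}"
proof -
  have "open {f. \<forall>i\<in>{..<n}. f (id i) \<in> S i}"
    by (rule product_topology_basis') (use assms in auto)
  moreover have "{f. \<forall>i\<in>{..<n}. f (id i) \<in> S i} = {x. \<forall>i<n. x i \<in> S i}" by auto
  ultimately show ?thesis by simp
qed

text \<open>Brings the product topology into the form of an epsilon-delta statement. If no common
  \<open>\<eta>\<close> existed, counterexamples with tolerance \<open>1 / (m + 1)\<close> would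
  converge to \<open>x\<close> coordinatewise, hence in the product topology.\<close>

lemma continuous_on_finite_coordinates:
  fixes G :: "(nat \<Rightarrow> complex) \<Rightarrow> complex"
  assumes op: "open A" and cont: "continuous_on A G" and x: "x \<in> A" and e: "e > 0"
  shows "\<exists>\<eta>>0. \<forall>y. (\<forall>i<n. cmod (y i - x i) < \<eta>) \<and> (\<forall>i\<ge>n. y i = x i) \<longrightarrow>
     y \<in> A \<and> cmod (G y - G x) < e"
proof (rule ccontr)
  assume "\<not> ?thesis"
  then have "\<forall>m::nat. \<exists>y. ((\<forall>i<n. cmod (y i - x i) < inverse (real (Suc m))) \<and> (\<forall>i\<ge>n. y i = x i)) \<and>
     \<not> (y \<in> A \<and> cmod (G y - G x) < e)"
    by (metis inverse_positive_iff_positive of_nat_0_less_iff zero_less_Suc)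
  then obtain Y where Y: "\<And>m i. i < n \<Longrightarrow> cmod (Y m i - x i) < inverse (real (Suc m))"
    "\<And>m i. i \<ge> n \<Longrightarrow> Y m i = x i" and bad: "\<And>m. \<not> (Y m \<in> A \<and> cmod (G (Y m) - G x) < e)"
    by metis
  have "Y \<longlonglongrightarrow> x"
  proof (rule tendsto_fun_coordinatewise)
    fix i
    have "(\<lambda>m. Y m i - x i) \<longlonglongrightarrow> 0"
    proof (cases "i < n")
      case True
      then show ?thesis
        by (intro Lim_null_comparison[OF _ LIMSEQ_inverse_real_of_nat])
          (intro always_eventually allI less_imp_le Y)
    qed (simp add: Y)
    then show "(\<lambda>m. Y m i) \<longlonglongrightarrow> x i" by (simp add: LIM_zero_iff)
  qed
  then have "\<forall>\<^sub>F m in sequentially. Y m \<in> A"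
    using op x by (rule topological_tendstoD)
  moreover have "isCont G x" using continuous_on_eq_continuous_at[OF op, of G] cont x by blast
  then have "(\<lambda>m. G (Y m)) \<longlonglongrightarrow> G x" using \<open>Y \<longlonglongrightarrow> x\<close> by (rule isCont_tendsto_compose)
  then have "\<forall>\<^sub>F m in sequentially. dist (G (Y m)) (G x) < e" using e by (rule tendstoD)
  ultimately have "\<forall>\<^sub>F m in sequentially. Y m \<in> A \<and> dist (G (Y m)) (G x) < e"
    using eventually_conj by blast
  then show False using bad by (auto simp: dist_norm)
qed

text \<open>Coordinate lines are holomorphic curves, so the partial derivatives exist; Cauchy's
  inequality makes them continuous, and changing one coordinate at a time gives Frechet
  differentiability. The work takes place on the cylinder \<open>A\<close> because it is open among
  all sequences, which \<open>prod_tail n S {0}\<close> is not.\<close>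

lemma hol_along_imp_C1_on:
  fixes n :: nat and S :: "nat \<Rightarrow> complex set"
  defines "A \<equiv> {x. \<forall>i<n. x i \<in> S i}"
  assumes op: "\<And>i. i < n \<Longrightarrow> open (S i)"
    and cont: "continuous_on A F" and hol: "hol_along n A F"
  shows "C1_on n (prod_tail n S {0}) F"
proof -
  have opA: "open A" unfolding A_def using op by (rule open_cylinder)
  have PA: "prod_tail n S {0} \<subseteq> A" by (auto simp: prod_tail_def A_def)
  define D where "D = (\<lambda>i x. deriv (\<lambda>z. F (x(i := z))) (x i))"
  have hol1: "(\<lambda>z. F (x(i := z))) holomorphic_on S i" if "x \<in> A" "i < n" for x i
  proof (rule hol_alongD[OF hol])
    show "(\<lambda>z. (x(i := z)) l) holomorphic_on S i" for l
      by (cases "l = i") (simp_all add: holomorphic_on_ident holomorphic_on_const)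
  qed (use that op in \<open>auto simp: A_def\<close>)
  have contD: "continuous_on A (D i)" if i: "i < n" for i
    unfolding continuous_on_def
  proof (intro ballI tendstoI)
    fix x0 and e :: real assume x0: "x0 \<in> A" and e: "e > 0"
    have "x0 i \<in> S i" using x0 i by (auto simp: A_def)
    then obtain r where r: "r > 0" "cball (x0 i) (2 * r) \<subseteq> S i"
      using op[OF i] by (metis open_contains_cball mult_2 field_sum_of_halves half_gt_zero)
    let ?C = "cball (x0 i) (2 * r)"
    have cupd: "continuous_on (A \<times> ?C) (\<lambda>p. (fst p)(i := snd p))"
    proof (rule continuous_on_coordinatewise_then_product)
      fix l show "continuous_on (A \<times> ?C) (\<lambda>p. ((fst p)(i := snd p)) l)"
        by (cases "l = i")
          (simp_all add: continuous_on_snd continuous_on_id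
            continuous_on_product_then_coordinatewise[OF continuous_on_fst[OF continuous_on_id]])
    qed
    have "continuous_on (A \<times> ?C) (\<lambda>p. F ((fst p)(i := snd p)))"
      by (rule continuous_on_compose2[OF cont cupd]) (use r in \<open>auto simp: A_def\<close>)
    \<comment> \<open>Compactness of the disc makes the closeness uniform in \<open>t\<close>. The
      tolerance \<open>e / 2 * r\<close> is what Cauchy's inequality at radius \<open>r\<close>
      turns into \<open>e / 2\<close> for the derivatives.\<close>
    then obtain X0 where X0: "x0 \<in> X0" "open X0"
      "\<forall>x\<in>X0 \<inter> A. \<forall>t\<in>?C. dist (F (x(i := t))) (F (x0(i := t))) \<le> e / 2 * r"
      using continuous_on_prod_compactE[of A ?C "\<lambda>p. F ((fst p)(i := snd p))" x0 "e / 2 * r"]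
        x0 e r by auto
    have lim: "((\<lambda>x. x i) \<longlongrightarrow> x0 i) (at x0 within A)"
      by (rule tendsto_fun_coordinate) (rule tendsto_ident_at)
    have "isCont (deriv (\<lambda>z. F (x0(i := z)))) (x0 i)"
      using holomorphic_on_imp_continuous_on[OF holomorphic_deriv[OF hol1[OF x0 i] op[OF i]]]
        \<open>x0 i \<in> S i\<close> op[OF i] by (simp add: continuous_on_eq_continuous_at)
    then have "((\<lambda>x. deriv (\<lambda>z. F (x0(i := z))) (x i)) \<longlongrightarrow> D i x0) (at x0 within A)"
      unfolding D_def using lim by (rule isCont_tendsto_compose)
    then have ev2: "\<forall>\<^sub>F x in at x0 within A. dist (deriv (\<lambda>z. F (x0(i := z))) (x i)) (D i x0) < e / 2"
      using e by (intro tendstoD) auto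
    have ev1: "\<forall>\<^sub>F x in at x0 within A. x \<in> X0" and evA: "\<forall>\<^sub>F x in at x0 within A. x \<in> A"
      using X0 by (auto simp: eventually_at_topological)
    have ev3: "\<forall>\<^sub>F x in at x0 within A. dist (x i) (x0 i) < r" using lim r by (intro tendstoD) auto
    from ev1 evA ev2 ev3 show "\<forall>\<^sub>F x in at x0 within A. dist (D i x) (D i x0) < e"
    proof eventually_elim
      case (elim x)
      have sub: "cball (x i) r \<subseteq> ?C"
      proof
        fix w assume "w \<in> cball (x i) r"
        then show "w \<in> ?C" using elim(4) dist_triangle[of "x0 i" w "x i"] by (auto simp: dist_commute)
      qed
      let ?g = "\<lambda>z. F (x(i := z)) - F (x0(i := z))"
      have holg: "?g holomorphic_on S i" using hol1 elim x0 i by (intro holomorphic_intros) auto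
      have "norm ((deriv ^^ 1) ?g (x i)) \<le> fact 1 * (e / 2 * r) / r ^ 1"
      proof (rule Cauchy_inequality)
        show "?g holomorphic_on ball (x i) r"
          by (rule holomorphic_on_subset[OF holg]) (use sub r ball_subset_cball in blast)
        show "continuous_on (cball (x i) r) ?g"
          by (rule holomorphic_on_imp_continuous_on[OF holomorphic_on_subset[OF holg]]) (use sub r in blast)
        show "norm (F (x(i := z)) - F (x0(i := z))) \<le> e / 2 * r" if "norm (x i - z) = r" for z
          using X0(3) elim sub that by (auto simp: dist_norm)
      qed (use r in auto)
      moreover have "x i \<in> S i" using elim i by (auto simp: A_def)
      then have "deriv ?g (x i) = D i x - deriv (\<lambda>z. F (x0(i := z))) (x i)"
        unfolding D_def using hol1[OF elim(2) i] hol1[OF x0 i] op[OF i]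
        by (intro deriv_diff) (auto intro: holomorphic_on_imp_differentiable_at)
      ultimately have "dist (D i x) (deriv (\<lambda>z. F (x0(i := z))) (x i)) \<le> e / 2"
        using r by (simp add: dist_norm)
      then show ?case using elim(3) dist_triangle[of "D i x" "D i x0" "deriv (\<lambda>z. F (x0(i := z))) (x i)"]
        by linarith
    qed
  qed
  show ?thesis unfolding C1_on_def
  proof (intro exI[of _ D] conjI ballI allI impI)
    show "continuous_on (prod_tail n S {0}) (D i)" if "i < n" for i
      using contD[OF that] PA continuous_on_subset by blast
    fix x and \<epsilon> :: real assume xP: "x \<in> prod_tail n S {0}" and \<epsilon>: "\<epsilon> > 0"
    have x: "x \<in> A" using xP PA by blast
    \<comment> \<open>Each of the \<open>n\<close> coordinate changes below may cost
      \<open>\<epsilon>1\<close> times the length of \<open>h\<close>.\<close>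
    define \<epsilon>1 where "\<epsilon>1 = \<epsilon> / (real n + 1)"
    have \<epsilon>1: "\<epsilon>1 > 0" "real n * \<epsilon>1 \<le> \<epsilon>" using \<epsilon> by (auto simp: \<epsilon>1_def field_simps)
    have "\<forall>m. \<exists>\<eta>>0. m < n \<longrightarrow> (\<forall>y. (\<forall>i<n. cmod (y i - x i) < \<eta>) \<and> (\<forall>i\<ge>n. y i = x i) \<longrightarrow>
          y \<in> A \<and> cmod (D m y - D m x) < \<epsilon>1)"
    proof
      fix m
      show "\<exists>\<eta>>0. m < n \<longrightarrow> (\<forall>y. (\<forall>i<n. cmod (y i - x i) < \<eta>) \<and> (\<forall>i\<ge>n. y i = x i) \<longrightarrow>
          y \<in> A \<and> cmod (D m y - D m x) < \<epsilon>1)"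
      proof (cases "m < n")
        case True
        show ?thesis
          using continuous_on_finite_coordinates[OF opA contD[OF True] x \<epsilon>1(1), of n] by blast
      qed (use zero_less_one in blast)
    qed
    then obtain \<eta>s where \<eta>s: "\<And>m. \<eta>s m > 0" "\<And>m y. m < n \<Longrightarrow> \<forall>i<n. cmod (y i - x i) < \<eta>s m \<Longrightarrow>
         \<forall>i\<ge>n. y i = x i \<Longrightarrow> y \<in> A \<and> cmod (D m y - D m x) < \<epsilon>1"
      by metis
    define \<eta> where "\<eta> = Min (insert 1 (\<eta>s ` {..<n}))"
    have \<eta>: "\<eta> > 0" unfolding \<eta>_def using \<eta>s(1) by (subst Min_gr_iff) auto
    have \<eta>2: "y \<in> A \<and> cmod (D m y - D m x) < \<epsilon>1"
      if "m < n" "\<forall>i<n. cmod (y i - x i) < \<eta>" "\<forall>i\<ge>n. y i = x i" for m y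
    proof -
      have "\<eta> \<le> \<eta>s m" unfolding \<eta>_def using that(1) by (intro Min_le) auto
      then have "\<forall>i<n. cmod (y i - x i) < \<eta>s m" using that(2) by (meson order.strict_trans2)
      then show ?thesis using that by (intro \<eta>s(2))
    qed
    have "cmod (F (\<lambda>i. x i + h i) - F x - (\<Sum>i<n. D i x * h i)) \<le> \<epsilon> * L2_set (\<lambda>i. cmod (h i)) {..<n}"
      if h0: "\<forall>i\<ge>n. h i = 0" and hL: "L2_set (\<lambda>i. cmod (h i)) {..<n} < \<eta>" for h
    proof -
      \<comment> \<open>A staircase from \<open>x\<close> to \<open>x + h\<close>: passing from
        \<open>y m\<close> to \<open>y (Suc m)\<close> changes coordinate \<open>m\<close> only, so
        the mean value inequality in one variable applies.\<close>
      define y where "y = (\<lambda>m i. if i < m then x i + h i else x i)"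
      have hi: "cmod (h i) \<le> L2_set (\<lambda>i. cmod (h i)) {..<n}" if "i < n" for i
        using that by (intro member_le_L2_set) auto
      have step: "cmod (F (y (Suc m)) - F (y m) - D m x * h m) \<le> \<epsilon>1 * cmod (h m)" if m: "m < n" for m
      proof -
        let ?\<psi> = "\<lambda>z. F ((y m)(m := z)) - D m x * z"
        have in\<eta>: "(y m)(m := z) \<in> A \<and> cmod (D m ((y m)(m := z)) - D m x) < \<epsilon>1" if "z \<in> ball (x m) \<eta>" for z
        proof (rule \<eta>2[OF m])
          show "\<forall>i<n. cmod (((y m)(m := z)) i - x i) < \<eta>"
            using that hi hL \<eta> by (force simp: y_def dist_norm norm_minus_commute)
          show "\<forall>i\<ge>n. ((y m)(m := z)) i = x i" using m by (auto simp: y_def)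
        qed
        have der: "(?\<psi> has_field_derivative (D m ((y m)(m := z)) - D m x)) (at z within ball (x m) \<eta>)"
          if z: "z \<in> ball (x m) \<eta>" for z
        proof -
          have "(y m)(m := z) \<in> A" using in\<eta>[OF z] by blast
          moreover from this have "z \<in> S m" using m by (auto simp: A_def)
          ultimately have "((\<lambda>w. F ((y m)(m := w))) has_field_derivative D m ((y m)(m := z))) (at z)"
            unfolding D_def using holomorphic_derivI[OF hol1[of "(y m)(m := z)" m] op[OF m]] m by simp
          then have "(?\<psi> has_field_derivative (D m ((y m)(m := z)) - D m x * 1)) (at z)"
            by (intro DERIV_diff DERIV_cmult DERIV_ident)
          then show ?thesis by (simp add: has_field_derivative_at_within)
        qed
        have "cmod (?\<psi> (x m + h m) - ?\<psi> (x m)) \<le> \<epsilon>1 * cmod (x m + h m - x m)"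
        proof (rule field_differentiable_bound[OF convex_ball der])
          show "cmod (D m ((y m)(m := z)) - D m x) \<le> \<epsilon>1" if "z \<in> ball (x m) \<eta>" for z
            using in\<eta>[OF that] by simp
          show "x m + h m \<in> ball (x m) \<eta>" using hi[OF m] hL by (simp add: dist_norm)
          show "x m \<in> ball (x m) \<eta>" using \<eta> by simp
        qed
        moreover have "(y m)(m := x m + h m) = y (Suc m)" "(y m)(m := x m) = y m"
          by (auto simp: y_def less_Suc_eq)
        ultimately show ?thesis by (simp add: algebra_simps)
      qed
      have "(\<lambda>i. x i + h i) = y n" "x = y 0" using h0 by (auto simp: y_def)
      then have "F (\<lambda>i. x i + h i) - F x - (\<Sum>i<n. D i x * h i) =
          (\<Sum>m<n. F (y (Suc m)) - F (y m) - D m x * h m)"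
        using sum_lessThan_telescope[of "\<lambda>m. F (y m)" n] by (simp add: sum_subtractf)
      also have "cmod \<dots> \<le> (\<Sum>m<n. \<epsilon>1 * L2_set (\<lambda>i. cmod (h i)) {..<n})"
        using step hi \<epsilon>1 by (intro sum_norm_le) (meson lessThan_iff mult_left_mono order_trans less_imp_le)
      also have "\<dots> = real n * \<epsilon>1 * L2_set (\<lambda>i. cmod (h i)) {..<n}" by simp
      also have "\<dots> \<le> \<epsilon> * L2_set (\<lambda>i. cmod (h i)) {..<n}"
        using \<epsilon>1 by (intro mult_right_mono) auto
      finally show ?thesis .
    qed
    then show "\<exists>\<eta>>0. \<forall>h. (\<forall>i\<ge>n. h i = 0) \<and> L2_set (\<lambda>i. cmod (h i)) {..<n} < \<eta> \<and>
          (\<lambda>i. x i + h i) \<in> prod_tail n S {0} \<longrightarrow>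
          cmod (F (\<lambda>i. x i + h i) - F x - (\<Sum>i<n. D i x * h i))
            \<le> \<epsilon> * L2_set (\<lambda>i. cmod (h i)) {..<n}"
      using \<eta> by blast
  qed
qed

subsection \<open>The product measure\<close>

lemma space_lam [simp]: "space lam = U1"
  by (simp add: lam_def space_restrict_space space_scale_measure)

lemma sets_lam: "sets lam = sets (restrict_space borel U1)"
  by (simp add: lam_def sets_restrict_space)

text \<open>Makes the integration rules for densities applicable to the scaled measure.\<close>

lemma lam_eq_density: "lam = density (restrict_space lborel U1) (\<lambda>_. ennreal (1/2))"
proof (rule measure_eqI)
  show "emeasure lam A = emeasure (density (restrict_space lborel U1) (\<lambda>_. ennreal (1/2))) A"
    if "A \<in> sets lam" for A
  proof -
    have "ennreal (1/2) = 1/2" using divide_ennreal[of 1 2] by simp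
    then show ?thesis using that unfolding lam_def
      by (simp only: emeasure_scale_measure sets_scale_measure emeasure_density_const)
  qed
qed (simp add: lam_def)

lemma measurable_lam:
  fixes g :: "real \<Rightarrow> complex"
  assumes "continuous_on U1 g" shows "g \<in> borel_measurable lam"
  using borel_measurable_continuous_on_restrict[OF assms]
  by (simp cong: measurable_cong_sets add: sets_lam)

lemma lam_integral:
  fixes g :: "real \<Rightarrow> complex"
  assumes "g \<in> borel_measurable lam"
  shows "(\<integral>s. g s \<partial>lam) = (1/2) * (\<integral>s. indicator U1 s *\<^sub>R g s \<partial>lborel)"
proof -
  have "g \<in> borel_measurable (restrict_space lborel U1)"
    using assms unfolding lam_def
    by (simp cong: measurable_cong_sets)
  then have "(\<integral>s. g s \<partial>lam) = (\<integral>s. (1/2) *\<^sub>R g s \<partial>restrict_space lborel U1)"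
    unfolding lam_eq_density by (subst integral_density) auto
  also have "\<dots> = (1/2) * (\<integral>s. g s \<partial>restrict_space lborel U1)"
    by (simp add: scaleR_conv_of_real)
  also have "(\<integral>s. g s \<partial>restrict_space lborel U1) = (\<integral>s. indicator U1 s *\<^sub>R g s \<partial>lborel)"
    by (subst integral_restrict_space) (auto simp: U1_def)
  finally show ?thesis .
qed

lemma prob_space_lam: "prob_space lam"
proof
  have "emeasure lam (space lam) = 1/2 * emeasure (restrict_space lborel U1) U1"
    by (simp only: space_lam) (simp only: lam_def emeasure_scale_measure)
  also have "emeasure (restrict_space lborel U1) U1 = emeasure lborel U1"
    by (rule emeasure_restrict_space) (auto simp: U1_def)
  also have "1/2 * emeasure lborel U1 = ennreal (1/2) * emeasure lborel U1"
    using divide_ennreal[of 1 2] by simp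
  also have "\<dots> = ennreal (1/2) * ennreal 2" by (simp add: U1_def)
  also have "\<dots> = 1" by (subst ennreal_mult[symmetric]) auto
  finally show "emeasure lam (space lam) = 1" .
qed

interpretation lam: prob_space lam by (rule prob_space_lam)
interpretation lam_seq: sequence_space lam by unfold_locales
interpretation mu: prob_space mu unfolding mu_def by (rule lam_seq.P.prob_space_axioms)

lemma space_mu [simp]: "space mu = U"
  by (auto simp: mu_def space_PiM U_def PiE_UNIV_domain)

text \<open>Coordinates are measurable for the product measure, and countably many measurable
  coordinates give a Borel map into the sequence space with its product topology.\<close>

lemma measurable_mu:
  fixes G :: "(nat \<Rightarrow> real) \<Rightarrow> complex"
  assumes "continuous_on U G" shows "G \<in> borel_measurable mu"
proof -
  have "(\<lambda>s. s) \<in> measurable lam borel"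
    by (simp cong: measurable_cong_sets add: sets_lam measurable_restrict_space1)
  then have "(\<lambda>y. y i) \<in> borel_measurable mu" for i
    unfolding mu_def using measurable_compose[OF measurable_component_singleton[of i UNIV "\<lambda>_. lam"]] by fastforce
  then have "(\<lambda>y. y) \<in> borel_measurable mu"
    by (rule measurable_coordinatewise_then_product)
  then have "(\<lambda>y. y) \<in> measurable mu (restrict_space borel U)"
    by (intro measurable_restrict_space2) auto
  from measurable_compose[OF this borel_measurable_continuous_on_restrict[OF assms]] show ?thesis .
qed

text \<open>Prepending an independent \<open>lam\<close>-distributed entry to a
  \<open>mu\<close>-distributed sequence gives \<open>mu\<close> again; the rest is Fubini.\<close>

lemma mu_integral_iterate:
  fixes G :: "(nat \<Rightarrow> real) \<Rightarrow> complex"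
  assumes "integrable mu G"
  shows "(\<integral>t. G t \<partial>mu) = (\<integral>s. \<integral>\<omega>. G (case_nat s \<omega>) \<partial>mu \<partial>lam)"
proof -
  interpret pair_sigma_finite lam mu ..
  have m: "(\<lambda>(s, \<omega>). case_nat s \<omega>) \<in> measurable (lam \<Otimes>\<^sub>M mu) mu"
    unfolding mu_def by measurable
  have iter: "distr (lam \<Otimes>\<^sub>M mu) mu (\<lambda>(s, \<omega>). case_nat s \<omega>) = mu"
    using lam_seq.PiM_iter by (simp add: mu_def)
  have "(\<integral>t. G t \<partial>mu) = (\<integral>p. G (case p of (s, \<omega>) \<Rightarrow> case_nat s \<omega>) \<partial>(lam \<Otimes>\<^sub>M mu))"
    using assms by (subst iter[symmetric], subst integral_distr[OF m]) auto
  also have "integrable (lam \<Otimes>\<^sub>M mu) (\<lambda>p. G (case p of (s, \<omega>) \<Rightarrow> case_nat s \<omega>))"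
    using assms by (subst (asm) iter[symmetric], subst (asm) integrable_distr_eq[OF m]) auto
  from integral_fst'[OF this, symmetric]
  have "(\<integral>p. G (case p of (s, \<omega>) \<Rightarrow> case_nat s \<omega>) \<partial>(lam \<Otimes>\<^sub>M mu)) = (\<integral>s. \<integral>\<omega>. G (case_nat s \<omega>) \<partial>mu \<partial>lam)"
    by simp
  finally show ?thesis .
qed

lemma (in prob_space) norm_integral_le_const:
  fixes g :: "'a \<Rightarrow> complex"
  assumes "g \<in> borel_measurable M" "\<And>x. x \<in> space M \<Longrightarrow> norm (g x) \<le> B"
  shows "norm (\<integral>x. g x \<partial>M) \<le> B"
proof -
  have "integrable M g" using assms by (intro integrable_const_bound[of _ B]) auto
  have "norm (\<integral>x. g x \<partial>M) \<le> (\<integral>x. norm (g x) \<partial>M)" by (rule integral_norm_bound)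
  also have "\<dots> \<le> B" using \<open>integrable M g\<close> assms by (intro integral_le_const) auto
  finally show ?thesis .
qed

lemma (in prob_space) Re_integral_ge_const:
  fixes g :: "'a \<Rightarrow> complex"
  assumes "g \<in> borel_measurable M" "\<And>x. x \<in> space M \<Longrightarrow> norm (g x) \<le> B"
    and "\<And>x. x \<in> space M \<Longrightarrow> c \<le> Re (g x)"
  shows "c \<le> Re (\<integral>x. g x \<partial>M)"
proof -
  have "integrable M g" using assms by (intro integrable_const_bound[of _ B]) auto
  then have "Re (\<integral>x. g x \<partial>M) = (\<integral>x. Re (g x) \<partial>M)" by simp
  also have "c \<le> \<dots>" using \<open>integrable M g\<close> assms by (intro integral_ge_const) auto
  finally show ?thesis .
qed

text \<open>Parametrised over \<open>[-1, 1]\<close>, from \<open>a\<close> at -1 to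
  \<open>b\<close> at 1, so that the probability measure \<open>lam\<close> averages uniformly over
  the segment.\<close>

definition seg :: "complex \<Rightarrow> complex \<Rightarrow> real \<Rightarrow> complex" where
  "seg a b \<sigma> = a + of_real ((1 + \<sigma>) / 2) * (b - a)"

text \<open>The fundamental theorem of calculus along the segment: the speed
  \<open>(b - a) / 2\<close> already contains the factor 1/2 of \<open>lam\<close>.\<close>

lemma lam_integral_segment:
  fixes a b :: complex
  assumes S: "convex S" "a \<in> S" "b \<in> S" and cont: "continuous_on S p"
    and P: "\<And>z. z \<in> S \<Longrightarrow> (P has_field_derivative p z) (at z within S)"
  shows "(b - a) * (\<integral>\<sigma>. p (seg a b \<sigma>) \<partial>lam) = P b - P a"
proof -
  define \<gamma> where "\<gamma> = seg a b"
  have \<gamma>S: "\<gamma> \<sigma> \<in> S" if "\<sigma> \<in> {-1..1}" for \<sigma>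
  proof -
    have "(1 - (1 + \<sigma>) / 2) *\<^sub>R a + ((1 + \<sigma>) / 2) *\<^sub>R b \<in> S"
      using that by (intro convexD_alt[OF S]) auto
    moreover have "\<gamma> \<sigma> = (1 - (1 + \<sigma>) / 2) *\<^sub>R a + ((1 + \<sigma>) / 2) *\<^sub>R b"
      unfolding \<gamma>_def seg_def scaleR_conv_of_real of_real_diff
      by (simp only: algebra_simps of_real_1 mult_1_left mult_1_right)
    ultimately show ?thesis by simp
  qed
  have d\<gamma>: "(\<gamma> has_vector_derivative (b - a) / 2) (at \<sigma> within X)" for \<sigma> X
  proof -
    have "((\<lambda>\<sigma>. a + (\<sigma> *\<^sub>R ((b - a) / 2) + (b - a) / 2)) has_vector_derivative (b - a) / 2) (at \<sigma> within X)"
      by (auto intro!: derivative_eq_intros)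
    moreover have "\<gamma> = (\<lambda>\<sigma>. a + (\<sigma> *\<^sub>R ((b - a) / 2) + (b - a) / 2))"
      by (auto simp: \<gamma>_def seg_def scaleR_conv_of_real field_simps)
    ultimately show ?thesis by simp
  qed
  have c\<gamma>: "continuous_on {-1..1} (\<lambda>\<sigma>. p (\<gamma> \<sigma>))"
    by (rule continuous_on_compose2[OF cont]) (use \<gamma>S in \<open>auto simp: \<gamma>_def seg_def intro!: continuous_intros\<close>)
  have "(\<integral>\<sigma>. indicator {-1..1} \<sigma> *\<^sub>R ((b - a) / 2 * p (\<gamma> \<sigma>)) \<partial>lborel) = P (\<gamma> 1) - P (\<gamma> (-1))"
  proof (rule integral_FTC_Icc)
    fix \<sigma> :: real assume "-1 \<le> \<sigma>" "\<sigma> \<le> 1"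
    then have \<sigma>: "\<sigma> \<in> {-1..1}" by auto
    have "((P \<circ> \<gamma>) has_vector_derivative (b - a) / 2 * p (\<gamma> \<sigma>)) (at \<sigma> within {-1..1})"
      by (rule field_vector_diff_chain_within[OF d\<gamma>])
        (rule DERIV_subset[OF P[OF \<gamma>S[OF \<sigma>]]], use \<gamma>S in blast)
    then show "((\<lambda>\<sigma>. P (\<gamma> \<sigma>)) has_vector_derivative (b - a) / 2 * p (\<gamma> \<sigma>)) (at \<sigma> within {-1..1})"
      by (simp add: o_def)
  qed (auto intro!: continuous_intros c\<gamma>)
  moreover have "(\<integral>\<sigma>. p (\<gamma> \<sigma>) \<partial>lam) = 1 / 2 * (\<integral>\<sigma>. indicator {-1..1} \<sigma> *\<^sub>R p (\<gamma> \<sigma>) \<partial>lborel)"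
    using c\<gamma> by (subst lam_integral[OF measurable_lam]) (auto simp: U1_def)
  moreover have "(\<integral>\<sigma>. indicator {-1..1} \<sigma> *\<^sub>R ((b - a) / 2 * p (\<gamma> \<sigma>)) \<partial>lborel)
     = (b - a) / 2 * (\<integral>\<sigma>. indicator {-1..1} \<sigma> *\<^sub>R p (\<gamma> \<sigma>) \<partial>lborel)"
    by (subst integral_mult_right_zero[symmetric], rule Bochner_Integration.integral_cong) auto
  moreover have "\<gamma> 1 = b" "\<gamma> (-1) = a" by (auto simp: \<gamma>_def seg_def diff_divide_distrib)
  moreover have "(b - a) * (1 / 2 * I) = (b - a) / 2 * I" for I :: complex by simp
  ultimately have "(b - a) * (\<integral>\<sigma>. p (\<gamma> \<sigma>) \<partial>lam) = P b - P a" by metis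
  then show ?thesis by (simp add: \<gamma>_def)
qed

text \<open>The factor 2 undoes the normalisation of \<open>lam\<close>. This is the bridge from
  real distribution functions to complex primitives.\<close>

lemma lam_integral_initial:
  fixes p :: "complex \<Rightarrow> complex"
  assumes s: "s \<in> U1" and S: "of_real ` U1 \<subseteq> S" and cont: "continuous_on S p"
    and P: "\<And>z. z \<in> S \<Longrightarrow> (P has_field_derivative p z) (at z within S)"
  shows "2 * (\<integral>\<sigma>. indicator {-1..s} \<sigma> *\<^sub>R p (of_real \<sigma>) \<partial>lam) = P (of_real s) - P (-1)"
proof -
  have sub: "{-1..s} \<subseteq> U1" using s by (auto simp: U1_def)
  have c: "continuous_on U1 (\<lambda>\<sigma>. p (of_real \<sigma>))"
    by (rule continuous_on_compose2[OF cont]) (use S in \<open>auto intro!: continuous_intros\<close>)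
  have "{-1..s} \<inter> U1 \<in> sets lam" unfolding sets_lam sets_restrict_space
    by (metis Int_commute image_eqI borel_closed closed_atLeastAtMost)
  moreover have "{-1..s} \<inter> U1 = {-1..s}" using sub by auto
  ultimately have m: "(\<lambda>\<sigma>. indicator {-1..s} \<sigma> *\<^sub>R p (of_real \<sigma>)) \<in> borel_measurable lam"
    by (intro borel_measurable_scaleR borel_measurable_indicator measurable_lam[OF c]) metis
  have "2 * (\<integral>\<sigma>. indicator {-1..s} \<sigma> *\<^sub>R p (of_real \<sigma>) \<partial>lam)
      = (\<integral>\<sigma>. indicator U1 \<sigma> *\<^sub>R (indicator {-1..s} \<sigma> *\<^sub>R p (of_real \<sigma>)) \<partial>lborel)"
    by (subst lam_integral[OF m]) simp
  also have "\<dots> = (\<integral>\<sigma>. indicator {-1..s} \<sigma> *\<^sub>R p (of_real \<sigma>) \<partial>lborel)"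
    using sub by (intro Bochner_Integration.integral_cong) (auto simp: indicator_def)
  also have "\<dots> = P (of_real s) - P (of_real (-1))"
  proof (rule integral_FTC_Icc)
    show "-1 \<le> s" using s by (auto simp: U1_def)
    show "continuous_on {-1..s} (\<lambda>\<sigma>. p (of_real \<sigma>))" by (rule continuous_on_subset[OF c sub])
    fix \<sigma> assume "-1 \<le> \<sigma>" "\<sigma> \<le> s"
    then have \<sigma>: "\<sigma> \<in> {-1..s}" by auto
    have "((P \<circ> of_real) has_vector_derivative 1 * p (of_real \<sigma>)) (at \<sigma> within {-1..s})"
    proof (rule field_vector_diff_chain_within)
      show "(of_real has_vector_derivative (1::complex)) (at \<sigma> within {-1..s})"
        unfolding of_real_def by (auto intro!: derivative_eq_intros)
      show "(P has_field_derivative p (of_real \<sigma>)) (at (of_real \<sigma>) within of_real ` {-1..s})"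
        by (rule DERIV_subset[OF P]) (use \<sigma> sub S in blast)+
    qed
    then show "((\<lambda>\<sigma>. P (of_real \<sigma>)) has_vector_derivative p (of_real \<sigma>)) (at \<sigma> within {-1..s})"
      by (simp add: o_def)
  qed
  finally show ?thesis by simp
qed

section \<open>Neighbourhoods of the interval and cylinders over them\<close>

lemma in_nbhd_iff: "z \<in> nbhd r D \<longleftrightarrow> (\<exists>u\<in>D. cmod (z - u) < r)"
  unfolding nbhd_def by (force intro: exI[of _ "z - _"])

lemma nbhd_U1c_iff: "z \<in> nbhd r U1c \<longleftrightarrow> (\<exists>u\<in>U1. cmod (z - of_real u) < r)"
  by (simp add: in_nbhd_iff U1c_def)

lemma open_nbhd: "open (nbhd r D)"
proof -
  have "nbhd r D = (\<Union>u\<in>D. ball u r)"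
    by (auto simp: in_nbhd_iff dist_norm norm_minus_commute)
  then show ?thesis by (simp add: open_UN)
qed

lemma convex_nbhd:
  assumes "convex D" shows "convex (nbhd r D)"
proof -
  have "nbhd r D = (\<Union>x\<in>ball 0 r. \<Union>y\<in>D. {x + y})"
    by (auto simp: nbhd_def) blast
  then show ?thesis using convex_sums[OF convex_ball[of 0 r] assms] by metis
qed

lemma convex_U1c: "convex U1c"
proof -
  have "U1c = (\<lambda>s. s *\<^sub>R 1) ` U1" by (auto simp: U1c_def scaleR_conv_of_real)
  then show ?thesis unfolding U1_def
    using convex_linear_image[of "\<lambda>s::real. s *\<^sub>R (1::complex)" "{-1..1}"]
    by (simp add: linear_scaleR_left convex_real_interval)
qed

lemma of_real_in_nbhd: "s \<in> U1 \<Longrightarrow> r > 0 \<Longrightarrow> complex_of_real s \<in> nbhd r U1c"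
  by (force simp: nbhd_U1c_iff)

lemma nbhd_mono: "r \<le> r' \<Longrightarrow> nbhd r D \<subseteq> nbhd r' D"
  by (force simp: in_nbhd_iff)

text \<open>In contrast to \<open>cube_nbhd\<close>, coordinates from \<open>j\<close> on are free.
  This makes the set open and lets one sequence serve as argument for marginals of different
  order.\<close>

definition cyl :: "nat \<Rightarrow> (nat \<Rightarrow> real) \<Rightarrow> (nat \<Rightarrow> complex) set" where
  "cyl j r = {x. \<forall>i<j. x i \<in> nbhd (r i) U1c}"

lemma cpx_comb_seq: "cpx (comb_seq j x t) = comb_seq j (cpx x) (cpx t)"
  by (auto simp: cpx_def comb_seq_def)

lemma comb_seq_in_U: "x \<in> U \<Longrightarrow> t \<in> U \<Longrightarrow> comb_seq j x t \<in> U"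
  by (auto simp: U_def comb_seq_def)

subsection \<open>Complex marginals\<close>

lemma convex_combination_nbhd:
  assumes "a \<in> nbhd r U1c" "b \<in> nbhd r U1c" "\<sigma> \<in> U1"
  shows "seg a b \<sigma> \<in> nbhd r U1c"
proof -
  have "(1 - (1 + \<sigma>) / 2) *\<^sub>R a + ((1 + \<sigma>) / 2) *\<^sub>R b \<in> nbhd r U1c"
    using assms by (intro convexD_alt[OF convex_nbhd[OF convex_U1c]]) (auto simp: U1_def)
  moreover have "seg a b \<sigma> = (1 - (1 + \<sigma>) / 2) *\<^sub>R a + ((1 + \<sigma>) / 2) *\<^sub>R b"
    unfolding seg_def scaleR_conv_of_real of_real_diff
    by (simp only: algebra_simps of_real_1 mult_1_left mult_1_right)
  ultimately show ?thesis by simp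
qed

lemma convex_combination_U1:
  assumes "a \<in> U1" "b \<in> U1" "\<sigma> \<in> U1"
  shows "a + (1 + \<sigma>) / 2 * (b - a) \<in> U1"
proof -
  have "(1 - (1 + \<sigma>) / 2) *\<^sub>R a + ((1 + \<sigma>) / 2) *\<^sub>R b \<in> U1"
    using assms unfolding U1_def by (intro convexD_alt[OF convex_real_interval(5)]) auto
  moreover have "a + (1 + \<sigma>) / 2 * (b - a) = (1 - (1 + \<sigma>) / 2) *\<^sub>R a + ((1 + \<sigma>) / 2) *\<^sub>R b"
    by (simp add: left_diff_distrib right_diff_distrib)
  ultimately show ?thesis by simp
qed

lemma cyl_Suc_upd: "x(j := z) \<in> cyl (Suc j) r \<longleftrightarrow> x \<in> cyl j r \<and> z \<in> nbhd (r j) U1c"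
  by (auto simp: cyl_def less_Suc_eq)

lemma cyl_Suc: "x \<in> cyl (Suc j) r \<longleftrightarrow> x \<in> cyl j r \<and> x j \<in> nbhd (r j) U1c"
  by (auto simp: cyl_def less_Suc_eq)

lemma real_point_near:
  assumes "x \<in> cyl j r"
  obtains u where "u \<in> U" "\<And>i. i < j \<Longrightarrow> cmod (x i - of_real (u i)) < r i"
proof -
  have "\<forall>i. \<exists>u. i < j \<longrightarrow> u \<in> U1 \<and> cmod (x i - of_real u) < r i"
    using assms by (auto simp: cyl_def nbhd_U1c_iff)
  then obtain u where u: "\<And>i. i < j \<Longrightarrow> u i \<in> U1 \<and> cmod (x i - of_real (u i)) < r i" by metis
  show ?thesis
    by (rule that[of "\<lambda>i. if i < j then u i else 0"]) (use u in \<open>auto simp: U_def U1_def\<close>)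
qed

lemma continuous_on_fun_upd:
  fixes g :: "'a::topological_space \<Rightarrow> nat \<Rightarrow> complex"
  assumes g: "continuous_on S g" and h: "continuous_on S h"
  shows "continuous_on S (\<lambda>p. (g p)(j := h p))"
proof (rule continuous_on_coordinatewise_then_product)
  fix i show "continuous_on S (\<lambda>p. ((g p)(j := h p)) i)"
    using h continuous_on_product_then_coordinatewise[OF g, of i] by (cases "i = j") simp_all
qed

text \<open>What can be said about one density alone. The bound \<open>C1 \<le> M / 16\<close>
  leaves room both for real parts at least \<open>M / 2\<close> and for quotients of four
  marginals.\<close>

locale complex_density =
  fixes M L C1 :: real and k :: nat and \<delta> :: "nat \<Rightarrow> real" and f :: "(nat \<Rightarrow> complex) \<Rightarrow> complex"
  assumes dens: "density_hyps M L C1 k \<delta> f"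
    and \<delta>_pos: "\<And>j. j < k \<Longrightarrow> \<delta> j > 0"
    and M_pos: "0 < M" and M_le_L: "M \<le> L" and C1_pos: "0 < C1" and C1_le: "C1 \<le> M / 16"
begin

lemma L_pos: "0 < L" using M_pos M_le_L by linarith

lemma f_cont: "continuous_on (cube_nbhd_U k \<delta>) f"
  and f_real: "y \<in> U \<Longrightarrow> f (cpx y) \<in> \<real>"
  and f_pos: "y \<in> U \<Longrightarrow> 0 < Re (f (cpx y))"
  and f_int: "has_bochner_integral mu (\<lambda>y. Re (f (cpx y))) 1"
  and f_C1: "y \<in> U \<Longrightarrow> C1_on k (cube_nbhd k \<delta>) (\<lambda>x. f (comb_seq k x (cpx y)))"
  and f_lower: "z \<in> cube_nbhd_U k \<delta> \<Longrightarrow> M \<le> cmod (f z)"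
  and f_upper: "z \<in> cube_nbhd_U k \<delta> \<Longrightarrow> cmod (f z) \<le> L"
  and f_near: "u \<in> U \<Longrightarrow> h \<in> polydisc k \<delta> \<Longrightarrow> cmod (f (\<lambda>i. cpx u i + h i) - f (cpx u)) \<le> C1"
  and f_near_\<delta>: "u \<in> U \<Longrightarrow> 1 \<le> j \<Longrightarrow> j < k \<Longrightarrow> h \<in> polydisc j \<delta> \<Longrightarrow>
     cmod (f (\<lambda>i. cpx u i + h i) - f (cpx u)) \<le> C1 * \<delta> j"
  using dens by (auto simp: density_hyps_def)

lemma comb_seq_in_domain:
  assumes "x \<in> cyl j \<delta>" "t \<in> U" "j \<le> k"
  shows "comb_seq j x (cpx t) \<in> cube_nbhd_U k \<delta>"
proof -
  have "comb_seq j x (cpx t) i \<in> nbhd (\<delta> i) U1c" if "i < k" for i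
    using assms that \<delta>_pos[OF that] by (auto simp: comb_seq_def cyl_def cpx_def U_def intro!: of_real_in_nbhd)
  moreover have "comb_seq j x (cpx t) i \<in> U1c" if "i \<ge> k" for i
    using assms that by (auto simp: comb_seq_def cpx_def U_def U1c_def)
  ultimately show ?thesis by (auto simp: cube_nbhd_U_def prod_tail_def)
qed

lemma continuous_on_comb_seq: "continuous_on S (\<lambda>p. comb_seq j (fst p) (cpx (snd p)))"
proof (rule continuous_on_coordinatewise_then_product)
  fix i
  show "continuous_on S (\<lambda>p. comb_seq j (fst p) (cpx (snd p)) i)"
    by (cases "i < j")
      (simp_all add: comb_seq_def cpx_def continuous_on_of_real
        continuous_on_product_then_coordinatewise[OF continuous_on_fst[OF continuous_on_id]]
        continuous_on_product_then_coordinatewise[OF continuous_on_snd[OF continuous_on_id]])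
qed

lemma f_comb_cont:
  assumes "j \<le> k"
  shows "continuous_on (cyl j \<delta> \<times> U) (\<lambda>p. f (comb_seq j (fst p) (cpx (snd p))))"
  by (rule continuous_on_compose2[OF f_cont continuous_on_comb_seq])
    (use comb_seq_in_domain assms in auto)

lemma f_comb_measurable:
  assumes "j \<le> k" "x \<in> cyl j \<delta>"
  shows "(\<lambda>t. f (comb_seq j x (cpx t))) \<in> borel_measurable mu"
proof (rule measurable_mu)
  have "continuous_on U (\<lambda>t. (x, t))" by (intro continuous_intros)
  from continuous_on_compose2[OF f_comb_cont[OF assms(1)] this] assms(2)
  show "continuous_on U (\<lambda>t. f (comb_seq j x (cpx t)))" by auto
qed

text \<open>The complex extension of \<open>marg\<close>. At \<open>j = 0\<close> the integral
  equals 1 because \<open>f\<close> is a probability density, in agreement with the case distinction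
  in \<open>marg\<close>.\<close>

definition cmarg :: "nat \<Rightarrow> (nat \<Rightarrow> complex) \<Rightarrow> complex" where
  "cmarg j x = (\<integral>t. f (comb_seq j x (cpx t)) \<partial>mu)"

lemma cmarg_cong: "(\<And>i. i < j \<Longrightarrow> x i = y i) \<Longrightarrow> cmarg j x = cmarg j y"
  unfolding cmarg_def by (intro Bochner_Integration.integral_cong refl arg_cong[of _ _ f])
    (auto simp: comb_seq_def)

lemma cmarg_cont: assumes "j \<le> k" shows "continuous_on (cyl j \<delta>) (cmarg j)"
  unfolding cmarg_def
proof (rule continuous_on_lebesgue_integral[where B = L])
  show "continuous_on (cyl j \<delta>) (\<lambda>x. f (comb_seq j x (cpx t)))" if "t \<in> space mu" for t
  proof -
    have "continuous_on (cyl j \<delta>) (\<lambda>x. (x, t))" by (intro continuous_intros)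
    from continuous_on_compose2[OF f_comb_cont[OF assms(1)] this] that show ?thesis by auto
  qed
qed (use f_comb_measurable f_upper comb_seq_in_domain assms mu.finite_measure_axioms in auto)

lemma cmarg_norm_le: "j \<le> k \<Longrightarrow> x \<in> cyl j \<delta> \<Longrightarrow> cmod (cmarg j x) \<le> L"
  unfolding cmarg_def
  by (rule mu.norm_integral_le_const) (use f_comb_measurable f_upper comb_seq_in_domain in auto)

text \<open>For fixed \<open>t\<close> the integrand is a function of the first \<open>k\<close>
  coordinates as in hypothesis (b), restricted to a curve whose coordinates from \<open>j\<close> to
  \<open>k - 1\<close> are constant.\<close>

lemma cmarg_hol:
  assumes j: "j \<le> k" shows "hol_along j (cyl j \<delta>) (cmarg j)"
  unfolding hol_along_def
proof (intro allI impI)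
  fix V and \<gamma> :: "complex \<Rightarrow> nat \<Rightarrow> complex"
  assume V: "open V" and \<gamma>: "\<forall>z\<in>V. \<gamma> z \<in> cyl j \<delta>" and hol: "\<forall>i<j. (\<lambda>z. \<gamma> z i) holomorphic_on V"
  show "(\<lambda>z. cmarg j (\<gamma> z)) holomorphic_on V" unfolding cmarg_def
  proof (rule holomorphic_on_lebesgue_integral[where B = L])
    fix t assume "t \<in> space mu"
    then have t: "t \<in> U" by simp
    \<comment> \<open>The first \<open>k - j\<close> entries of \<open>t\<close> fill the positions
      \<open>j\<close> to \<open>k - 1\<close>; the tail behind position \<open>k\<close> consists
      of the remaining ones.\<close>
    define y where "y = (\<lambda>i. t (k - j + i))"
    define \<Gamma> where "\<Gamma> = (\<lambda>z. trunc k (comb_seq j (\<gamma> z) (cpx t)))"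
    have yU: "y \<in> U" using t by (auto simp: y_def U_def)
    have "(\<lambda>z. f (comb_seq k (\<Gamma> z) (cpx y))) holomorphic_on V"
    proof (rule C1_on_holomorphic_compose[OF f_C1[OF yU] V])
      show "\<Gamma> z \<in> cube_nbhd k \<delta>" if "z \<in> V" for z
        using comb_seq_in_domain[of "\<gamma> z" j t] \<gamma> that t j
        by (auto simp: \<Gamma>_def trunc_def cube_nbhd_def cube_nbhd_U_def prod_tail_def comb_seq_less)
          (simp add: comb_seq_def)
      show "(\<lambda>z. \<Gamma> z i) holomorphic_on V" if "i < k" for i
        using that hol by (cases "i < j") (simp_all add: \<Gamma>_def trunc_def comb_seq_def holomorphic_on_const)
      show "\<Gamma> z i = \<Gamma> z' i" if "k \<le> i" for i z z'
        using that by (simp add: \<Gamma>_def trunc_def comb_seq_def)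
    qed
    moreover have "comb_seq k (\<Gamma> z) (cpx y) = comb_seq j (\<gamma> z) (cpx t)" for z
      using j by (auto simp: \<Gamma>_def trunc_def comb_seq_def y_def cpx_def fun_eq_iff not_less)
    ultimately show "(\<lambda>z. f (comb_seq j (\<gamma> z) (cpx t))) holomorphic_on V" by simp
  qed (use V \<gamma> j f_comb_measurable f_upper comb_seq_in_domain mu.finite_measure_axioms in auto)
qed

text \<open>Hypotheses (d) and (e) with base point \<open>comb_seq j u t\<close>. With indices from
  0, \<open>\<delta> l\<close> is the first radius after the \<open>l\<close> coordinates that leave
  the real axis.\<close>

lemma f_comb_near:
  assumes u: "u \<in> U" and t: "t \<in> U" and j: "j \<le> k"
    and x: "\<And>i. i < j \<Longrightarrow> cmod (x i - of_real (u i)) < \<delta> i"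
  shows "cmod (f (comb_seq j x (cpx t)) - f (comb_seq j (cpx u) (cpx t))) \<le> C1"
    and "1 \<le> l \<Longrightarrow> l < k \<Longrightarrow> (\<And>i. l \<le> i \<Longrightarrow> i < j \<Longrightarrow> x i = of_real (u i)) \<Longrightarrow>
       cmod (f (comb_seq j x (cpx t)) - f (comb_seq j (cpx u) (cpx t))) \<le> C1 * \<delta> l"
proof -
  define h where "h = comb_seq j (\<lambda>i. x i - of_real (u i)) (\<lambda>_. 0)"
  have eq: "(\<lambda>i. cpx (comb_seq j u t) i + h i) = comb_seq j x (cpx t)"
    by (auto simp: h_def cpx_def comb_seq_def)
  have "h \<in> polydisc k \<delta>"
    using x j \<delta>_pos by (auto simp: h_def polydisc_def prod_tail_def comb_seq_def)
  from f_near[OF comb_seq_in_U[OF u t, of j] this] show "cmod (f (comb_seq j x (cpx t)) - f (comb_seq j (cpx u) (cpx t))) \<le> C1"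
    unfolding eq by (simp only: cpx_comb_seq)
  assume l: "1 \<le> l" "l < k" "\<And>i. l \<le> i \<Longrightarrow> i < j \<Longrightarrow> x i = of_real (u i)"
  have "h \<in> polydisc l \<delta>"
    using x j l \<delta>_pos by (auto simp: h_def polydisc_def prod_tail_def comb_seq_def)
  from f_near_\<delta>[OF comb_seq_in_U[OF u t, of j] l(1,2) this]
  show "cmod (f (comb_seq j x (cpx t)) - f (comb_seq j (cpx u) (cpx t))) \<le> C1 * \<delta> l"
    unfolding eq by (simp only: cpx_comb_seq)
qed

lemma cpx_in_cyl: "u \<in> U \<Longrightarrow> j \<le> k \<Longrightarrow> cpx u \<in> cyl j \<delta>"
  using \<delta>_pos by (auto simp: cyl_def cpx_def U_def intro!: of_real_in_nbhd)

lemma near_in_cyl: "u \<in> U \<Longrightarrow> (\<And>i. i < j \<Longrightarrow> cmod (x i - of_real (u i)) < r i) \<Longrightarrow> x \<in> cyl j r"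
  by (auto simp: cyl_def nbhd_U1c_iff U_def)

lemma cmarg_near_aux:
  assumes u: "u \<in> U" and j: "j \<le> k" and x: "\<And>i. i < j \<Longrightarrow> cmod (x i - of_real (u i)) < \<delta> i"
    and B: "\<And>t. t \<in> U \<Longrightarrow> cmod (f (comb_seq j x (cpx t)) - f (comb_seq j (cpx u) (cpx t))) \<le> B"
  shows "cmod (cmarg j x - cmarg j (cpx u)) \<le> B"
proof -
  have xc: "x \<in> cyl j \<delta>" using near_in_cyl[OF u] x by blast
  note uc = cpx_in_cyl[OF u j]
  have "integrable mu (\<lambda>t. f (comb_seq j x (cpx t)))" if "x \<in> cyl j \<delta>" for x
    using f_comb_measurable f_upper comb_seq_in_domain that j
    by (intro mu.integrable_const_bound[of _ L]) auto
  note int = this[OF xc] this[OF uc]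
  have "cmarg j x - cmarg j (cpx u) = (\<integral>t. f (comb_seq j x (cpx t)) - f (comb_seq j (cpx u) (cpx t)) \<partial>mu)"
    unfolding cmarg_def using int by simp
  also have "cmod \<dots> \<le> B"
    using B int by (intro mu.norm_integral_le_const) auto
  finally show ?thesis .
qed

lemma cmarg_near:
  assumes u: "u \<in> U" and j: "j \<le> k" and x: "\<And>i. i < j \<Longrightarrow> cmod (x i - of_real (u i)) < \<delta> i"
  shows "cmod (cmarg j x - cmarg j (cpx u)) \<le> C1"
  by (rule cmarg_near_aux[OF u j x f_comb_near(1)[OF u _ j x]])

text \<open>Averaging hypothesis (e) over the tail. The value \<open>l = 0\<close> lies outside (e),
  but then no coordinate leaves the real point and the difference vanishes.\<close>

lemma cmarg_near_\<delta>:
  assumes u: "u \<in> U" and j: "j \<le> k" and x: "\<And>i. i < j \<Longrightarrow> cmod (x i - of_real (u i)) < \<delta> i"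
    and l: "l < k" "\<And>i. l \<le> i \<Longrightarrow> i < j \<Longrightarrow> x i = of_real (u i)"
  shows "cmod (cmarg j x - cmarg j (cpx u)) \<le> C1 * \<delta> l"
proof (cases "l = 0")
  case True
  then have "cmarg j x = cmarg j (cpx u)" using l by (intro cmarg_cong) (auto simp: cpx_def)
  then show ?thesis using C1_pos \<delta>_pos[OF l(1)] by simp
next
  case False
  show ?thesis
    by (rule cmarg_near_aux[OF u j x f_comb_near(2)[OF u _ j x]]) (use False l in auto)
qed

abbreviation "fr \<equiv> \<lambda>y. Re (f (cpx y))"

lemma fr_bounds: assumes "u \<in> U" shows "M \<le> fr u" "fr u \<le> L" "f (cpx u) = of_real (fr u)"
proof -
  have "cpx u \<in> cube_nbhd_U k \<delta>"
    using comb_seq_in_domain[of "cpx u" 0 u] assms by (simp add: comb_seq_0 cyl_def)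
  moreover show eq: "f (cpx u) = of_real (fr u)" using f_real[OF assms] by simp
  then have "cmod (f (cpx u)) = fr u" using f_pos[OF assms] by (metis abs_of_pos norm_of_real)
  ultimately show "M \<le> fr u" "fr u \<le> L" using f_lower f_upper by metis+
qed

lemma cmarg_cpx: assumes u: "u \<in> U" and j: "j \<le> k"
  shows "cmarg j (cpx u) = of_real (marg fr j u)"
proof -
  have "cmarg j (cpx u) = (\<integral>t. of_real (fr (comb_seq j u t)) \<partial>mu)"
    unfolding cmarg_def
    by (rule Bochner_Integration.integral_cong)
      (use fr_bounds(3) comb_seq_in_U[OF u] in \<open>auto simp flip: cpx_comb_seq\<close>)
  also have "\<dots> = of_real (\<integral>t. fr (comb_seq j u t) \<partial>mu)" by simp
  also have "(\<integral>t. fr (comb_seq j u t) \<partial>mu) = marg fr j u"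
    using f_int by (auto simp: marg_def comb_seq_0 has_bochner_integral_integral_eq)
  finally show ?thesis .
qed

lemma cmarg_cpx_bounds: assumes u: "u \<in> U" and j: "j \<le> k"
  shows "M \<le> Re (cmarg j (cpx u))" "Re (cmarg j (cpx u)) \<le> L"
proof -
  have "cmod (cmarg j (cpx u)) \<le> L" using cmarg_norm_le[OF j cpx_in_cyl[OF u j]] .
  then show "Re (cmarg j (cpx u)) \<le> L" using complex_Re_le_cmod order_trans by blast
  show "M \<le> Re (cmarg j (cpx u))" unfolding cmarg_def
  proof (rule mu.Re_integral_ge_const[where B = L])
    show "M \<le> Re (f (comb_seq j (cpx u) (cpx t)))" if "t \<in> space mu" for t
      using fr_bounds(1)[OF comb_seq_in_U[OF u, of t j]] that by (simp add: cpx_comb_seq)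
  qed (use f_comb_measurable f_upper comb_seq_in_domain j cpx_in_cyl[OF u j] in auto)
qed

lemma cmarg_Re_ge: assumes x: "x \<in> cyl j \<delta>" and j: "j \<le> k"
  shows "M / 2 \<le> Re (cmarg j x)"
proof -
  obtain u where u: "u \<in> U" "\<And>i. i < j \<Longrightarrow> cmod (x i - of_real (u i)) < \<delta> i"
    using real_point_near[OF x] by blast
  have "\<bar>Re (cmarg j x - cmarg j (cpx u))\<bar> \<le> C1"
    using cmarg_near[OF u(1) j u(2)] abs_Re_le_cmod order_trans by blast
  then show ?thesis using cmarg_cpx_bounds(1)[OF u(1) j] C1_le M_pos by simp
qed

lemma cmarg_norm_ge: "x \<in> cyl j \<delta> \<Longrightarrow> j \<le> k \<Longrightarrow> M / 2 \<le> cmod (cmarg j x)"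
  using cmarg_Re_ge complex_Re_le_cmod order_trans by blast

lemma cmarg_nonzero: "x \<in> cyl j \<delta> \<Longrightarrow> j \<le> k \<Longrightarrow> cmarg j x \<noteq> 0"
  using cmarg_norm_ge M_pos by fastforce

lemma cmarg_iterate:
  assumes x: "x \<in> cyl j \<delta>" and j: "j < k"
  shows "cmarg j x = (\<integral>s. cmarg (Suc j) (x(j := of_real s)) \<partial>lam)"
proof -
  have "integrable mu (\<lambda>t. f (comb_seq j x (cpx t)))"
    using f_comb_measurable f_upper comb_seq_in_domain x j
    by (intro mu.integrable_const_bound[of _ L]) auto
  then have "cmarg j x = (\<integral>s. \<integral>\<omega>. f (comb_seq j x (cpx (case_nat s \<omega>))) \<partial>mu \<partial>lam)"
    unfolding cmarg_def by (rule mu_integral_iterate)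
  moreover have "comb_seq j x (cpx (case_nat s \<omega>)) = comb_seq (Suc j) (x(j := of_real s)) (cpx \<omega>)" for s \<omega>
  proof
    fix i
    show "comb_seq j x (cpx (case_nat s \<omega>)) i = comb_seq (Suc j) (x(j := of_real s)) (cpx \<omega>) i"
    proof (cases "i \<le> j")
      case False
      then obtain l where "i = Suc (j + l)" using less_iff_Suc_add[of j i] by auto
      then show ?thesis by (simp add: comb_seq_def cpx_def Suc_diff_le)
    qed (auto simp: comb_seq_def cpx_def)
  qed
  ultimately show ?thesis unfolding cmarg_def by simp
qed

text \<open>For \<open>a \<noteq> b\<close> this is the divided difference
  \<open>(P b - P a) / (b - a)\<close> of a primitive \<open>P\<close> of the marginal of order
  \<open>j + 1\<close> in its last variable; as a mean it extends to \<open>a = b\<close> and needs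
  no choice of \<open>P\<close>.\<close>

definition smean :: "nat \<Rightarrow> (nat \<Rightarrow> complex) \<Rightarrow> complex \<Rightarrow> complex \<Rightarrow> complex" where
  "smean j x a b = (\<integral>\<sigma>. cmarg (Suc j) (x(j := seg a b \<sigma>)) \<partial>lam)"

lemma smean_cong: "(\<And>i. i < j \<Longrightarrow> x i = y i) \<Longrightarrow> smean j x a b = smean j y a b"
  unfolding smean_def by (intro Bochner_Integration.integral_cong refl cmarg_cong) (auto simp: less_Suc_eq)

lemma smean_same: "smean j x a a = cmarg (Suc j) (x(j := a))"
  using lam.prob_space by (simp add: smean_def seg_def)

lemma segment_in_cyl:
  assumes "x \<in> cyl j \<delta>" "a \<in> nbhd (\<delta> j) U1c" "b \<in> nbhd (\<delta> j) U1c" "\<sigma> \<in> U1"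
  shows "x(j := seg a b \<sigma>) \<in> cyl (Suc j) \<delta>"
  using assms by (simp only: cyl_Suc_upd convex_combination_nbhd)

lemma smean_measurable:
  assumes "x \<in> cyl j \<delta>" "a \<in> nbhd (\<delta> j) U1c" "b \<in> nbhd (\<delta> j) U1c" "j < k"
  shows "(\<lambda>\<sigma>. cmarg (Suc j) (x(j := seg a b \<sigma>))) \<in> borel_measurable lam"
proof (rule measurable_lam)
  have "continuous_on U1 (\<lambda>\<sigma>. x(j := seg a b \<sigma>))"
    unfolding seg_def by (intro continuous_on_fun_upd continuous_intros) auto
  moreover have "(\<lambda>\<sigma>. x(j := seg a b \<sigma>)) ` U1 \<subseteq> cyl (Suc j) \<delta>"
    using assms segment_in_cyl by blast
  ultimately show "continuous_on U1 (\<lambda>\<sigma>. cmarg (Suc j) (x(j := seg a b \<sigma>)))"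
    using assms by (intro continuous_on_compose2[OF cmarg_cont]) auto
qed

lemma smean_norm_le:
  assumes "x \<in> cyl j \<delta>" "a \<in> nbhd (\<delta> j) U1c" "b \<in> nbhd (\<delta> j) U1c" "j < k"
  shows "cmod (smean j x a b) \<le> L"
  unfolding smean_def
  by (rule lam.norm_integral_le_const[OF smean_measurable[OF assms]])
    (use assms in \<open>auto intro!: cmarg_norm_le segment_in_cyl\<close>)

lemma smean_Re_ge:
  assumes "x \<in> cyl j \<delta>" "a \<in> nbhd (\<delta> j) U1c" "b \<in> nbhd (\<delta> j) U1c" "j < k"
  shows "M / 2 \<le> Re (smean j x a b)"
  unfolding smean_def
  by (rule lam.Re_integral_ge_const[OF smean_measurable[OF assms], where B = L])
    (use assms cmarg_Re_ge[OF segment_in_cyl] in \<open>auto intro!: cmarg_norm_le segment_in_cyl\<close>)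

lemma smean_norm_ge:
  assumes "x \<in> cyl j \<delta>" "a \<in> nbhd (\<delta> j) U1c" "b \<in> nbhd (\<delta> j) U1c" "j < k"
  shows "M / 2 \<le> cmod (smean j x a b)"
  using smean_Re_ge[OF assms] complex_Re_le_cmod order_trans by blast

lemma smean_nonzero:
  assumes "x \<in> cyl j \<delta>" "a \<in> nbhd (\<delta> j) U1c" "b \<in> nbhd (\<delta> j) U1c" "j < k"
  shows "smean j x a b \<noteq> 0"
  using smean_norm_ge[OF assms] M_pos by fastforce

lemma smean_cont:
  assumes "j < k"
  shows "continuous_on (cyl j \<delta> \<times> nbhd (\<delta> j) U1c \<times> nbhd (\<delta> j) U1c) (\<lambda>(x, a, b). smean j x a b)"
  unfolding smean_def split_beta
proof (rule continuous_on_lebesgue_integral[where B = L])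
  let ?S = "cyl j \<delta> \<times> nbhd (\<delta> j) U1c \<times> nbhd (\<delta> j) U1c"
  fix \<sigma> assume "\<sigma> \<in> space lam"
  have "continuous_on ?S (\<lambda>p. (fst p)(j := seg (fst (snd p)) (snd (snd p)) \<sigma>))"
    unfolding seg_def by (intro continuous_on_fun_upd continuous_intros)
  moreover have "(\<lambda>p. (fst p)(j := seg (fst (snd p)) (snd (snd p)) \<sigma>)) ` ?S \<subseteq> cyl (Suc j) \<delta>"
    using segment_in_cyl \<open>\<sigma> \<in> space lam\<close> by auto
  ultimately show "continuous_on ?S (\<lambda>p. cmarg (Suc j) ((fst p)(j := seg (fst (snd p)) (snd (snd p)) \<sigma>)))"
    using assms by (intro continuous_on_compose2[OF cmarg_cont]) auto
qed (use assms in \<open>auto intro!: cmarg_norm_le segment_in_cyl smean_measurable lam.finite_measure_axioms\<close>)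

lemma smean_hol:
  assumes j: "j < k" and V: "open V" and \<gamma>: "\<And>z. z \<in> V \<Longrightarrow> \<gamma> z \<in> cyl j \<delta>"
    and a: "\<And>z. z \<in> V \<Longrightarrow> a z \<in> nbhd (\<delta> j) U1c" and b: "\<And>z. z \<in> V \<Longrightarrow> b z \<in> nbhd (\<delta> j) U1c"
    and hol: "\<And>i. i < j \<Longrightarrow> (\<lambda>z. \<gamma> z i) holomorphic_on V" "a holomorphic_on V" "b holomorphic_on V"
  shows "(\<lambda>z. smean j (\<gamma> z) (a z) (b z)) holomorphic_on V"
  unfolding smean_def
proof (rule holomorphic_on_lebesgue_integral[where B = L])
  fix \<sigma> assume "\<sigma> \<in> space lam"
  show "(\<lambda>z. cmarg (Suc j) ((\<gamma> z)(j := seg (a z) (b z) \<sigma>))) holomorphic_on V"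
  proof (rule hol_alongD[OF cmarg_hol V])
    show "(\<lambda>z. ((\<gamma> z)(j := seg (a z) (b z) \<sigma>)) i) holomorphic_on V" if "i < Suc j" for i
    proof (cases "i = j")
      case True
      then show ?thesis using hol by (auto simp: seg_def intro!: holomorphic_intros)
    qed (use hol that in auto)
  qed (use j \<gamma> a b \<open>\<sigma> \<in> space lam\<close> in \<open>auto intro!: segment_in_cyl\<close>)
qed (use j V \<gamma> a b in \<open>auto intro!: cmarg_norm_le segment_in_cyl smean_measurable lam.finite_measure_axioms\<close>)

text \<open>The neighbourhood is convex, so a holomorphic function on it has a primitive. The
  primitive depends on \<open>x\<close> and stays confined to proofs about a fixed
  \<open>x\<close>.\<close>

lemma smean_primitive:
  assumes x: "x \<in> cyl j \<delta>" and j: "j < k"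
  obtains P where "\<And>z. z \<in> nbhd (\<delta> j) U1c \<Longrightarrow>
      (P has_field_derivative cmarg (Suc j) (x(j := z))) (at z within nbhd (\<delta> j) U1c)"
    and "\<And>a b. a \<in> nbhd (\<delta> j) U1c \<Longrightarrow> b \<in> nbhd (\<delta> j) U1c \<Longrightarrow> (b - a) * smean j x a b = P b - P a"
proof -
  let ?N = "nbhd (\<delta> j) U1c"
  have hol: "(\<lambda>z. cmarg (Suc j) (x(j := z))) holomorphic_on ?N"
  proof (rule hol_alongD[OF cmarg_hol open_nbhd])
    show "(\<lambda>z. (x(j := z)) i) holomorphic_on ?N" for i
      by (cases "i = j") (simp_all add: holomorphic_on_ident holomorphic_on_const)
  qed (use j x in \<open>auto simp: cyl_Suc_upd\<close>)
  obtain P where P: "\<And>z. z \<in> ?N \<Longrightarrow> (P has_field_derivative cmarg (Suc j) (x(j := z))) (at z within ?N)"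
    using holomorphic_convex_primitive'[OF convex_nbhd[OF convex_U1c] open_nbhd hol] by blast
  show ?thesis
    by (rule that[OF P])
      (auto simp: smean_def intro!: lam_integral_segment[OF convex_nbhd[OF convex_U1c] _ _ holomorphic_on_imp_continuous_on[OF hol] P])
qed

text \<open>Cauchy's theorem on the triangle with vertices \<open>a\<close>, \<open>b\<close>,
  \<open>c\<close>, by telescoping a primitive.\<close>

lemma smean_add:
  assumes "x \<in> cyl j \<delta>" "a \<in> nbhd (\<delta> j) U1c" "b \<in> nbhd (\<delta> j) U1c" "c \<in> nbhd (\<delta> j) U1c" "j < k"
  shows "(b - a) * smean j x a b + (c - b) * smean j x b c = (c - a) * smean j x a c"
proof -
  obtain P where "\<And>a b. a \<in> nbhd (\<delta> j) U1c \<Longrightarrow> b \<in> nbhd (\<delta> j) U1c \<Longrightarrow> (b - a) * smean j x a b = P b - P a"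
    using smean_primitive[OF assms(1,5)] by metis
  then show ?thesis using assms by simp
qed

text \<open>With real end points the whole segment is real, so only the first \<open>j\<close>
  coordinates leave the real axis and hypothesis (e) yields the factor \<open>\<delta> j\<close>.
  This is the gain that makes the equation for the next component solvable.\<close>

lemma smean_near:
  assumes u: "u \<in> U" and j: "j < k" and x: "\<And>i. i < j \<Longrightarrow> cmod (x i - of_real (u i)) < \<delta> i"
    and a: "a \<in> U1" and b: "b \<in> U1"
  shows "cmod (smean j x (of_real a) (of_real b) - smean j (cpx u) (of_real a) (of_real b)) \<le> C1 * \<delta> j"
proof -
  have xc: "x \<in> cyl j \<delta>" using near_in_cyl[OF u] x by blast
  have uc: "cpx u \<in> cyl j \<delta>" using cpx_in_cyl[OF u] j by simp
  note ab = of_real_in_nbhd[OF a \<delta>_pos[OF j]] of_real_in_nbhd[OF b \<delta>_pos[OF j]]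
  let ?g = "\<lambda>x \<sigma>. cmarg (Suc j) (x(j := seg (of_real a) (of_real b) \<sigma>))"
  note m = smean_measurable[OF xc ab j] smean_measurable[OF uc ab j]
  have int: "integrable lam (?g x)" "integrable lam (?g (cpx u))"
    using j xc uc ab by (auto intro!: lam.integrable_const_bound[of _ L] m cmarg_norm_le segment_in_cyl)
  have "smean j x (of_real a) (of_real b) - smean j (cpx u) (of_real a) (of_real b) = (\<integral>\<sigma>. ?g x \<sigma> - ?g (cpx u) \<sigma> \<partial>lam)"
    unfolding smean_def using int by (intro Bochner_Integration.integral_diff[symmetric])
  also have "cmod \<dots> \<le> C1 * \<delta> j"
  proof (rule lam.norm_integral_le_const)
    fix \<sigma> assume "\<sigma> \<in> space lam"
    then have \<sigma>: "\<sigma> \<in> U1" by simp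
    define s where "s = a + (1 + \<sigma>) / 2 * (b - a)"
    have s: "s \<in> U1" unfolding s_def using a b \<sigma> by (rule convex_combination_U1)
    have u': "u(j := s) \<in> U" using u s by (auto simp: U_def)
    have "seg (of_real a) (of_real b) \<sigma> = (of_real s :: complex)"
      by (simp add: s_def seg_def)
    moreover have "cpx (u(j := s)) = (cpx u)(j := of_real s)" by (auto simp: cpx_def)
    moreover have "cmod (cmarg (Suc j) (x(j := of_real s)) - cmarg (Suc j) (cpx (u(j := s)))) \<le> C1 * \<delta> j"
      by (rule cmarg_near_\<delta>[OF u']) (use j x \<delta>_pos[OF j] in \<open>auto simp: less_Suc_eq\<close>)
    ultimately show "cmod (?g x \<sigma> - ?g (cpx u) \<sigma>) \<le> C1 * \<delta> j" by metis
  qed (use m in auto)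
  finally show ?thesis .
qed

lemma smean_cpx_real:
  assumes u: "u \<in> U" and j: "j < k" and a: "a \<in> U1" and b: "b \<in> U1"
  shows "smean j (cpx u) (of_real a) (of_real b) \<in> \<real>"
proof -
  have "cmarg (Suc j) ((cpx u)(j := seg (of_real a) (of_real b) \<sigma>))
     = of_real (marg fr (Suc j) (u(j := a + (1 + \<sigma>) / 2 * (b - a))))" if "\<sigma> \<in> U1" for \<sigma>
  proof -
    have "u(j := a + (1 + \<sigma>) / 2 * (b - a)) \<in> U"
      using u convex_combination_U1[OF a b that] by (auto simp: U_def)
    moreover have "(cpx u)(j := seg (of_real a) (of_real b) \<sigma>)
       = cpx (u(j := a + (1 + \<sigma>) / 2 * (b - a)))" by (auto simp: cpx_def fun_eq_iff seg_def)
    ultimately show ?thesis using cmarg_cpx j by simp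
  qed
  then have "smean j (cpx u) (of_real a) (of_real b)
     = (\<integral>\<sigma>. of_real (marg fr (Suc j) (u(j := a + (1 + \<sigma>) / 2 * (b - a)))) \<partial>lam)"
    unfolding smean_def by (intro Bochner_Integration.integral_cong) auto
  then show ?thesis by simp
qed

text \<open>At real points the left-hand side is twice the unnormalised conditional distribution
  function at \<open>s\<close>.\<close>

lemma smean_cpx_initial:
  assumes u: "u \<in> U" and j: "j < k" and s: "s \<in> U1"
  shows "(of_real s + 1) * smean j (cpx u) (-1) (of_real s) =
    of_real (2 * (\<integral>\<sigma>. indicator {-1..s} \<sigma> * marg fr (Suc j) (u(j := \<sigma>)) \<partial>lam))"
proof -
  let ?N = "nbhd (\<delta> j) U1c"
  have uc: "cpx u \<in> cyl j \<delta>" using cpx_in_cyl[OF u] j by simp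
  obtain P where P: "\<And>z. z \<in> ?N \<Longrightarrow> (P has_field_derivative cmarg (Suc j) ((cpx u)(j := z))) (at z within ?N)"
    and P2: "\<And>a b. a \<in> ?N \<Longrightarrow> b \<in> ?N \<Longrightarrow> (b - a) * smean j (cpx u) a b = P b - P a"
    using smean_primitive[OF uc j] by metis
  have sub: "complex_of_real ` U1 \<subseteq> ?N" using of_real_in_nbhd \<delta>_pos[OF j] by blast
  have m1: "-1 \<in> ?N" using of_real_in_nbhd[of "-1" "\<delta> j"] \<delta>_pos[OF j] by (simp add: U1_def)
  have c: "continuous_on ?N (\<lambda>z. cmarg (Suc j) ((cpx u)(j := z)))"
    by (rule continuous_on_compose2[OF cmarg_cont continuous_on_fun_upd])
      (use j uc in \<open>auto simp: cyl_Suc_upd intro!: continuous_intros\<close>)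
  have "(of_real s + 1) * smean j (cpx u) (-1) (of_real s) = P (of_real s) - P (-1)"
    using P2[OF m1, of "of_real s"] sub s by auto
  also have "\<dots> = 2 * (\<integral>\<sigma>. indicator {-1..s} \<sigma> *\<^sub>R cmarg (Suc j) ((cpx u)(j := of_real \<sigma>)) \<partial>lam)"
    by (rule lam_integral_initial[OF s sub c P, symmetric])
  also have "(\<integral>\<sigma>. indicator {-1..s} \<sigma> *\<^sub>R cmarg (Suc j) ((cpx u)(j := of_real \<sigma>)) \<partial>lam)
     = (\<integral>\<sigma>. of_real (indicator {-1..s} \<sigma> * marg fr (Suc j) (u(j := \<sigma>))) \<partial>lam)"
  proof (rule Bochner_Integration.integral_cong)
    fix \<sigma> assume "\<sigma> \<in> space lam"
    then have "u(j := \<sigma>) \<in> U" using u by (auto simp: U_def)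
    moreover have "(cpx u)(j := of_real \<sigma>) = cpx (u(j := \<sigma>))" by (auto simp: cpx_def)
    ultimately show "indicator {-1..s} \<sigma> *\<^sub>R cmarg (Suc j) ((cpx u)(j := of_real \<sigma>)) =
       of_real (indicator {-1..s} \<sigma> * marg fr (Suc j) (u(j := \<sigma>)))"
      using cmarg_cpx j by (simp add: scaleR_conv_of_real)
  qed simp
  also have "2 * \<dots> = of_real (2 * (\<integral>\<sigma>. indicator {-1..s} \<sigma> * marg fr (Suc j) (u(j := \<sigma>)) \<partial>lam))"
    unfolding integral_complex_of_real by simp
  finally show ?thesis .
qed

text \<open>Schwarz' lemma in the last variable on the disc of radius \<open>\<delta> j\<close>
  about -1, the point from which the distribution functions are integrated.\<close>

lemma cmarg_increment:
  assumes x: "x \<in> cyl j \<delta>" and j: "j < k" and \<tau>: "cmod (\<tau> + 1) < \<delta> j"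
  shows "cmod (cmarg (Suc j) (x(j := \<tau>)) - cmarg (Suc j) (x(j := -1))) \<le> 2 * L / \<delta> j * cmod (\<tau> + 1)"
proof -
  have sub: "z \<in> nbhd (\<delta> j) U1c" if "z \<in> ball (-1) (\<delta> j)" for z
    using that unfolding nbhd_U1c_iff
    by (intro bexI[of _ "-1"]) (auto simp: dist_norm U1_def norm_minus_commute)
  have "(\<lambda>z. cmarg (Suc j) (x(j := z))) holomorphic_on ball (-1) (\<delta> j)"
  proof (rule hol_alongD[OF cmarg_hol open_ball])
    show "(\<lambda>z. (x(j := z)) i) holomorphic_on ball (-1) (\<delta> j)" for i
      by (cases "i = j") (simp_all add: holomorphic_on_ident holomorphic_on_const)
  qed (use j x sub in \<open>auto simp: cyl_Suc_upd\<close>)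
  then have "cmod (cmarg (Suc j) (x(j := \<tau>)) - cmarg (Suc j) (x(j := -1))) \<le> 2 * L / \<delta> j * cmod (\<tau> - (-1))"
  proof (rule holomorphic_increment_bound)
    show "\<tau> \<in> ball (-1) (\<delta> j)" using \<tau> by (simp add: dist_norm norm_minus_commute add.commute)
  qed (use j x sub in \<open>auto simp: cyl_Suc_upd intro!: cmarg_norm_le\<close>)
  then show ?thesis by simp
qed

end

subsection \<open>Monotone transport and conditional densities\<close>

text \<open>Monotonicity squeezes \<open>{-1..s}\<close> between the preimages of
  \<open>{-1..<g s}\<close> and \<open>{-1..g s}\<close>. These targets differ by one point, which
  is a null set for a measure with a density, so both distribution functions agree even if
  \<open>g\<close> is not known to be injective.\<close>

lemma mono_transport_integral_eq:
  assumes tr: "mono_transport (density lam (\<lambda>s. ennreal (p s))) (density lam (\<lambda>s. ennreal (q s))) g"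
    and p: "p \<in> borel_measurable lam" "\<And>s. s \<in> U1 \<Longrightarrow> 0 \<le> p s" "\<And>s. s \<in> U1 \<Longrightarrow> p s \<le> B"
    and q: "q \<in> borel_measurable lam" "\<And>s. s \<in> U1 \<Longrightarrow> 0 \<le> q s" "\<And>s. s \<in> U1 \<Longrightarrow> q s \<le> B"
    and s: "s \<in> U1"
  shows "(\<integral>\<sigma>. indicator {-1..s} \<sigma> * p \<sigma> \<partial>lam) = (\<integral>\<sigma>. indicator {-1..g s} \<sigma> * q \<sigma> \<partial>lam)"
proof -
  let ?\<nu> = "density lam (\<lambda>s. ennreal (p s))" and ?\<nu>' = "density lam (\<lambda>s. ennreal (q s))"
  have g: "g ` U1 \<subseteq> U1" "mono_on U1 g" "distr ?\<nu> lam g = ?\<nu>'"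
    using tr by (auto simp: mono_transport_def)
  have gs: "g s \<in> U1" using g s by auto
  have "g \<in> borel_measurable (restrict_space borel U1)"
    using borel_measurable_mono_on_fnc g(2) by blast
  then have "g \<in> measurable (restrict_space borel U1) (restrict_space borel U1)"
    using g(1) by (intro measurable_restrict_space2) (auto simp: space_restrict_space)
  then have gm: "g \<in> measurable ?\<nu> lam"
    by (simp cong: measurable_cong_sets add: sets_lam)
  have set_in: "A \<in> sets lam" if "A \<in> sets borel" "A \<subseteq> U1" for A
    unfolding sets_lam sets_restrict_space using that by (auto simp: image_iff intro!: bexI[of _ A])
  have I: "{-1..c} \<in> sets lam" "{-1..<c} \<in> sets lam" "{c} \<in> sets lam" if "c \<in> U1" for c
    using that by (intro set_in; auto simp: U1_def)+
  have null: "emeasure ?\<nu>' {g s} = 0"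
  proof -
    have "emeasure lam {g s} = 0"
      using gs unfolding lam_def by (simp add: emeasure_restrict_space U1_def)
    then have "AE x in lam. x \<notin> {g s}" using I(3)[OF gs] by (intro AE_not_in) (auto simp: null_sets_def)
    then have "AE x in lam. x \<in> {g s} \<longrightarrow> ennreal (q x) = 0" by (rule eventually_mono) simp
    then have "{g s} \<in> null_sets ?\<nu>'"
      using q(1) I(3)[OF gs] null_sets_density_iff[of "\<lambda>x. ennreal (q x)" lam "{g s}"] by simp
    then show ?thesis by (simp add: null_sets_def)
  qed
  have pre: "emeasure ?\<nu>' A = emeasure ?\<nu> (g -` A \<inter> U1)" and pre_in: "g -` A \<inter> U1 \<in> sets ?\<nu>"
    if "A \<in> sets lam" for A
    using emeasure_distr[OF gm that] measurable_sets[OF gm that] g(3) by auto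
  have "emeasure ?\<nu> {-1..s} \<le> emeasure ?\<nu> (g -` {-1..g s} \<inter> U1)"
  proof (rule emeasure_mono)
    show "{-1..s} \<subseteq> g -` {-1..g s} \<inter> U1"
    proof
      fix x assume x: "x \<in> {-1..s}"
      then have "x \<in> U1" using s by (auto simp: U1_def)
      moreover have "g x \<le> g s" using x \<open>x \<in> U1\<close> s g(2) by (auto simp: mono_on_def)
      moreover have "g x \<ge> -1" using g(1) \<open>x \<in> U1\<close> by (force simp: U1_def)
      ultimately show "x \<in> g -` {-1..g s} \<inter> U1" by auto
    qed
  qed (rule pre_in[OF I(1)[OF gs]])
  then have le: "emeasure ?\<nu> {-1..s} \<le> emeasure ?\<nu>' {-1..g s}" using pre I(1)[OF gs] by simp
  have "{-1..g s} = {-1..<g s} \<union> {g s}" using gs by (auto simp: U1_def)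
  then have "emeasure ?\<nu>' {-1..g s} \<le> emeasure ?\<nu>' {-1..<g s} + emeasure ?\<nu>' {g s}"
    using I[OF gs] by (metis emeasure_subadditive sets_density)
  also have "\<dots> = emeasure ?\<nu> (g -` {-1..<g s} \<inter> U1)" using null pre I(2)[OF gs] by simp
  also have "\<dots> \<le> emeasure ?\<nu> {-1..s}"
  proof (rule emeasure_mono)
    show "g -` {-1..<g s} \<inter> U1 \<subseteq> {-1..s}"
    proof
      fix x assume x: "x \<in> g -` {-1..<g s} \<inter> U1"
      then have "x \<le> s" using g(2) s by (force simp: mono_on_def)
      then show "x \<in> {-1..s}" using x by (auto simp: U1_def)
    qed
  qed (use I(1)[OF s] in simp)
  finally have eq: "emeasure ?\<nu> {-1..s} = emeasure ?\<nu>' {-1..g s}" using le by simp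
  have dens: "emeasure (density lam (\<lambda>s. ennreal (h s))) {-1..c} = ennreal (\<integral>\<sigma>. indicator {-1..c} \<sigma> * h \<sigma> \<partial>lam)"
    and nonneg: "0 \<le> (\<integral>\<sigma>. indicator {-1..c} \<sigma> * h \<sigma> \<partial>lam)"
    if h: "h \<in> borel_measurable lam" "\<And>s. s \<in> U1 \<Longrightarrow> 0 \<le> h s" "\<And>s. s \<in> U1 \<Longrightarrow> h s \<le> B"
      and c: "c \<in> U1" for h c
  proof -
    have m: "(\<lambda>\<sigma>. indicator {-1..c} \<sigma> * h \<sigma>) \<in> borel_measurable lam"
      using h(1) I(1)[OF c] by (intro borel_measurable_times borel_measurable_indicator)
    have "0 \<le> B" using h(2,3) c order_trans by blast
    then have "integrable lam (\<lambda>\<sigma>. indicator {-1..c} \<sigma> * h \<sigma>)"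
      using h by (intro lam.integrable_const_bound[OF _ m, of B]) (auto simp: indicator_def)
    moreover have "emeasure (density lam (\<lambda>s. ennreal (h s))) {-1..c} = (\<integral>\<^sup>+ \<sigma>. ennreal (indicator {-1..c} \<sigma> * h \<sigma>) \<partial>lam)"
      using h(1) I(1)[OF c] by (subst emeasure_density) (auto intro!: nn_integral_cong simp: indicator_def)
    moreover have "AE \<sigma> in lam. 0 \<le> indicator {-1..c} \<sigma> * h \<sigma>"
      using h(2) by (intro AE_I2) (auto simp: indicator_def)
    ultimately show "emeasure (density lam (\<lambda>s. ennreal (h s))) {-1..c} = ennreal (\<integral>\<sigma>. indicator {-1..c} \<sigma> * h \<sigma> \<partial>lam)"
      by (simp add: nn_integral_eq_integral)
    show "0 \<le> (\<integral>\<sigma>. indicator {-1..c} \<sigma> * h \<sigma> \<partial>lam)"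
      using h(2) by (intro Bochner_Integration.integral_nonneg) (auto simp: indicator_def)
  qed
  have "emeasure ?\<nu> {-1..s} = ennreal (\<integral>\<sigma>. indicator {-1..s} \<sigma> * p \<sigma> \<partial>lam)"
    using p s by (intro dens) auto
  moreover have "emeasure ?\<nu>' {-1..g s} = ennreal (\<integral>\<sigma>. indicator {-1..g s} \<sigma> * q \<sigma> \<partial>lam)"
    using q gs by (intro dens) auto
  moreover have "0 \<le> (\<integral>\<sigma>. indicator {-1..s} \<sigma> * p \<sigma> \<partial>lam)" using p s by (intro nonneg) auto
  moreover have "0 \<le> (\<integral>\<sigma>. indicator {-1..g s} \<sigma> * q \<sigma> \<partial>lam)" using q gs by (intro nonneg) auto
  ultimately show ?thesis using eq by (metis ennreal_inj)
qed

section \<open>Estimates for products and quotients\<close>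

lemma norm_mult_le:
  fixes a b :: complex
  shows "cmod a \<le> A \<Longrightarrow> cmod b \<le> B \<Longrightarrow> cmod (a * b) \<le> A * B"
  unfolding norm_mult by (intro mult_mono) (auto intro: order_trans[OF norm_ge_zero])

lemma norm_divide_le:
  fixes a b :: complex
  assumes "cmod a \<le> A" "B \<le> cmod b" "0 < B"
  shows "cmod (a / b) \<le> A / B"
  unfolding norm_divide using assms by (intro frac_le) (auto intro: order_trans[OF norm_ge_zero])

text \<open>Each of the four numbers is a positive real times a factor within 1/16 of 1. The real
  parts combine to a number between \<open>M\<^sup>2 / L\<^sup>2\<close> and
  \<open>L\<^sup>2 / M\<^sup>2\<close>; the factors combine to a number within
  \<open>(6/16) / (13/16) \<le> 1/2\<close> of 1.\<close>

lemma quotient_near_real: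
  fixes p q r s :: complex and M L :: real
  assumes M: "0 < M"
    and p: "cmod (p - of_real p0) \<le> M / 16" "M \<le> p0" "p0 \<le> L"
    and q: "cmod (q - of_real q0) \<le> M / 16" "M \<le> q0" "q0 \<le> L"
    and r: "cmod (r - of_real r0) \<le> M / 16" "M \<le> r0" "r0 \<le> L"
    and s: "cmod (s - of_real s0) \<le> M / 16" "M \<le> s0" "s0 \<le> L"
  shows "Re ((p / q) / (r / s)) \<ge> M\<^sup>2 / (2 * L\<^sup>2)"
    and "cmod ((p / q) / (r / s)) \<le> 3 / 2 * L\<^sup>2 / M\<^sup>2"
proof -
  have pert: "\<exists>a. z = of_real z0 * (1 + a) \<and> cmod a \<le> 1 / 16"
    if z: "cmod (z - of_real z0) \<le> M / 16" "M \<le> z0" for z z0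
  proof (intro exI[of _ "(z - of_real z0) / of_real z0"] conjI)
    have z0: "z0 > 0" using z M by linarith
    show "z = of_real z0 * (1 + (z - of_real z0) / of_real z0)" using z0 by (simp add: field_simps)
    have "cmod (z - of_real z0) \<le> z0 / 16" using z by linarith
    then show "cmod ((z - of_real z0) / of_real z0) \<le> 1 / 16" using z0 by (simp add: norm_divide field_simps)
  qed
  obtain a where a: "p = of_real p0 * (1 + a)" "cmod a \<le> 1 / 16" using pert[OF p(1,2)] by blast
  obtain b where b: "q = of_real q0 * (1 + b)" "cmod b \<le> 1 / 16" using pert[OF q(1,2)] by blast
  obtain c where c: "r = of_real r0 * (1 + c)" "cmod c \<le> 1 / 16" using pert[OF r(1,2)] by blast
  obtain d where d: "s = of_real s0 * (1 + d)" "cmod d \<le> 1 / 16" using pert[OF s(1,2)] by blast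
  note pos = less_le_trans[OF M p(2)] less_le_trans[OF M q(2)] less_le_trans[OF M r(2)] less_le_trans[OF M s(2)]
  define R0 where "R0 = p0 * s0 / (q0 * r0)"
  define num where "num = (1 + a) * (1 + d)"
  define den where "den = (1 + b) * (1 + c)"
  have prod: "cmod ((1 + x) * (1 + y) - 1) \<le> 3 / 16" if "cmod x \<le> 1 / 16" "cmod y \<le> 1 / 16" for x y :: complex
  proof -
    have "cmod (x * y) \<le> 1 / 16 * (1 / 16)" using that by (rule norm_mult_le)
    moreover have "(1 + x) * (1 + y) - 1 = x + y + x * y" by (simp add: algebra_simps)
    ultimately show ?thesis using that norm_triangle_ineq[of "x + y" "x * y"] norm_triangle_ineq[of x y] by simp
  qed
  have num: "cmod (num - 1) \<le> 3 / 16" unfolding num_def using a d by (intro prod)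
  have den: "cmod (den - 1) \<le> 3 / 16" unfolding den_def using b c by (intro prod)
  have den_ge: "13 / 16 \<le> cmod den"
    using den norm_triangle_ineq2[of 1 "1 - den"] by (simp add: norm_minus_commute)
  then have den0: "den \<noteq> 0" by auto
  have "cmod (num - den) \<le> 6 / 16"
    using num den norm_triangle_ineq4[of "num - 1" "den - 1"] by simp
  then have "cmod ((num - den) / den) \<le> (6 / 16) / (13 / 16)" using den_ge by (rule norm_divide_le) simp
  moreover have "num / den - 1 = (num - den) / den" using den0 by (simp add: field_simps)
  ultimately have e: "cmod (num / den - 1) \<le> 1 / 2" by simp
  have R: "(p / q) / (r / s) = of_real R0 * (num / den)"
    using pos by (simp add: a b c d R0_def num_def den_def mult_ac)
  have "M\<^sup>2 / L\<^sup>2 \<le> R0" unfolding R0_def power2_eq_square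
    using p q r s pos M by (intro frac_le mult_mono mult_pos_pos mult_nonneg_nonneg; linarith)
  moreover have "R0 \<le> L\<^sup>2 / M\<^sup>2" unfolding R0_def power2_eq_square
    using p q r s pos M by (intro frac_le mult_mono mult_pos_pos mult_nonneg_nonneg; linarith)
  ultimately have R0: "M\<^sup>2 / L\<^sup>2 \<le> R0" "R0 \<le> L\<^sup>2 / M\<^sup>2" .
  have R00: "0 < R0" unfolding R0_def using pos by simp
  have "\<bar>Re (num / den - 1)\<bar> \<le> 1 / 2" using e abs_Re_le_cmod order_trans by blast
  then have "Re (num / den) \<ge> 1 / 2" unfolding minus_complex.sel one_complex.sel by linarith
  then have "R0 * Re (num / den) \<ge> R0 * (1 / 2)" using R00 by (intro mult_left_mono) auto
  moreover have "Re (of_real R0 * (num / den)) = R0 * Re (num / den)"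
    by (simp only: times_complex.sel Re_complex_of_real Im_complex_of_real)
  ultimately have "Re ((p / q) / (r / s)) \<ge> R0 / 2" unfolding R by linarith
  then show "Re ((p / q) / (r / s)) \<ge> M\<^sup>2 / (2 * L\<^sup>2)" using R0 by simp
  have "cmod (num / den) \<le> 3 / 2" using e norm_triangle_ineq[of "num / den - 1" 1] by simp
  then have "R0 * cmod (num / den) \<le> L\<^sup>2 / M\<^sup>2 * (3 / 2)" using R0 R00 by (intro mult_mono) auto
  then show "cmod ((p / q) / (r / s)) \<le> 3 / 2 * L\<^sup>2 / M\<^sup>2"    unfolding R norm_mult norm_of_real using R00 by (simp add: mult.commute)
qed

context complex_density
begin

lemma minus_one_in_nbhd: "j < k \<Longrightarrow> -1 \<in> nbhd (\<delta> j) U1c"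
  using of_real_in_nbhd[of "-1" "\<delta> j"] \<delta>_pos[of j] by (simp add: U1_def)

text \<open>The segment from -1 to 1 is the full domain of integration, so the next variable is
  integrated out.\<close>

lemma smean_full: assumes "x \<in> cyl j \<delta>" "j < k" shows "smean j x (-1) 1 = cmarg j x"
proof -
  have "seg (-1) 1 \<sigma> = of_real \<sigma>" for \<sigma> by (simp add: seg_def field_simps)
  then show ?thesis unfolding cmarg_iterate[OF assms] smean_def by simp
qed

text \<open>The function \<open>t \<mapsto> (t + 1) * smean j x (-1) t\<close> is the primitive that
  vanishes at -1. Its increments are \<open>b - a\<close> times a number of modulus between
  \<open>M / 2\<close> and \<open>L\<close>; most later estimates rest on this
  factorisation.\<close>

lemma smean_reverse: assumes "x \<in> cyl j \<delta>" "a \<in> nbhd (\<delta> j) U1c" "b \<in> nbhd (\<delta> j) U1c" "j < k"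
  shows "(b + 1) * smean j x (-1) b - (a + 1) * smean j x (-1) a = (b - a) * smean j x a b"
  using smean_add[OF assms(1) minus_one_in_nbhd[OF assms(4)] assms(2,3,4)] by (simp add: algebra_simps)

lemma smean_line_hol:
  assumes x: "x \<in> cyl j \<delta>" and j: "j < k"
  shows "(\<lambda>t. (t + 1) * smean j x (-1) t) holomorphic_on nbhd (\<delta> j) U1c"
  by (intro holomorphic_intros smean_hol[OF j open_nbhd]) (use x minus_one_in_nbhd[OF j] in auto)

lemma marg_cont:
  assumes u: "u \<in> U" and j: "j < k"
  shows "continuous_on U1 (\<lambda>s. marg fr (Suc j) (u(j := s)))"
proof -
  have "continuous_on U1 (\<lambda>s. (cpx u)(j := of_real s))"
    by (intro continuous_on_fun_upd continuous_intros)
  moreover have "(\<lambda>s. (cpx u)(j := of_real s)) ` U1 \<subseteq> cyl (Suc j) \<delta>"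
    using cpx_in_cyl[OF u, of j] j by (auto simp: cyl_Suc_upd intro!: of_real_in_nbhd \<delta>_pos)
  ultimately have "continuous_on U1 (\<lambda>s. Re (cmarg (Suc j) ((cpx u)(j := of_real s))))"
    using j by (intro continuous_on_Re continuous_on_compose2[OF cmarg_cont]) auto
  moreover have "Re (cmarg (Suc j) ((cpx u)(j := of_real s))) = marg fr (Suc j) (u(j := s))" if "s \<in> U1" for s
  proof -
    have "u(j := s) \<in> U" using u that by (auto simp: U_def)
    moreover have "(cpx u)(j := of_real s) = cpx (u(j := s))" by (auto simp: cpx_def)
    ultimately show ?thesis using cmarg_cpx j by simp
  qed
  ultimately show ?thesis by (simp cong: continuous_on_cong)
qed

lemma marg_bounds: assumes "u \<in> U" "j \<le> k" shows "M \<le> marg fr j u" "marg fr j u \<le> L"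
  using cmarg_cpx_bounds[OF assms] cmarg_cpx[OF assms] by auto

lemma cond_dens_eq: "cond_dens fr (Suc j) (u(j := s)) = marg fr (Suc j) (u(j := s)) / marg fr j u"
proof -
  have "comb_seq j (u(j := s)) = comb_seq j u" by (auto simp: comb_seq_def fun_eq_iff)
  then show ?thesis by (simp add: cond_dens_def marg_def)
qed

end

subsection \<open>Complex extension of the transport\<close>

locale KR_extension =
  \<rho>: complex_density M L C1 k \<delta> f\<rho> + \<pi>: complex_density M L C1 k \<delta> f\<pi>
  for M L C1 :: real and k :: nat and \<delta> :: "nat \<Rightarrow> real"
    and f\<rho> f\<pi> :: "(nat \<Rightarrow> complex) \<Rightarrow> complex" +
  fixes C2 :: real and T :: "nat \<Rightarrow> (nat \<Rightarrow> real) \<Rightarrow> real" and \<zeta> :: "nat \<Rightarrow> real"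
  assumes C1_eq: "C1 = M ^ 3 / (64 * L\<^sup>2)"
    and C2_eq: "C2 = M\<^sup>2 / (16 * L\<^sup>2)"
    and KR: "KR_transport \<rho>.fr \<pi>.fr T"
    and \<zeta>_eq: "\<zeta> = (\<lambda>j. C2 * \<delta> j)"
begin

abbreviation "N j \<equiv> nbhd (\<delta> j) U1c"

lemmas M_pos = \<rho>.M_pos and L_pos = \<rho>.L_pos and \<delta>_pos = \<rho>.\<delta>_pos

lemma one_le_quotient: "1 \<le> L / M" "1 \<le> L\<^sup>2 / M\<^sup>2"
proof -
  show "1 \<le> L / M" using M_pos \<rho>.M_le_L by simp
  then have "1 \<le> (L / M)\<^sup>2" by (rule one_le_power)
  then show "1 \<le> L\<^sup>2 / M\<^sup>2" by (simp add: power_divide)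
qed

lemma C2_pos: "0 < C2" and C2_le: "C2 \<le> 1"
proof -
  show "0 < C2" unfolding C2_eq using M_pos L_pos by simp
  have "M\<^sup>2 \<le> L\<^sup>2" using M_pos \<rho>.M_le_L by (intro power_mono) auto
  then have "M\<^sup>2 \<le> 16 * L\<^sup>2" using zero_le_power2[of L] by linarith
  then show "C2 \<le> 1" unfolding C2_eq using L_pos by simp
qed

lemma \<zeta>_le: "j < k \<Longrightarrow> \<zeta> j \<le> \<delta> j" and \<zeta>_pos: "j < k \<Longrightarrow> 0 < \<zeta> j"
  using C2_pos C2_le \<delta>_pos[of j] mult_right_mono[OF C2_le, of "\<delta> j"] by (auto simp: \<zeta>_eq)

lemma cyl_\<zeta>_\<delta>: "x \<in> cyl j \<zeta> \<Longrightarrow> j \<le> k \<Longrightarrow> x \<in> cyl j \<delta>"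
  using nbhd_mono[OF \<zeta>_le] unfolding cyl_def by (auto intro!: subsetD[OF nbhd_mono[OF \<zeta>_le]])

text \<open>
  Clearing denominators in the conditional distribution functions, \<open>t = T\<^sub>j\<^sub>+\<^sub>1(x)\<close> solves
  \<open>(t + 1) * smean\<^sub>\<pi>(w, -1, t) = E(w, x)\<close> with \<open>w = T\<^sub>[\<^sub>j\<^sub>](x)\<close>,
  which is \<open>Tc j x\<close> below.
\<close>

definition E :: "nat \<Rightarrow> (nat \<Rightarrow> complex) \<Rightarrow> (nat \<Rightarrow> complex) \<Rightarrow> complex \<Rightarrow> complex" where
  "E j w x s = \<pi>.cmarg j w / \<rho>.cmarg j x * ((s + 1) * \<rho>.smean j x (-1) s)"

definition is_sol :: "nat \<Rightarrow> (nat \<Rightarrow> complex) \<Rightarrow> (nat \<Rightarrow> complex) \<Rightarrow> complex \<Rightarrow> bool" where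
  "is_sol j w x t \<longleftrightarrow> t \<in> N j \<and> (t + 1) * \<pi>.smean j w (-1) t = E j w x (x j)"

text \<open>The choice is forced wherever \<open>sol\<close> is used with arguments in the domain:
  \<open>solution_exists\<close> and \<open>is_sol_unique\<close> give exactly one solution.\<close>

definition sol :: "nat \<Rightarrow> (nat \<Rightarrow> complex) \<Rightarrow> (nat \<Rightarrow> complex) \<Rightarrow> complex" where
  "sol j w x = (SOME t. is_sol j w x t)"

text \<open>Entry \<open>i\<close> is set at stage \<open>i + 1\<close> and kept at all later
  stages; entries not yet reached are 0.\<close>

primrec Tc :: "nat \<Rightarrow> (nat \<Rightarrow> complex) \<Rightarrow> nat \<Rightarrow> complex" where
  "Tc 0 x = (\<lambda>_. 0)"
| "Tc (Suc j) x = (Tc j x)(j := sol j (Tc j x) x)"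

lemma E_cong:
  assumes "\<And>i. i < j \<Longrightarrow> w i = w' i" "\<And>i. i < j \<Longrightarrow> x i = x' i"
  shows "E j w x s = E j w' x' s"
  unfolding E_def
  using \<rho>.cmarg_cong[OF assms(2)] \<pi>.cmarg_cong[OF assms(1)] \<rho>.smean_cong[OF assms(2)] by simp

lemma is_sol_cong:
  assumes "\<And>i. i < j \<Longrightarrow> w i = w' i" "\<And>i. i < Suc j \<Longrightarrow> x i = x' i"
  shows "is_sol j w x t \<longleftrightarrow> is_sol j w' x' t"
proof -
  have "E j w x s = E j w' x' s" for s using assms by (intro E_cong) auto
  then show ?thesis
    unfolding is_sol_def using \<pi>.smean_cong[OF assms(1)] assms(2) by simp
qed

lemma Tc_cong: "(\<And>i. i < j \<Longrightarrow> x i = x' i) \<Longrightarrow> Tc j x = Tc j x'"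
proof (induction j)
  case (Suc j)
  then have "Tc j x = Tc j x'" by simp
  moreover have "is_sol j w x = is_sol j w x'" for w
    using Suc.prems by (intro ext is_sol_cong) auto
  ultimately show ?case by (simp add: sol_def)
qed simp

text \<open>The residual of a trial value \<open>t0\<close> is \<open>t - t0\<close> times a mean of
  modulus at least \<open>M / 2\<close>. Trial values used later: another solution for uniqueness,
  the solution at a neighbouring point for continuity, and -1 for a bound on the size of the
  solution.\<close>

lemma sol_difference_bound:
  assumes w: "w \<in> cyl j \<delta>" and j: "j < k" and t: "is_sol j w x t" and t0: "t0 \<in> N j"
  shows "cmod (t - t0) \<le> 2 / M * cmod (E j w x (x j) - (t0 + 1) * \<pi>.smean j w (-1) t0)"
proof -
  have tN: "t \<in> N j" using t by (simp add: is_sol_def)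
  have "E j w x (x j) - (t0 + 1) * \<pi>.smean j w (-1) t0 = (t - t0) * \<pi>.smean j w t0 t"
    using t \<pi>.smean_reverse[OF w t0 tN j] by (simp add: is_sol_def)
  then have "cmod (E j w x (x j) - (t0 + 1) * \<pi>.smean j w (-1) t0) \<ge> cmod (t - t0) * (M / 2)"
    using \<pi>.smean_norm_ge[OF w t0 tN j] by (simp only: norm_mult) (intro mult_left_mono norm_ge_zero)
  then show ?thesis using M_pos by (simp add: field_simps)
qed

lemma is_sol_unique:
  assumes "w \<in> cyl j \<delta>" "j < k" "is_sol j w x t" "is_sol j w x t'"
  shows "t = t'"
  using sol_difference_bound[OF assms(1-3), of t'] assms(4) by (simp add: is_sol_def)

lemma E_difference:
  assumes x: "x \<in> cyl j \<delta>" and s: "s \<in> N j" "s0 \<in> N j" and j: "j < k"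
  shows "E j w x s - E j w x s0 = \<pi>.cmarg j w / \<rho>.cmarg j x * ((s - s0) * \<rho>.smean j x s0 s)"
  unfolding E_def right_diff_distrib[symmetric] \<rho>.smean_reverse[OF x s(2,1) j] ..

lemma cmarg_ratio_le:
  assumes "x \<in> cyl j \<delta>" "w \<in> cyl j \<delta>" "j \<le> k"
  shows "cmod (\<pi>.cmarg j w / \<rho>.cmarg j x) \<le> 2 * L / M"
  using norm_divide_le[OF \<pi>.cmarg_norm_le[OF assms(3,2)] \<rho>.cmarg_norm_ge[OF assms(1,3)]] M_pos by (simp add: mult.commute)

text \<open>Intermediate value theorem: the left-hand side runs from 0 to twice the marginal
  \<open>p\<close> of \<open>\<pi>\<close> at \<open>v\<close>, and \<open>A\<close> lies between 0
  and twice the marginal \<open>r\<close> of \<open>\<rho>\<close> at \<open>u\<close>, so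
  \<open>p / r * A\<close> is in range. No relation between \<open>u\<close> and \<open>v\<close> is
  assumed.\<close>

lemma real_solution:
  assumes u: "u \<in> U" and v: "v \<in> U" and j: "j < k" and s: "s \<in> U1"
  obtains t where "t \<in> U1"
    "(of_real t + 1) * \<pi>.smean j (cpx v) (-1) (of_real t) = E j (cpx v) (cpx u) (of_real s)"
proof -
  have U1_N: "of_real a \<in> N j" if "a \<in> U1" for a using of_real_in_nbhd[OF that \<delta>_pos[OF j]] .
  have m1: "(-1 :: complex) = of_real (-1)" "(1 :: complex) = of_real 1" "(-1::real) \<in> U1" "(1::real) \<in> U1"
    by (auto simp: U1_def)
  have uc: "cpx u \<in> cyl j \<delta>" and vc: "cpx v \<in> cyl j \<delta>"
    using \<rho>.cpx_in_cyl u v j by auto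
  define \<psi> where "\<psi> = (\<lambda>t::real. Re ((of_real t + 1) * \<pi>.smean j (cpx v) (-1) (of_real t)))"
  have real\<pi>: "(of_real t + 1) * \<pi>.smean j (cpx v) (-1) (of_real t) = of_real (\<psi> t)" if "t \<in> U1" for t
    using \<pi>.smean_cpx_real[OF v j m1(3) that] unfolding \<psi>_def
    by (metis Reals_add Reals_mult Reals_of_real m1(1) m1(2) of_real_Re)
  define p where "p = Re (\<pi>.cmarg j (cpx v))"
  define r where "r = Re (\<rho>.cmarg j (cpx u))"
  have pr: "\<pi>.cmarg j (cpx v) = of_real p" "\<rho>.cmarg j (cpx u) = of_real r" "p > 0" "r > 0"
    using \<pi>.cmarg_cpx[OF v] \<rho>.cmarg_cpx[OF u] \<pi>.cmarg_cpx_bounds[OF v, of j] \<rho>.cmarg_cpx_bounds[OF u, of j] j M_pos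
    by (auto simp: p_def r_def)
  define A where "A = Re ((of_real s + 1) * \<rho>.smean j (cpx u) (-1) (of_real s))"
  have realA: "(of_real s + 1) * \<rho>.smean j (cpx u) (-1) (of_real s) = of_real A"
    using \<rho>.smean_cpx_real[OF u j m1(3) s] unfolding A_def
    by (metis Reals_add Reals_mult Reals_of_real m1(1) m1(2) of_real_Re)
  have s': "0 \<le> s + 1" "0 \<le> 1 - s" using s by (auto simp: U1_def)
  have "A = (s + 1) * Re (\<rho>.smean j (cpx u) (-1) (of_real s))" unfolding A_def by simp
  moreover have "Re (\<rho>.smean j (cpx u) (-1) (of_real s)) \<ge> 0"
    using \<rho>.smean_Re_ge[OF uc \<rho>.minus_one_in_nbhd[OF j] U1_N[OF s] j] M_pos by linarith
  ultimately have A0: "0 \<le> A" using s' by simp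
  have "(1 + 1) * \<rho>.smean j (cpx u) (-1) 1 - (of_real s + 1) * \<rho>.smean j (cpx u) (-1) (of_real s)
      = (1 - of_real s) * \<rho>.smean j (cpx u) (of_real s) 1"
    using \<rho>.smean_reverse[OF uc U1_N[OF s] U1_N[OF m1(4)] j] by simp
  then have "2 * of_real r - of_real A = of_real (1 - s) * \<rho>.smean j (cpx u) (of_real s) 1"
    using realA \<rho>.smean_full[OF uc j] pr by simp
  then have "2 * r - A = Re (of_real (1 - s) * \<rho>.smean j (cpx u) (of_real s) 1)"
    by (metis Re_complex_of_real of_real_diff of_real_mult of_real_numeral)
  then have "2 * r - A = (1 - s) * Re (\<rho>.smean j (cpx u) (of_real s) 1)" by simp
  moreover have "Re (\<rho>.smean j (cpx u) (of_real s) 1) \<ge> 0"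
    using \<rho>.smean_Re_ge[OF uc U1_N[OF s] U1_N[OF m1(4)] j] M_pos by simp
  ultimately have A2: "A \<le> 2 * r" using s' by (metis diff_ge_0_iff_ge mult_nonneg_nonneg)
  have "continuous_on U1 (\<lambda>t. (of_real t + 1) * \<pi>.smean j (cpx v) (-1) (of_real t))"
    by (rule continuous_on_compose2[OF holomorphic_on_imp_continuous_on[OF \<pi>.smean_line_hol[OF vc j]]])
      (use U1_N in \<open>auto intro!: continuous_intros\<close>)
  then have cont: "continuous_on {-1..1} \<psi>"
    unfolding \<psi>_def U1_def by (rule continuous_on_Re)
  have "\<psi> (-1) \<le> p / r * A" using A0 pr by (simp add: \<psi>_def)
  moreover have "\<psi> 1 = 2 * p" using \<pi>.smean_full[OF vc j] pr by (simp add: \<psi>_def)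
  then have "p / r * A \<le> \<psi> 1"
    using mult_left_mono[OF A2, of "p / r"] pr by simp
  ultimately obtain t where t: "t \<in> {-1..1}" "\<psi> t = p / r * A"
    using IVT'[of \<psi> "-1" "p / r * A" 1] cont by auto
  show ?thesis
  proof (rule that)
    show tU: "t \<in> U1" using t by (simp add: U1_def)
    show "(of_real t + 1) * \<pi>.smean j (cpx v) (-1) (of_real t) = E j (cpx v) (cpx u) (of_real s)"
      unfolding real\<pi>[OF tU] t(2) E_def pr realA by simp
  qed
qed

text \<open>
  The constants are chosen such that the complex equation is a perturbation of a real one by less
  than the radius \<open>M \<delta>\<^sub>j / 2\<close> of a disc that is covered by the left-hand side.
\<close>

lemma solution_exists:
  assumes x: "x \<in> cyl (Suc j) \<zeta>" and w: "w \<in> cyl j \<delta>" and j: "j < k"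
  shows "\<exists>t. is_sol j w x t"
proof -
  have x\<delta>: "x \<in> cyl j \<delta>" and xj: "x j \<in> nbhd (\<zeta> j) U1c" and xN: "x j \<in> N j"
    using x cyl_\<zeta>_\<delta>[OF x] j by (auto simp: cyl_Suc)
  obtain u where u: "u \<in> U" "\<And>i. i < j \<Longrightarrow> cmod (x i - of_real (u i)) < \<delta> i"
    using real_point_near[OF x\<delta>] by blast
  obtain v where v: "v \<in> U" "\<And>i. i < j \<Longrightarrow> cmod (w i - of_real (v i)) < \<delta> i"
    using real_point_near[OF w] by blast
  obtain s where s: "s \<in> U1" "cmod (x j - of_real s) < \<zeta> j" using xj by (auto simp: nbhd_U1c_iff)
  obtain t where t: "t \<in> U1"
    "(of_real t + 1) * \<pi>.smean j (cpx v) (-1) (of_real t) = E j (cpx v) (cpx u) (of_real s)"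
    using real_solution[OF u(1) v(1) j s(1)] by blast
  have uc: "cpx u \<in> cyl j \<delta>" and vc: "cpx v \<in> cyl j \<delta>" using \<rho>.cpx_in_cyl u v j by auto
  have j': "j \<le> k" using j by simp
  note dj = \<delta>_pos[OF j]
  have sN: "of_real s \<in> N j" and tN: "of_real t \<in> N j"
    using of_real_in_nbhd dj s t by auto
  have m1: "(-1 :: complex) = of_real (-1)" "(-1::real) \<in> U1" by (auto simp: U1_def)
  note m1N = \<rho>.minus_one_in_nbhd[OF j]
  define B where "B = C1 * \<delta> j"
  have B0: "0 \<le> B" using \<rho>.C1_pos dj by (simp add: B_def)
  define H where "H = (\<lambda>t. (t + 1) * \<pi>.smean j w (-1) t)"
  \<comment> \<open>Moving the last variable to the real point \<open>s\<close> costs a multiple of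
    \<open>\<zeta> j = C2 * \<delta> j\<close>. The two further errors, from replacing
    \<open>x\<close>, \<open>w\<close> by \<open>u\<close>, \<open>v\<close> on either side of the
    equation, are multiples of \<open>B = C1 * \<delta> j\<close>.\<close>
  have est1: "cmod (E j w x (x j) - E j w x (of_real s)) \<le> 2 * L / M * (\<zeta> j * L)"
    unfolding E_difference[OF x\<delta> xN sN j]
    by (intro norm_mult_le cmarg_ratio_le \<rho>.smean_norm_le) (use x\<delta> w j s sN xN in auto)
  have s2: "cmod (of_real s + 1) \<le> 2" and t2: "cmod (of_real t + 1) \<le> 2"
    using norm_triangle_ineq[of "complex_of_real s" 1] norm_triangle_ineq[of "complex_of_real t" 1] s t
    unfolding norm_of_real norm_one U1_def atLeastAtMost_iff by linarith+
  let ?c = "\<pi>.cmarg j w / \<rho>.cmarg j x" and ?c' = "\<pi>.cmarg j (cpx v) / \<rho>.cmarg j (cpx u)"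
  let ?A = "\<rho>.smean j x (-1) (of_real s)" and ?A' = "\<rho>.smean j (cpx u) (-1) (of_real s)"
  have n\<pi>: "cmod (\<pi>.cmarg j w - \<pi>.cmarg j (cpx v)) \<le> B" unfolding B_def
    by (rule \<pi>.cmarg_near_\<delta>[OF v(1) j' v(2)]) (use j in auto)
  have n\<rho>: "cmod (\<rho>.cmarg j (cpx u) - \<rho>.cmarg j x) \<le> B" unfolding B_def
    by (subst norm_minus_commute, rule \<rho>.cmarg_near_\<delta>[OF u(1) j' u(2)]) (use j in auto)
  have nz: "\<rho>.cmarg j x \<noteq> 0" "\<rho>.cmarg j (cpx u) \<noteq> 0" using \<rho>.cmarg_nonzero x\<delta> uc j' by auto
  have "?c - ?c' = (\<pi>.cmarg j w - \<pi>.cmarg j (cpx v)) / \<rho>.cmarg j x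
      + ?c' * ((\<rho>.cmarg j (cpx u) - \<rho>.cmarg j x) / \<rho>.cmarg j x)"
  proof -
    have "a / x - b / y = (a - b) / x + b / y * ((y - x) / x)" if "x \<noteq> 0" "y \<noteq> 0" for a b x y :: complex
      using that by (simp add: diff_divide_distrib right_diff_distrib)
    from this[OF nz] show ?thesis .
  qed
  also have "cmod \<dots> \<le> B / (M / 2) + 2 * L / M * (B / (M / 2))"
    by (intro norm_triangle_le add_mono norm_mult_le norm_divide_le n\<pi> n\<rho> cmarg_ratio_le \<rho>.cmarg_norm_ge)
      (use x\<delta> uc vc j' M_pos in auto)
  also have "B / (M / 2) + 2 * L / M * (B / (M / 2)) = 2 * B / M * 1 + 4 * B * L / M\<^sup>2"
    by (simp add: power2_eq_square mult_ac)
  \<comment> \<open>Since \<open>1 \<le> L / M\<close>, the error terms can be brought to a common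
    power of \<open>L / M\<close>; the same device is used for the next two estimates.\<close>
  also have "\<dots> \<le> 2 * B / M * (L / M) + 4 * B * L / M\<^sup>2"
    using one_le_quotient(1) B0 M_pos by (intro add_right_mono mult_left_mono) auto
  also have "\<dots> = 6 * B * L / M\<^sup>2" by (simp add: power2_eq_square)
  finally have cdiff: "cmod (?c - ?c') \<le> 6 * B * L / M\<^sup>2" .
  have Adiff: "cmod (?A - ?A') \<le> B"
    unfolding B_def m1(1) by (rule \<rho>.smean_near[OF u(1) j u(2) m1(2) s(1)])
  have "E j w x (of_real s) - E j (cpx v) (cpx u) (of_real s)
      = (?c - ?c') * ((of_real s + 1) * ?A) + ?c' * ((of_real s + 1) * (?A - ?A'))"
    unfolding E_def by (simp only: algebra_simps)
  also have "cmod \<dots> \<le> 6 * B * L / M\<^sup>2 * (2 * L) + 2 * L / M * (2 * B)"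
    by (intro norm_triangle_le add_mono norm_mult_le cdiff s2 Adiff cmarg_ratio_le \<rho>.smean_norm_le)
      (use x\<delta> uc vc j j' m1N sN in auto)
  also have "\<dots> = 12 * (B * (L\<^sup>2 / M\<^sup>2)) + 4 * (B * (L / M)) * 1" by (simp add: power2_eq_square)
  also have "\<dots> \<le> 12 * (B * (L\<^sup>2 / M\<^sup>2)) + 4 * (B * (L / M)) * (L / M)"
    using one_le_quotient(1) B0 M_pos L_pos by (intro add_left_mono mult_left_mono) auto
  also have "\<dots> = 16 * (B * (L\<^sup>2 / M\<^sup>2))" by (simp add: power2_eq_square)
  finally have est2: "cmod (E j w x (of_real s) - E j (cpx v) (cpx u) (of_real s)) \<le> 16 * (B * (L\<^sup>2 / M\<^sup>2))" .
  have "E j (cpx v) (cpx u) (of_real s) - H (of_real t)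
      = (of_real t + 1) * (\<pi>.smean j (cpx v) (-1) (of_real t) - \<pi>.smean j w (-1) (of_real t))"
    unfolding t(2)[symmetric] H_def by (simp only: algebra_simps)
  also have "cmod \<dots> \<le> 2 * B"
    unfolding B_def m1(1)
    by (rule norm_mult_le[OF t2], subst norm_minus_commute, rule \<pi>.smean_near[OF v(1) j v(2) m1(2) t(1)])
  also have "\<dots> \<le> 2 * (B * (L\<^sup>2 / M\<^sup>2))"
    using mult_left_mono[OF one_le_quotient(2) B0] by simp
  finally have est3: "cmod (E j (cpx v) (cpx u) (of_real s) - H (of_real t)) \<le> 2 * (B * (L\<^sup>2 / M\<^sup>2))" .
  have "cmod (E j w x (x j) - H (of_real t)) \<le> 2 * L / M * (\<zeta> j * L) + 16 * (B * (L\<^sup>2 / M\<^sup>2)) + 2 * (B * (L\<^sup>2 / M\<^sup>2))"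
    using est1 est2 est3
      norm_triangle_ineq[of "E j w x (x j) - E j w x (of_real s)" "E j w x (of_real s) - H (of_real t)"]
      norm_triangle_ineq[of "E j w x (of_real s) - E j (cpx v) (cpx u) (of_real s)" "E j (cpx v) (cpx u) (of_real s) - H (of_real t)"]
    by simp
  \<comment> \<open>Here the constants originate: they make the two summands \<open>2 / 16\<close>
    and \<open>18 / 64\<close> times \<open>M * \<delta> j\<close>, in total
    \<open>13 / 32\<close>.\<close>
  also have "\<dots> = 2 * (C2 * L\<^sup>2 / M) * \<delta> j + 18 * (C1 * (L\<^sup>2 / M\<^sup>2)) * \<delta> j"
    by (simp add: B_def \<zeta>_eq power2_eq_square mult_ac)
  also have "C2 * L\<^sup>2 / M = M / 16" unfolding C2_eq using M_pos L_pos by (simp add: field_simps power2_eq_square)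
  also have "C1 * (L\<^sup>2 / M\<^sup>2) = M / 64"
    unfolding C1_eq using M_pos L_pos by (simp add: field_simps power2_eq_square power3_eq_cube)
  finally have total: "cmod (E j w x (x j) - H (of_real t)) \<le> 13 / 32 * M * \<delta> j" by simp
  \<comment> \<open>Below \<open>\<delta> j\<close>, so that the closed disc about \<open>t\<close>
    stays in the domain, and large enough that \<open>M / 2 * r\<close>, which is
    \<open>14 / 32 * M * \<delta> j\<close>, exceeds the total error.\<close>
  define r where "r = 7 / 8 * \<delta> j"
  have r: "0 < r" "r < \<delta> j" using dj by (auto simp: r_def)
  have ball: "z \<in> N j" if "z \<in> cball (of_real t) r" for z
    using that r t unfolding nbhd_U1c_iff
    by (intro bexI[of _ t]) (auto simp: dist_norm norm_minus_commute)
  have holH: "H holomorphic_on N j" unfolding H_def by (rule \<pi>.smean_line_hol[OF w j])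
  have Hge: "M / 2 * cmod (b - a) \<le> cmod (H b - H a)" if "a \<in> N j" "b \<in> N j" for a b
    unfolding H_def \<pi>.smean_reverse[OF w that j] norm_mult
    using mult_left_mono[OF \<pi>.smean_norm_ge[OF w that j] norm_ge_zero[of "b - a"]] by (simp add: mult.commute)
  have "inj_on H (N j)"
  proof (rule inj_onI)
    fix a b assume "a \<in> N j" "b \<in> N j" "H a = H b"
    then show "a = b" using Hge[of a b] M_pos by (simp add: mult_le_0_iff)
  qed
  then have "open (H ` ball (of_real t) r)"
    using ball holH
    by (intro open_mapping_thm3)
      (auto intro: holomorphic_on_subset inj_on_subset simp: less_imp_le subset_eq)
  \<comment> \<open>The image of the disc is open, and the boundary circle is mapped to distance at
    least \<open>M / 2 * r\<close> from the image of the centre; a disc of that radius therefore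
    cannot leave the image.\<close>
  then have "ball (H (of_real t)) (M / 2 * r) \<subseteq> H ` ball (of_real t) r"
  proof (intro ball_subset_open_map_image)
    show "continuous_on (closure (ball (of_real t) r)) H"
      using r ball by (simp add: continuous_on_subset[OF holomorphic_on_imp_continuous_on[OF holH]] subset_eq)
    show "M / 2 * r \<le> cmod (H z - H (of_real t))" if "z \<in> frontier (ball (of_real t) r)" for z
      using that Hge[OF tN ball, of z] r by (simp add: dist_norm norm_minus_commute)
  qed (use r M_pos in auto)
  moreover have "E j w x (x j) \<in> ball (H (of_real t)) (M / 2 * r)"
  proof -
    have "13 / 32 * M * \<delta> j < M / 2 * r" using M_pos dj by (simp add: r_def)
    then show ?thesis using total by (simp add: dist_norm norm_minus_commute)
  qed
  ultimately obtain z where "z \<in> ball (of_real t) r" "H z = E j w x (x j)" by force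
  then have "is_sol j w x z" using ball by (simp add: is_sol_def H_def)
  then show ?thesis ..
qed

text \<open>Radii \<open>\<zeta>\<close> for \<open>x\<close>, but the full radii
  \<open>\<delta>\<close> for the image: membership in \<open>N j\<close> is part of being a
  solution, and \<open>solution_exists\<close> asks no more of the earlier components.\<close>

lemma Tc_in_cyl: "j \<le> k \<Longrightarrow> x \<in> cyl j \<zeta> \<Longrightarrow> Tc j x \<in> cyl j \<delta>"
proof (induction j)
  case (Suc j)
  then have w: "Tc j x \<in> cyl j \<delta>" by (simp add: cyl_Suc)
  have "is_sol j (Tc j x) x (sol j (Tc j x) x)"
    unfolding sol_def by (rule someI_ex[OF solution_exists[OF Suc.prems(2) w]]) (use Suc.prems in simp)
  then show ?case using w by (simp add: cyl_Suc_upd is_sol_def del: fun_upd_apply)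
qed (simp add: cyl_def)

lemma Tc_is_sol:
  assumes "j < k" "x \<in> cyl (Suc j) \<zeta>"
  shows "is_sol j (Tc j x) x (Tc (Suc j) x j)"
proof -
  have "Tc j x \<in> cyl j \<delta>" using assms by (intro Tc_in_cyl) (auto simp: cyl_Suc)
  then show ?thesis
    unfolding Tc.simps fun_upd_same sol_def
    by (rule someI_ex[OF solution_exists[OF assms(2) _ assms(1)]])
qed

end

subsection \<open>Regularity of the extension\<close>

lemma tendsto_of_norm_bound:
  fixes g h :: "'a::topological_space \<Rightarrow> complex"
  assumes g: "(g \<longlongrightarrow> 0) (at x0 within S)" and h: "\<And>x. x \<in> S \<Longrightarrow> cmod (h x - l) \<le> K * cmod (g x)"
  shows "(h \<longlongrightarrow> l) (at x0 within S)"
proof -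
  have "((\<lambda>x. K * cmod (g x)) \<longlongrightarrow> K * cmod 0) (at x0 within S)"
    by (intro tendsto_intros g)
  then have "((\<lambda>x. K * cmod (g x)) \<longlongrightarrow> 0) (at x0 within S)" by simp
  moreover have "\<forall>\<^sub>F x in at x0 within S. cmod (h x - l) \<le> K * cmod (g x)"
    unfolding eventually_at_filter by (rule always_eventually) (use h in blast)
  ultimately have "((\<lambda>x. h x - l) \<longlongrightarrow> 0) (at x0 within S)" by (rule Lim_null_comparison[rotated])
  then show ?thesis by (simp only: LIM_zero_iff)
qed

context KR_extension
begin

lemma continuous_on_E:
  assumes j: "j < k" and w: "continuous_on S w" and x: "continuous_on S x" and s: "continuous_on S s"
    and sub: "\<And>p. p \<in> S \<Longrightarrow> w p \<in> cyl j \<delta> \<and> x p \<in> cyl j \<delta> \<and> s p \<in> N j"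
  shows "continuous_on S (\<lambda>p. E j (w p) (x p) (s p))"
proof -
  have j': "j \<le> k" using j by simp
  have 1: "continuous_on S (\<lambda>p. \<pi>.cmarg j (w p))" "continuous_on S (\<lambda>p. \<rho>.cmarg j (x p))"
    using sub by (auto intro!: continuous_on_compose2[OF \<pi>.cmarg_cont[OF j'] w] continuous_on_compose2[OF \<rho>.cmarg_cont[OF j'] x])
  have "continuous_on S (\<lambda>p. (x p, -1::complex, s p))" by (intro continuous_intros x s)
  from continuous_on_compose2[OF \<rho>.smean_cont[OF j] this]
  have 2: "continuous_on S (\<lambda>p. \<rho>.smean j (x p) (-1) (s p))"
    using sub \<rho>.minus_one_in_nbhd[OF j] by (simp add: image_subset_iff)
  show ?thesis unfolding E_def
    by (intro continuous_intros 1 2 s) (use sub \<rho>.cmarg_nonzero j' in auto)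
qed

lemma holomorphic_on_E:
  assumes j: "j < k" and V: "open V"
    and w: "\<And>i. i < j \<Longrightarrow> (\<lambda>z. w z i) holomorphic_on V" and x: "\<And>i. i < j \<Longrightarrow> (\<lambda>z. x z i) holomorphic_on V"
    and s: "s holomorphic_on V"
    and sub: "\<And>p. p \<in> V \<Longrightarrow> w p \<in> cyl j \<delta> \<and> x p \<in> cyl j \<delta> \<and> s p \<in> N j"
  shows "(\<lambda>p. E j (w p) (x p) (s p)) holomorphic_on V"
proof -
  have j': "j \<le> k" using j by simp
  have "(\<lambda>p. \<pi>.cmarg j (w p)) holomorphic_on V" "(\<lambda>p. \<rho>.cmarg j (x p)) holomorphic_on V"
    using sub by (auto intro!: hol_alongD[OF \<pi>.cmarg_hol[OF j'] V _ w] hol_alongD[OF \<rho>.cmarg_hol[OF j'] V _ x])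
  moreover have "(\<lambda>p. \<rho>.smean j (x p) (-1) (s p)) holomorphic_on V"
    using sub \<rho>.minus_one_in_nbhd[OF j] by (intro \<rho>.smean_hol[OF j V] x s holomorphic_on_const) auto
  ultimately show ?thesis unfolding E_def
    using sub \<rho>.cmarg_nonzero j' s by (auto intro!: holomorphic_intros)
qed

text \<open>The residual \<open>g\<close> of the old value \<open>t0\<close> in the equation at
  \<open>x\<close> is continuous and vanishes at \<open>x0\<close>; it controls the distance of the
  new solution from \<open>t0\<close>.\<close>

lemma Tc_cont: "j \<le> k \<Longrightarrow> continuous_on (cyl j \<zeta>) (Tc j)"
proof (induction j)
  case (Suc j)
  then have j: "j < k" by simp
  let ?S = "cyl (Suc j) \<zeta>"
  have sub: "x \<in> cyl j \<zeta> \<and> Tc j x \<in> cyl j \<delta> \<and> x \<in> cyl j \<delta> \<and> x j \<in> N j" if "x \<in> ?S" for x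
    using that Tc_in_cyl[of j x] cyl_\<zeta>_\<delta>[OF that] j by (simp add: cyl_Suc)
  have w: "continuous_on ?S (Tc j)"
    by (rule continuous_on_subset[OF Suc.IH]) (use j sub in auto)
  have "continuous_on ?S (\<lambda>x. Tc (Suc j) x j)"
    unfolding continuous_on_def
  proof
    fix x0 assume x0: "x0 \<in> ?S"
    define t0 where "t0 = Tc (Suc j) x0 j"
    have t0: "is_sol j (Tc j x0) x0 t0" unfolding t0_def by (rule Tc_is_sol[OF j x0])
    then have t0N: "t0 \<in> N j" by (simp add: is_sol_def)
    define g where "g = (\<lambda>x. E j (Tc j x) x (x j) - (t0 + 1) * \<pi>.smean j (Tc j x) (-1) t0)"
    have "continuous_on ?S (\<lambda>x. (Tc j x, -1::complex, t0))" by (intro continuous_intros w)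
    from continuous_on_compose2[OF \<pi>.smean_cont[OF j] this]
    have "continuous_on ?S (\<lambda>x. \<pi>.smean j (Tc j x) (-1) t0)"
      using sub \<pi>.minus_one_in_nbhd[OF j] t0N by (simp add: image_subset_iff)
    moreover have "continuous_on ?S (\<lambda>x. E j (Tc j x) x (x j))"
      by (rule continuous_on_E[OF j w continuous_on_id])
        (use sub continuous_on_product_then_coordinatewise[OF continuous_on_id] in auto)
    ultimately have "continuous_on ?S g" unfolding g_def by (intro continuous_intros)
    moreover have "g x0 = 0" using t0 by (simp add: g_def is_sol_def)
    ultimately have "(g \<longlongrightarrow> 0) (at x0 within ?S)" using x0 by (metis continuous_on_def)
    then show "((\<lambda>x. Tc (Suc j) x j) \<longlongrightarrow> Tc (Suc j) x0 j) (at x0 within ?S)"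
      unfolding t0_def[symmetric]
    proof (rule tendsto_of_norm_bound)
      show "cmod (Tc (Suc j) x j - t0) \<le> 2 / M * cmod (g x)" if "x \<in> ?S" for x
        unfolding g_def using sub[OF that] by (intro sol_difference_bound[OF _ j Tc_is_sol[OF j that] t0N]) blast
    qed
  qed
  from continuous_on_fun_upd[OF w this, of j] show ?case by (simp del: fun_upd_apply add: fun_upd_same)
qed simp

text \<open>The residual of the fixed value \<open>t z0\<close> is holomorphic along the curve and
  equals \<open>(t z - t z0) * ?Q z\<close>. Dividing by the nonzero continuous mean
  \<open>?Q\<close> turns its difference quotient into that of \<open>t\<close>.\<close>

lemma Tc_hol: "j \<le> k \<Longrightarrow> hol_along j (cyl j \<zeta>) (\<lambda>x. Tc j x i)"
proof (induction j arbitrary: i)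
  case 0
  show ?case by (simp add: hol_along_def)
next
  case (Suc j)
  then have j: "j < k" by simp
  show ?case unfolding hol_along_def
  proof (intro allI impI)
    fix V and \<gamma> :: "complex \<Rightarrow> nat \<Rightarrow> complex"
    assume V: "open V" and \<gamma>: "\<forall>z\<in>V. \<gamma> z \<in> cyl (Suc j) \<zeta>"
      and hol: "\<forall>i<Suc j. (\<lambda>z. \<gamma> z i) holomorphic_on V"
    define w where "w = (\<lambda>z. Tc j (\<gamma> z))"
    define t where "t = (\<lambda>z. Tc (Suc j) (\<gamma> z) j)"
    have sub: "\<gamma> z \<in> cyl j \<zeta>" "w z \<in> cyl j \<delta>" "\<gamma> z \<in> cyl j \<delta>" "\<gamma> z j \<in> N j"
      and t: "is_sol j (w z) (\<gamma> z) (t z)" and tN: "t z \<in> N j" if "z \<in> V" for z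
      using Tc_in_cyl[of j "\<gamma> z"] cyl_\<zeta>_\<delta>[of "\<gamma> z" "Suc j"] Tc_is_sol[OF j, of "\<gamma> z"] j \<gamma> that
      by (auto simp: cyl_Suc w_def t_def is_sol_def simp del: Tc.simps)
    have holw: "(\<lambda>z. w z i) holomorphic_on V" for i
      unfolding w_def by (rule hol_alongD[OF Suc.IH V]) (use j sub hol in auto)
    have contw: "continuous_on V w"
      by (rule continuous_on_coordinatewise_then_product) (intro holomorphic_on_imp_continuous_on holw)
    define g where "g = (\<lambda>t0 z. E j (w z) (\<gamma> z) (\<gamma> z j) - (t0 + 1) * \<pi>.smean j (w z) (-1) t0)"
    have holg: "g t0 holomorphic_on V" if "t0 \<in> N j" for t0
      unfolding g_def
      by (intro holomorphic_intros holomorphic_on_E[OF j V] \<pi>.smean_hol[OF j V])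
        (use sub hol holw \<pi>.minus_one_in_nbhd[OF j] that in auto)
    have g0: "g (t z) z = 0" if "z \<in> V" for z
      using t[OF that] by (simp add: g_def is_sol_def)
    \<comment> \<open>\<open>Tc_cont\<close> cannot simply be composed with \<open>\<gamma>\<close>,
      whose coordinates beyond \<open>j\<close> may be discontinuous; the residual argument is
      repeated along the curve.\<close>
    have contt: "continuous_on V t"
      unfolding continuous_on_def
    proof
      fix z0 assume z0: "z0 \<in> V"
      have "(g (t z0) \<longlongrightarrow> 0) (at z0 within V)"
        using holomorphic_on_imp_continuous_on[OF holg[OF tN[OF z0]]] z0 g0[OF z0]
        by (metis continuous_on_def)
      then show "(t \<longlongrightarrow> t z0) (at z0 within V)"
      proof (rule tendsto_of_norm_bound)
        show "cmod (t z - t z0) \<le> 2 / M * cmod (g (t z0) z)" if "z \<in> V" for z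
          unfolding g_def by (rule sol_difference_bound[OF sub(2)[OF that] j t[OF that] tN[OF z0]])
      qed
    qed
    have "t holomorphic_on V"
    proof (rule holomorphic_onI)
      fix z0 assume z0: "z0 \<in> V"
      let ?Q = "\<lambda>z. \<pi>.smean j (w z) (t z0) (t z)"
      have "continuous_on V (\<lambda>z. (w z, t z0, t z))" by (intro continuous_intros contw contt)
      from continuous_on_compose2[OF \<pi>.smean_cont[OF j] this]
      have "continuous_on V ?Q" using sub tN z0 by (simp add: image_subset_iff)
      then have Q: "(?Q \<longlongrightarrow> ?Q z0) (at z0 within V)" using z0 by (simp add: continuous_on_def)
      have "(g (t z0) has_field_derivative deriv (g (t z0)) z0) (at z0 within V)"
        using holomorphic_derivI[OF holg[OF tN[OF z0]] V z0] by (rule has_field_derivative_at_within)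
      then have "((\<lambda>z. g (t z0) z / (z - z0)) \<longlongrightarrow> deriv (g (t z0)) z0) (at z0 within V)"
        by (simp add: has_field_derivative_iff g0[OF z0])
      from tendsto_divide[OF this Q] \<pi>.smean_nonzero[OF sub(2) tN tN j] z0
      have "((\<lambda>z. g (t z0) z / (z - z0) / ?Q z) \<longlongrightarrow> deriv (g (t z0)) z0 / ?Q z0) (at z0 within V)"
        by blast
      moreover have "\<forall>\<^sub>F z in at z0 within V. g (t z0) z / (z - z0) / ?Q z = (t z - t z0) / (z - z0)"
        unfolding eventually_at_filter
      proof (rule always_eventually, intro allI impI)
        fix z assume z: "z \<in> V"
        have "g (t z0) z = (t z - t z0) * ?Q z"
          using t[OF z] \<pi>.smean_reverse[OF sub(2)[OF z] tN[OF z0] tN[OF z] j] by (simp add: g_def is_sol_def)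
        then show "g (t z0) z / (z - z0) / ?Q z = (t z - t z0) / (z - z0)"
          using \<pi>.smean_nonzero[OF sub(2)[OF z] tN[OF z0] tN[OF z] j] by simp
      qed
      ultimately have "((\<lambda>z. (t z - t z0) / (z - z0)) \<longlongrightarrow> deriv (g (t z0)) z0 / ?Q z0) (at z0 within V)"
        by (rule Lim_transform_eventually)
      then show "t field_differentiable at z0 within V"
        unfolding field_differentiable_def has_field_derivative_iff by blast
    qed
    then show "(\<lambda>z. Tc (Suc j) (\<gamma> z) i) holomorphic_on V"
      using holw[of i] by (cases "i = j") (simp_all add: t_def w_def)
  qed
qed

section \<open>Agreement with the real transport\<close>

definition Tr :: "(nat \<Rightarrow> real) \<Rightarrow> nat \<Rightarrow> real" where
  "Tr u = (\<lambda>j. T j (trunc (Suc j) u))"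

lemma transport_j:
  assumes "u \<in> U"
  shows "mono_transport (cond_measure \<rho>.fr j u) (cond_measure \<pi>.fr j (Tr u)) (\<lambda>s. T j (trunc (Suc j) (u(j := s))))"
  using KR assms unfolding KR_transport_def Tr_def by blast

lemma Tr_in_U: assumes u: "u \<in> U" shows "Tr u \<in> U"
proof -
  have "T j (trunc (Suc j) (u(j := u j))) \<in> U1" for j
  proof -
    have "u j \<in> U1" using u by (simp add: U_def)
    then show ?thesis using transport_j[OF u, of j] unfolding mono_transport_def by blast
  qed
  then show ?thesis by (simp add: U_def Tr_def)
qed

text \<open>Monotone transport equates the conditional distribution functions at \<open>u j\<close>
  and \<open>Tr u j\<close>. Clearing the normalising marginals \<open>m\<close> and
  \<open>n\<close> gives the equation behind \<open>is_sol\<close>.\<close>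

lemma Tr_is_sol:
  assumes u: "u \<in> U" and j: "j < k"
  shows "is_sol j (cpx (Tr u)) (cpx u) (of_real (Tr u j))"
proof -
  let ?p = "\<lambda>s. marg \<rho>.fr (Suc j) (u(j := s))" and ?q = "\<lambda>s. marg \<pi>.fr (Suc j) ((Tr u)(j := s))"
  define m where "m = marg \<rho>.fr j u"
  define n where "n = marg \<pi>.fr j (Tr u)"
  note v = Tr_in_U[OF u]
  have mn: "M \<le> m" "M \<le> n" "0 < m" "0 < n"
    using \<rho>.marg_bounds[OF u, of j] \<pi>.marg_bounds[OF v, of j] j M_pos by (auto simp: m_def n_def)
  have uj: "u j \<in> U1" and vj: "Tr u j \<in> U1" using u v by (auto simp: U_def)
  have up: "u(j := s) \<in> U" "(Tr u)(j := s) \<in> U" if "s \<in> U1" for s using u v that by (auto simp: U_def)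
  have meas: "(\<lambda>s. h s / c) \<in> borel_measurable lam" if "continuous_on U1 h" for h :: "real \<Rightarrow> real" and c
    using borel_measurable_continuous_on_restrict[OF that]
    by (intro borel_measurable_divide) (simp_all cong: measurable_cong_sets add: sets_lam)
  have "(\<integral>\<sigma>. indicator {-1..u j} \<sigma> * (?p \<sigma> / m) \<partial>lam)
     = (\<integral>\<sigma>. indicator {-1..T j (trunc (Suc j) (u(j := u j)))} \<sigma> * (?q \<sigma> / n) \<partial>lam)"
  proof (rule mono_transport_integral_eq[where B = "L / M"])
    show "mono_transport (density lam (\<lambda>s. ennreal (?p s / m))) (density lam (\<lambda>s. ennreal (?q s / n)))
       (\<lambda>s. T j (trunc (Suc j) (u(j := s))))"
      using transport_j[OF u, of j] by (simp add: cond_measure_def \<rho>.cond_dens_eq \<pi>.cond_dens_eq m_def n_def)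
    show "(\<lambda>s. ?p s / m) \<in> borel_measurable lam" by (rule meas[OF \<rho>.marg_cont[OF u j]])
    show "(\<lambda>s. ?q s / n) \<in> borel_measurable lam" by (rule meas[OF \<pi>.marg_cont[OF v j]])
    fix s assume s: "s \<in> U1"
    note b = \<rho>.marg_bounds[OF up(1)[OF s], of "Suc j"] \<pi>.marg_bounds[OF up(2)[OF s], of "Suc j"]
    show "0 \<le> ?p s / m" "0 \<le> ?q s / n" using b mn M_pos j by auto
    show "?p s / m \<le> L / M" "?q s / n \<le> L / M" using b mn M_pos L_pos j by (auto intro!: frac_le)
  qed (rule uj)
  then have "(2 * (\<integral>\<sigma>. indicator {-1..u j} \<sigma> * ?p \<sigma> \<partial>lam)) / m = (2 * (\<integral>\<sigma>. indicator {-1..Tr u j} \<sigma> * ?q \<sigma> \<partial>lam)) / n"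
    by (simp add: Tr_def)
  then have "complex_of_real (2 * (\<integral>\<sigma>. indicator {-1..u j} \<sigma> * ?p \<sigma> \<partial>lam)) / of_real m
      = of_real (2 * (\<integral>\<sigma>. indicator {-1..Tr u j} \<sigma> * ?q \<sigma> \<partial>lam)) / of_real n"
    unfolding of_real_divide[symmetric] by (rule arg_cong)
  then have "(of_real (u j) + 1) * \<rho>.smean j (cpx u) (-1) (of_real (u j)) / of_real m
      = (of_real (Tr u j) + 1) * \<pi>.smean j (cpx (Tr u)) (-1) (of_real (Tr u j)) / of_real n"
    unfolding \<rho>.smean_cpx_initial[OF u j uj] \<pi>.smean_cpx_initial[OF v j vj] .
  moreover have "\<rho>.cmarg j (cpx u) = of_real m" "\<pi>.cmarg j (cpx (Tr u)) = of_real n"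
    using \<rho>.cmarg_cpx[OF u, of j] \<pi>.cmarg_cpx[OF v, of j] j by (auto simp: m_def n_def)
  ultimately show ?thesis
    unfolding is_sol_def E_def using mn of_real_in_nbhd[OF vj \<delta>_pos[OF j]]
    by (simp add: cpx_def field_simps)
qed

lemma cpx_in_cyl_\<zeta>: "u \<in> U \<Longrightarrow> j \<le> k \<Longrightarrow> cpx u \<in> cyl j \<zeta>"
  using \<zeta>_pos by (auto simp: cyl_def cpx_def U_def intro!: of_real_in_nbhd)

text \<open>By induction, the real transport and the complex recursion solve the same equation,
  whose solution is unique.\<close>

lemma Tc_cpx:
  assumes u: "u \<in> U" shows "j \<le> k \<Longrightarrow> i < j \<Longrightarrow> Tc j (cpx u) i = of_real (Tr u i)"
proof (induction j arbitrary: i)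
  case (Suc j)
  show ?case
  proof (cases "i = j")
    case True
    have c: "cpx u \<in> cyl (Suc j) \<zeta>" using cpx_in_cyl_\<zeta>[OF u Suc.prems(1)] .
    have w: "Tc j (cpx u) \<in> cyl j \<delta>" using c Suc.prems by (intro Tc_in_cyl) (auto simp: cyl_Suc)
    have "is_sol j (Tc j (cpx u)) (cpx u) (of_real (Tr u j))"
      using Tr_is_sol[OF u, of j] Suc is_sol_cong[of j "Tc j (cpx u)" "cpx (Tr u)" "cpx u" "cpx u"]
      by (simp add: cpx_def)
    then show ?thesis
      using is_sol_unique[OF w _ Tc_is_sol[OF _ c]] Suc.prems True by auto
  qed (use Suc in simp)
qed simp

section \<open>The extended derivative\<close>

definition R :: "nat \<Rightarrow> (nat \<Rightarrow> complex) \<Rightarrow> complex" where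
  "R j x = (\<rho>.cmarg (Suc j) x / \<rho>.cmarg j x) / (\<pi>.cmarg (Suc j) (Tc (Suc j) x) / \<pi>.cmarg j (Tc (Suc j) x))"

lemma R_domain:
  assumes "j < k" "x \<in> cyl (Suc j) \<zeta>"
  shows "x \<in> cyl (Suc j) \<delta>" "x \<in> cyl j \<delta>" "Tc (Suc j) x \<in> cyl (Suc j) \<delta>" "Tc (Suc j) x \<in> cyl j \<delta>"
  using assms cyl_\<zeta>_\<delta>[OF assms(2)] Tc_in_cyl[OF _ assms(2)] by (auto simp: cyl_Suc)

lemma R_C1:
  assumes j: "j < k" shows "C1_on (Suc j) (cube_nbhd (Suc j) \<zeta>) (R j)"
proof -
  note dom = R_domain[OF j]
  note nz = \<rho>.cmarg_nonzero[OF dom(1)] \<rho>.cmarg_nonzero[OF dom(2)] \<pi>.cmarg_nonzero[OF dom(3)] \<pi>.cmarg_nonzero[OF dom(4)]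
  have id: "continuous_on (cyl (Suc j) \<zeta>) (\<lambda>x. x)" by (rule continuous_on_id)
  have TTc: "continuous_on (cyl (Suc j) \<zeta>) (Tc (Suc j))" using j by (intro Tc_cont) auto
  have "continuous_on (cyl (Suc j) \<zeta>) (R j)"
    unfolding R_def
    by (intro continuous_intros continuous_on_compose2[OF \<rho>.cmarg_cont id] continuous_on_compose2[OF \<pi>.cmarg_cont TTc])
      (use j dom nz in \<open>auto simp del: Tc.simps\<close>)
  moreover have "hol_along (Suc j) (cyl (Suc j) \<zeta>) (R j)"
    unfolding hol_along_def
  proof (intro allI impI)
    fix V and \<gamma> :: "complex \<Rightarrow> nat \<Rightarrow> complex"
    assume V: "open V" and \<gamma>: "\<forall>z\<in>V. \<gamma> z \<in> cyl (Suc j) \<zeta>" and hol: "\<forall>i<Suc j. (\<lambda>z. \<gamma> z i) holomorphic_on V"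
    have TTh: "(\<lambda>z. Tc (Suc j) (\<gamma> z) i) holomorphic_on V" for i
      by (rule hol_alongD[OF Tc_hol V]) (use j \<gamma> hol in auto)
    show "(\<lambda>z. R j (\<gamma> z)) holomorphic_on V"
      unfolding R_def
      by (intro holomorphic_intros hol_alongD[OF \<rho>.cmarg_hol V] hol_alongD[OF \<pi>.cmarg_hol V] TTh)
        (use j dom nz \<gamma> hol in \<open>auto simp del: Tc.simps\<close>)
  qed
  ultimately show ?thesis
    unfolding cyl_def cube_nbhd_def by (intro hol_along_imp_C1_on open_nbhd)
qed

text \<open>The difference quotient of the transport is exactly a quotient \<open>Q\<close> of two
  segment means, and these tend to marginals as the segments shrink to points. End points of the
  interval need no separate treatment.\<close>

lemma R_extends: assumes j: "j < k" shows "extends_partial T j (R j)"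
  unfolding extends_partial_def
proof
  fix u assume u: "u \<in> U"
  define s0 where "s0 = u j"
  define \<tau> where "\<tau> = (\<lambda>s. T j (trunc (Suc j) (u(j := s))))"
  define w where "w = Tc j (cpx u)"
  have s0: "s0 \<in> U1" using u by (auto simp: s0_def U_def)
  have us: "u(j := s) \<in> U" if "s \<in> U1" for s using u that by (auto simp: U_def)
  have j': "Suc j \<le> k" using j by simp
  have cpx_upd: "cpx (u(j := s)) = (cpx u)(j := of_real s)" for s by (auto simp: cpx_def)
  have TTj: "Tc j (cpx (u(j := s))) = w" for s
    unfolding w_def by (rule Tc_cong) (simp add: cpx_def)
  have \<tau>: "Tc (Suc j) (cpx (u(j := s))) j = of_real (\<tau> s)" if "s \<in> U1" for s
    using Tc_cpx[OF us[OF that] j', of j] by (simp add: Tr_def \<tau>_def del: Tc.simps)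
  have uc: "cpx (u(j := s)) \<in> cyl (Suc j) \<zeta>" if "s \<in> U1" for s
    using cpx_in_cyl_\<zeta>[OF us[OF that] j'] .
  have u\<delta>: "cpx u \<in> cyl j \<delta>" using \<rho>.cpx_in_cyl[OF u] j by simp
  have w: "w \<in> cyl j \<delta>" unfolding w_def using cpx_in_cyl_\<zeta>[OF u] j by (intro Tc_in_cyl) auto
  have sN: "of_real s \<in> N j" if "s \<in> U1" for s using of_real_in_nbhd[OF that \<delta>_pos[OF j]] .
  have sol: "is_sol j w (cpx (u(j := s))) (of_real (\<tau> s))" if "s \<in> U1" for s
    using Tc_is_sol[OF j uc[OF that]] unfolding TTj \<tau>[OF that] .
  have \<tau>N: "of_real (\<tau> s) \<in> N j" if "s \<in> U1" for s using sol[OF that] by (simp add: is_sol_def)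
  define c where "c = \<pi>.cmarg j w / \<rho>.cmarg j (cpx u)"
  \<comment> \<open>The equations at \<open>s\<close> and \<open>s0\<close> share \<open>w\<close>
    and the coefficient \<open>c\<close>, because only the last coordinate varies; their difference
    factors on both sides.\<close>
  have incr: "(of_real (\<tau> s) - of_real (\<tau> s0)) * \<pi>.smean j w (of_real (\<tau> s0)) (of_real (\<tau> s))
     = c * ((of_real s - of_real s0) * \<rho>.smean j (cpx u) (of_real s0) (of_real s))" if s: "s \<in> U1" for s
  proof -
    have eq: "(of_real (\<tau> s) + 1) * \<pi>.smean j w (-1) (of_real (\<tau> s)) = E j w (cpx u) (of_real s)" if "s \<in> U1" for s
      using sol[OF that] E_cong[of j w w "cpx (u(j := s))" "cpx u"] by (simp add: is_sol_def cpx_def)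
    show ?thesis
      unfolding \<pi>.smean_reverse[OF w \<tau>N[OF s0] \<tau>N[OF s] j, symmetric] eq[OF s] eq[OF s0]
        E_difference[OF u\<delta> sN[OF s] sN[OF s0] j] c_def ..
  qed
  have upd_cont: "continuous_on U1 (\<lambda>s. cpx (u(j := s)))"
    unfolding cpx_upd by (intro continuous_on_fun_upd continuous_intros)
  have "continuous_on U1 (\<lambda>s. Tc (Suc j) (cpx (u(j := s))))"
    by (rule continuous_on_compose2[OF Tc_cont[OF j'] upd_cont]) (use uc in auto)
  then have "continuous_on U1 (\<lambda>s. Tc (Suc j) (cpx (u(j := s))) j)"
    by (rule continuous_on_product_then_coordinatewise)
  then have cont\<tau>: "continuous_on U1 (\<lambda>s. complex_of_real (\<tau> s))"
    by (rule continuous_on_eq) (rule \<tau>)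
  have c1: "continuous_on U1 (\<lambda>s. \<pi>.smean j w (of_real (\<tau> s0)) (of_real (\<tau> s)))"
  proof -
    have "continuous_on U1 (\<lambda>s. (w, complex_of_real (\<tau> s0), complex_of_real (\<tau> s)))"
      by (intro continuous_on_Pair continuous_on_const cont\<tau>)
    from continuous_on_compose2[OF \<pi>.smean_cont[OF j] this] show ?thesis
      using w \<tau>N s0 by (simp add: image_subset_iff)
  qed
  have c2: "continuous_on U1 (\<lambda>s. \<rho>.smean j (cpx u) (of_real s0) (of_real s))"
  proof -
    have "continuous_on U1 (\<lambda>s. (cpx u, complex_of_real s0, complex_of_real s))"
      by (intro continuous_intros)
    from continuous_on_compose2[OF \<rho>.smean_cont[OF j] this] show ?thesis
      using u\<delta> sN s0 by (simp add: image_subset_iff)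
  qed
  define Q where "Q = (\<lambda>s. c * \<rho>.smean j (cpx u) (of_real s0) (of_real s) / \<pi>.smean j w (of_real (\<tau> s0)) (of_real (\<tau> s)))"
  have nz: "\<pi>.smean j w (of_real (\<tau> s0)) (of_real (\<tau> s)) \<noteq> 0" if "s \<in> U1" for s
    using \<pi>.smean_nonzero[OF w \<tau>N[OF s0] \<tau>N[OF that] j] .
  have "continuous_on U1 Q" unfolding Q_def by (intro continuous_intros c1 c2) (use nz in auto)
  then have "(Q \<longlongrightarrow> Q s0) (at s0 within U1)" using s0 by (simp add: continuous_on_def)
  have u_eq: "u(j := s0) = u" by (simp add: s0_def)
  have TTu: "Tc (Suc j) (cpx u) = w(j := of_real (\<tau> s0))"
    using \<tau>[OF s0] unfolding u_eq by (simp add: w_def)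
  have Q0: "Q s0 = R j (cpx u)"
  proof -
    have "(cpx u)(j := of_real s0) = cpx u" using cpx_upd[of s0] by (simp add: u_eq)
    moreover have "\<pi>.cmarg j (w(j := of_real (\<tau> s0))) = \<pi>.cmarg j w" by (rule \<pi>.cmarg_cong) simp
    ultimately show ?thesis
      unfolding Q_def R_def \<pi>.smean_same \<rho>.smean_same c_def TTu by simp
  qed
  have "R j (cpx u) \<in> \<real>"
  proof -
    have a: "Tc (Suc j) (cpx u) i = cpx (Tr u) i" if "i < Suc j" for i
      using Tc_cpx[OF u j' that] by (simp add: cpx_def)
    then have "\<pi>.cmarg (Suc j) (Tc (Suc j) (cpx u)) = \<pi>.cmarg (Suc j) (cpx (Tr u))" "\<pi>.cmarg j (Tc (Suc j) (cpx u)) = \<pi>.cmarg j (cpx (Tr u))"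
      by (auto intro!: \<pi>.cmarg_cong simp del: Tc.simps)
    then show ?thesis unfolding R_def using \<rho>.cmarg_cpx[OF u] \<pi>.cmarg_cpx[OF Tr_in_U[OF u]] j by simp
  qed
  then obtain r where r: "R j (cpx u) = of_real r" by (auto elim: Reals_cases)
  have "(Q \<longlongrightarrow> of_real r) (at s0 within U1)" using \<open>(Q \<longlongrightarrow> Q s0) (at s0 within U1)\<close> Q0 r by simp
  moreover have "\<forall>\<^sub>F s in at s0 within U1. Q s = of_real ((\<tau> s - \<tau> s0) / (s - s0))"
    unfolding eventually_at_filter
  proof (rule always_eventually, intro allI impI)
    fix s assume s: "s \<noteq> s0" "s \<in> U1"
    have ne: "complex_of_real s - of_real s0 \<noteq> 0" using s by simp
    have "Q s * (of_real s - of_real s0) = of_real (\<tau> s) - of_real (\<tau> s0)"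
    proof -
      have "Q s * (of_real s - of_real s0) =
          c * ((of_real s - of_real s0) * \<rho>.smean j (cpx u) (of_real s0) (of_real s)) / \<pi>.smean j w (of_real (\<tau> s0)) (of_real (\<tau> s))"
        by (simp add: Q_def mult_ac)
      then show ?thesis unfolding incr[OF s(2), symmetric] using nz[OF s(2)] by simp
    qed
    then have "Q s = (of_real (\<tau> s) - of_real (\<tau> s0)) / (of_real s - of_real s0)"
      using ne by (simp add: eq_divide_eq)
    then show "Q s = of_real ((\<tau> s - \<tau> s0) / (s - s0))" by simp
  qed
  ultimately have "((\<lambda>s. complex_of_real ((\<tau> s - \<tau> s0) / (s - s0))) \<longlongrightarrow> of_real r) (at s0 within U1)"
    by (rule Lim_transform_eventually)
  then have "((\<lambda>s. (\<tau> s - \<tau> s0) / (s - s0)) \<longlongrightarrow> r) (at s0 within U1)"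
    by (simp only: tendsto_of_real_iff)
  then have "(\<tau> has_real_derivative r) (at s0 within U1)" by (simp add: has_field_derivative_iff)
  moreover have "R j (cpx (trunc (Suc j) u)) = of_real r"
  proof -
    have tc: "cpx (trunc (Suc j) u) i = cpx u i" if "i < Suc j" for i
      using that by (simp add: trunc_def cpx_def comb_seq_def)
    have "Tc (Suc j) (cpx (trunc (Suc j) u)) = Tc (Suc j) (cpx u)" by (rule Tc_cong) (rule tc)
    moreover have "\<rho>.cmarg (Suc j) (cpx (trunc (Suc j) u)) = \<rho>.cmarg (Suc j) (cpx u)"
      "\<rho>.cmarg j (cpx (trunc (Suc j) u)) = \<rho>.cmarg j (cpx u)" using tc by (auto intro!: \<rho>.cmarg_cong)
    ultimately show ?thesis using r unfolding R_def by simp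
  qed
  ultimately show "\<exists>r. ((\<lambda>s. T j (trunc (Suc j) (u(j := s)))) has_real_derivative r) (at (u j) within U1) \<and>
       R j (cpx (trunc (Suc j) u)) = complex_of_real r"
    unfolding \<tau>_def s0_def by blast
qed

lemma C1_le: "C1 \<le> M / 16" by (rule \<rho>.C1_le)

text \<open>Each marginal is within \<open>C1\<close> of its value at a real point, \<open>u\<close>
  for the factors of \<open>\<rho>\<close> and \<open>v\<close> for those of
  \<open>\<pi>\<close>.\<close>

lemma R_bounds:
  assumes j: "j < k" and x: "x \<in> cyl (Suc j) \<zeta>"
  shows "Re (R j x) \<ge> M\<^sup>2 / (2 * L\<^sup>2)" "cmod (R j x) \<le> 3 / 2 * L\<^sup>2 / M\<^sup>2"
proof -
  note dom = R_domain[OF j x]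
  obtain u where u: "u \<in> U" "\<And>i. i < Suc j \<Longrightarrow> cmod (x i - of_real (u i)) < \<delta> i"
    using real_point_near[OF dom(1)] by blast
  obtain v where v: "v \<in> U" "\<And>i. i < Suc j \<Longrightarrow> cmod (Tc (Suc j) x i - of_real (v i)) < \<delta> i"
    using real_point_near[OF dom(3)] by blast
  have \<rho>n: "cmod (\<rho>.cmarg l x - of_real (marg \<rho>.fr l u)) \<le> M / 16" if "l \<le> Suc j" for l
    using \<rho>.cmarg_near[OF u(1), of l x] u(2) that j C1_le \<rho>.cmarg_cpx[OF u(1), of l] by auto
  have \<pi>n: "cmod (\<pi>.cmarg l (Tc (Suc j) x) - of_real (marg \<pi>.fr l v)) \<le> M / 16" if "l \<le> Suc j" for l
    using \<pi>.cmarg_near[OF v(1), of l "Tc (Suc j) x"] v(2) that j C1_le \<pi>.cmarg_cpx[OF v(1), of l]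
    by (auto simp del: Tc.simps)
  note b = \<rho>.marg_bounds[OF u(1)] \<pi>.marg_bounds[OF v(1)]
  show "Re (R j x) \<ge> M\<^sup>2 / (2 * L\<^sup>2)" "cmod (R j x) \<le> 3 / 2 * L\<^sup>2 / M\<^sup>2"
    unfolding R_def
    by (rule quotient_near_real[OF M_pos \<rho>n b(1,2) \<rho>n b(1,2) \<pi>n b(3,4) \<pi>n b(3,4)]; use j in simp)+
qed

end

context complex_density
begin

text \<open>The denominator is the mean of the numerator over the real interval, and both are close
  to the value at -1. The bound \<open>2 \<le> K\<close> puts the whole interval into the disc of
  radius \<open>K\<close> about -1, and \<open>K < \<delta> j\<close> allows Schwarz' lemma
  there.\<close>

lemma cmarg_near_mean:
  assumes x: "x \<in> cyl j \<delta>" and j: "j < k" and K: "2 \<le> K" "K < \<delta> j" and \<tau>: "cmod (\<tau> + 1) \<le> K"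
  shows "cmod (cmarg (Suc j) (x(j := \<tau>)) / cmarg j x - 1) \<le> 8 * L * K / (M * \<delta> j)"
proof -
  have c: "cmod (cmarg (Suc j) (x(j := \<sigma>)) - cmarg (Suc j) (x(j := -1))) \<le> 2 * L * K / \<delta> j" if "cmod (\<sigma> + 1) \<le> K" for \<sigma>
  proof -
    have "cmod (cmarg (Suc j) (x(j := \<sigma>)) - cmarg (Suc j) (x(j := -1))) \<le> 2 * L / \<delta> j * cmod (\<sigma> + 1)"
      using that K by (intro cmarg_increment[OF x j]) auto
    also have "\<dots> \<le> 2 * L / \<delta> j * K" using that L_pos \<delta>_pos[OF j] by (intro mult_left_mono) auto
    finally show ?thesis by simp
  qed
  have cr: "continuous_on U1 (\<lambda>s. cmarg (Suc j) (x(j := of_real s)))"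
    by (rule continuous_on_compose2[OF cmarg_cont continuous_on_fun_upd])
      (use j x \<delta>_pos[OF j] in \<open>auto simp: cyl_Suc_upd of_real_in_nbhd simp del: fun_upd_apply intro!: continuous_intros\<close>)
  have in_cyl: "x(j := of_real s) \<in> cyl (Suc j) \<delta>" if "s \<in> U1" for s
    using x of_real_in_nbhd[OF that \<delta>_pos[OF j]] by (simp only: cyl_Suc_upd)
  have int: "integrable lam (\<lambda>s. cmarg (Suc j) (x(j := of_real s)))"
    using j in_cyl by (intro lam.integrable_const_bound[of _ L] measurable_lam cr) (auto intro!: cmarg_norm_le)
  have "cmarg j x - cmarg (Suc j) (x(j := -1)) = (\<integral>s. cmarg (Suc j) (x(j := of_real s)) - cmarg (Suc j) (x(j := -1)) \<partial>lam)"
    unfolding cmarg_iterate[OF x j] using int by (simp add: lam.prob_space[simplified])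
  also have "cmod \<dots> \<le> 2 * L * K / \<delta> j"
  proof (rule lam.norm_integral_le_const)
    fix s assume "s \<in> space lam"
    then have "cmod (of_real s + 1) \<le> K"
      using norm_triangle_ineq[of "complex_of_real s" 1] K by (auto simp: U1_def)
    then show "cmod (cmarg (Suc j) (x(j := of_real s)) - cmarg (Suc j) (x(j := -1))) \<le> 2 * L * K / \<delta> j" by (rule c)
  qed (use int in auto)
  finally have "cmod (cmarg (Suc j) (x(j := \<tau>)) - cmarg j x) \<le> 2 * L * K / \<delta> j + 2 * L * K / \<delta> j"
    using c[OF \<tau>] norm_triangle_ineq4[of "cmarg (Suc j) (x(j := \<tau>)) - cmarg (Suc j) (x(j := -1))" "cmarg j x - cmarg (Suc j) (x(j := -1))"]
    unfolding diff_diff_eq2 diff_add_cancel by linarith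
  then have "cmod ((cmarg (Suc j) (x(j := \<tau>)) - cmarg j x) / cmarg j x) \<le> (2 * L * K / \<delta> j + 2 * L * K / \<delta> j) / (M / 2)"
    using cmarg_norm_ge[OF x] j M_pos by (intro norm_divide_le) auto
  moreover have "(cmarg (Suc j) (x(j := \<tau>)) - cmarg j x) / cmarg j x = cmarg (Suc j) (x(j := \<tau>)) / cmarg j x - 1"
    using cmarg_nonzero[OF x] j by (simp add: diff_divide_distrib)
  moreover have "(2 * L * K / \<delta> j + 2 * L * K / \<delta> j) / (M / 2) = 8 * L * K / (M * \<delta> j)" by (simp add: mult.commute)
  ultimately show ?thesis by metis
qed

end

context KR_extension
begin

lemma R_near_one:
  assumes j: "j < k" and x: "x \<in> cyl (Suc j) \<zeta>" and s: "s \<in> U1" "x j = of_real s"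
    and \<delta>j: "8 * L\<^sup>2 / M\<^sup>2 < \<delta> j"
  shows "cmod (R j x - 1) \<le> 256 * L ^ 4 / M ^ 4 / \<delta> j"
proof -
  \<comment> \<open>The bound that the trial value -1 gives for the distance of the solution from
    -1: its residual is the right-hand side \<open>E\<close>, of modulus at most
    \<open>2 * L / M * (2 * L)\<close> because \<open>x j\<close> is real. The assumption on
    \<open>\<delta> j\<close> places the solution in the disc of Schwarz' lemma.\<close>
  define K where "K = 8 * L\<^sup>2 / M\<^sup>2"
  note dom = R_domain[OF j x] and dj = \<delta>_pos[OF j]
  have K8: "8 \<le> K" using one_le_quotient(2) by (simp add: K_def)
  have j': "j \<le> k" using j by simp
  define w where "w = Tc j x"
  define t where "t = Tc (Suc j) x j"
  have w: "w \<in> cyl j \<delta>" unfolding w_def using x j by (intro Tc_in_cyl) (auto simp: cyl_Suc)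
  have TTx: "Tc (Suc j) x = w(j := t)" by (simp add: w_def t_def)
  have sol: "is_sol j w x t" unfolding w_def t_def by (rule Tc_is_sol[OF j x])
  have xj: "x j \<in> N j" using dom(1) by (simp add: cyl_Suc)
  have s2: "cmod (x j + 1) \<le> 2"
    using norm_triangle_ineq[of "complex_of_real s" 1] s by (auto simp: U1_def)
  have "cmod (t - (-1)) \<le> 2 / M * cmod (E j w x (x j) - (-1 + 1) * \<pi>.smean j w (-1) (-1))"
    by (rule sol_difference_bound[OF w j sol \<pi>.minus_one_in_nbhd[OF j]])
  also have "\<dots> = 2 / M * cmod (E j w x (x j))" by simp
  also have "\<dots> \<le> 2 / M * (2 * L / M * (2 * L))"
    unfolding E_def
    by (intro mult_left_mono norm_mult_le cmarg_ratio_le s2 \<rho>.smean_norm_le)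
      (use dom w j j' xj \<rho>.minus_one_in_nbhd[OF j] M_pos in auto)
  also have "\<dots> = K" by (simp add: K_def power2_eq_square)
  finally have tK: "cmod (t + 1) \<le> K" by simp
  define gr where "gr = \<rho>.cmarg (Suc j) (x(j := x j)) / \<rho>.cmarg j x"
  define gp where "gp = \<pi>.cmarg (Suc j) (w(j := t)) / \<pi>.cmarg j w"
  have "\<pi>.cmarg j (w(j := t)) = \<pi>.cmarg j w" by (rule \<pi>.cmarg_cong) simp
  then have R: "R j x = gr / gp" unfolding R_def TTx by (simp add: gr_def gp_def)
  have 1: "cmod (gr - 1) \<le> 8 * L * K / (M * \<delta> j)" unfolding gr_def
    by (rule \<rho>.cmarg_near_mean) (use dom j K8 \<delta>j s2 in \<open>auto simp: K_def\<close>)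
  have 2: "cmod (gp - 1) \<le> 8 * L * K / (M * \<delta> j)" unfolding gp_def
    by (rule \<pi>.cmarg_near_mean) (use w j K8 \<delta>j tK in \<open>auto simp: K_def\<close>)
  have wt: "w(j := t) \<in> cyl (Suc j) \<delta>" using dom(3) unfolding TTx .
  have gp: "M / 2 / L \<le> cmod gp"
    unfolding gp_def norm_divide
    by (rule frac_le) (use \<pi>.cmarg_norm_ge[OF wt] \<pi>.cmarg_norm_le[OF j' w] \<pi>.cmarg_norm_ge[OF w j'] M_pos j in auto)
  then have gp0: "gp \<noteq> 0" using M_pos L_pos by (auto simp: field_simps)
  have "cmod (gr - gp) \<le> 16 * L * K / (M * \<delta> j)"
  proof -
    have "cmod (gr - gp) \<le> 8 * L * K / (M * \<delta> j) + 8 * L * K / (M * \<delta> j)"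
      using 1 2 norm_triangle_ineq4[of "gr - 1" "gp - 1"] unfolding diff_diff_eq2 diff_add_cancel by linarith
    then show ?thesis by (simp add: mult_ac flip: add_divide_distrib)
  qed
  then have "cmod ((gr - gp) / gp) \<le> 16 * L * K / (M * \<delta> j) / (M / 2 / L)"
    by (rule norm_divide_le) (use gp M_pos L_pos in auto)
  also have "\<dots> = 256 * L ^ 4 / M ^ 4 / \<delta> j"
    by (simp add: K_def power2_eq_square power4_eq_xxxx mult_ac)
  finally show ?thesis using gp0 by (simp add: R diff_divide_distrib)
qed

end

theorem proposition4p2:
  fixes M L :: real
  assumes "0 < M" and "M \<le> L"
  shows "\<exists>C1 C2 C3 :: real. C1 > 0 \<and> 0 < C2 \<and> C2 \<le> 1 \<and> C3 > 0 \<and>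
    (\<forall>k\<ge>1. \<forall>\<delta> :: nat \<Rightarrow> real. (\<forall>j<k. \<delta> j > 0) \<longrightarrow>
      (\<forall>(f\<rho> :: (nat \<Rightarrow> complex) \<Rightarrow> complex) (f\<pi> :: (nat \<Rightarrow> complex) \<Rightarrow> complex) T \<zeta>.
        density_hyps M L C1 k \<delta> f\<rho> \<and> density_hyps M L C1 k \<delta> f\<pi> \<and>
        KR_transport (\<lambda>y. Re (f\<rho> (cpx y))) (\<lambda>y. Re (f\<pi> (cpx y))) T \<and>
        \<zeta> = (\<lambda>j. C2 * \<delta> j) \<longrightarrow>
        (\<forall>j<k. \<exists>R. extends_partial T j R \<and>
          C1_on (Suc j) (cube_nbhd (Suc j) \<zeta>) R \<and>
          (\<forall>x\<in>cube_nbhd (Suc j) \<zeta>. R x \<in> nbhd C3 {1} \<and> Re (R x) \<ge> 1 / C3) \<and>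
          (j \<ge> 1 \<longrightarrow> (\<forall>x\<in>cube_nbhd_U1 j \<zeta>. R x \<in> nbhd (C3 / \<delta> j) {1})))))"
proof -
  define C1 where "C1 = M ^ 3 / (64 * L\<^sup>2)"
  define C2 where "C2 = M\<^sup>2 / (16 * L\<^sup>2)"
  define q where "q = L\<^sup>2 / M\<^sup>2"
  \<comment> \<open>The main term is \<open>256 * q\<^sup>2\<close> from large
    \<open>\<delta> j\<close>; one more \<open>q\<^sup>2\<close> makes the inequality
    strict.\<close>
  define C3 where "C3 = 257 * q\<^sup>2"
  have L: "0 < L" using assms by linarith
  have M2: "M\<^sup>2 \<le> L\<^sup>2" using assms by (intro power_mono) auto
  have q1: "1 \<le> q" unfolding q_def using M2 assms(1) by simp
  then have qq: "q \<le> q\<^sup>2" by (simp add: power2_eq_square)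
  have M2': "M\<^sup>2 \<le> 4 * L\<^sup>2" "M\<^sup>2 \<le> 16 * L\<^sup>2" using M2 zero_le_power2[of L] by linarith+
  have C1: "0 < C1" unfolding C1_def using assms(1) L by simp
  have "C1 = M * (M\<^sup>2 / (64 * L\<^sup>2))" by (simp add: C1_def power2_eq_square power3_eq_cube)
  also have "\<dots> \<le> M * (1 / 16)"
    using assms(1) L M2' by (intro mult_left_mono) (auto simp: divide_le_eq)
  finally have C1_le: "C1 \<le> M / 16" by simp
  have C2: "0 < C2" "C2 \<le> 1"
    using assms(1) L M2' by (auto simp: C2_def divide_le_eq)
  have C3: "0 < C3" using q1 by (simp add: C3_def)
  have main: "\<exists>R. extends_partial T j R \<and> C1_on (Suc j) (cube_nbhd (Suc j) \<zeta>) R \<and>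
          (\<forall>x\<in>cube_nbhd (Suc j) \<zeta>. R x \<in> nbhd C3 {1} \<and> Re (R x) \<ge> 1 / C3) \<and>
          (j \<ge> 1 \<longrightarrow> (\<forall>x\<in>cube_nbhd_U1 j \<zeta>. R x \<in> nbhd (C3 / \<delta> j) {1}))"
    if \<delta>: "\<forall>j<k. \<delta> j > 0" and f: "density_hyps M L C1 k \<delta> f\<rho>" "density_hyps M L C1 k \<delta> f\<pi>"
      and T: "KR_transport (\<lambda>y. Re (f\<rho> (cpx y))) (\<lambda>y. Re (f\<pi> (cpx y))) T"
      and \<zeta>: "\<zeta> = (\<lambda>j. C2 * \<delta> j)" and j: "j < k"
    for k \<delta> f\<rho> f\<pi> T \<zeta> j
  proof -
    interpret K: KR_extension M L C1 k \<delta> f\<rho> f\<pi> C2 T \<zeta>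
      by unfold_locales (use assms \<delta> f T \<zeta> C1 C1_le in \<open>auto simp: C1_def C2_def\<close>)
    have sub: "cube_nbhd (Suc j) \<zeta> \<subseteq> cyl (Suc j) \<zeta>"
      by (auto simp: cube_nbhd_def prod_tail_def cyl_def)
    have bound1: "cmod (K.R j x - 1) < 3 * q" if "x \<in> cyl (Suc j) \<zeta>" for x
    proof -
      have "cmod (K.R j x) \<le> 3 / 2 * q" using K.R_bounds(2)[OF j that] by (simp add: q_def)
      then show ?thesis using norm_triangle_ineq4[of "K.R j x" 1] q1 by simp
    qed
    have dj: "\<delta> j > 0" using \<delta> j by simp
    show ?thesis
    proof (intro exI[of _ "K.R j"] conjI ballI impI)
      show "extends_partial T j (K.R j)" by (rule K.R_extends[OF j])
      show "C1_on (Suc j) (cube_nbhd (Suc j) \<zeta>) (K.R j)" by (rule K.R_C1[OF j])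
    next
      fix x assume "x \<in> cube_nbhd (Suc j) \<zeta>"
      then have x: "x \<in> cyl (Suc j) \<zeta>" using sub by blast
      show "K.R j x \<in> nbhd C3 {1}"
        using bound1[OF x] qq q1 by (simp add: in_nbhd_iff C3_def)
      have "1 / C3 \<le> 1 / (2 * q)" using qq q1 by (intro frac_le) (auto simp: C3_def)
      also have "\<dots> = M\<^sup>2 / (2 * L\<^sup>2)" by (simp add: q_def)
      finally show "1 / C3 \<le> Re (K.R j x)" using K.R_bounds(1)[OF j x] by linarith
    next
      fix x assume x': "x \<in> cube_nbhd_U1 j \<zeta>"
      then have "x j \<in> U1c" and xi: "\<forall>i<j. x i \<in> nbhd (\<zeta> i) U1c"
        by (auto simp: cube_nbhd_U1_def prod_tail_def split: if_splits)
      then obtain s where s: "s \<in> U1" "x j = of_real s" by (auto simp: U1c_def)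
      have x: "x \<in> cyl (Suc j) \<zeta>"
        using xi s of_real_in_nbhd[OF s(1) K.\<zeta>_pos[OF j]] by (auto simp: cyl_def less_Suc_eq)
      have "cmod (K.R j x - 1) < C3 / \<delta> j"
      \<comment> \<open>If \<open>\<delta> j \<le> 8 * q\<close>, the uniform bound
        \<open>3 * q\<close> is already below \<open>C3 / \<delta> j\<close>, since
        \<open>24 * q\<^sup>2 \<le> C3\<close>.\<close>
      proof (cases "8 * L\<^sup>2 / M\<^sup>2 < \<delta> j")
        case True
        have "cmod (K.R j x - 1) \<le> 256 * L ^ 4 / M ^ 4 / \<delta> j" by (rule K.R_near_one[OF j x s True])
        also have "256 * L ^ 4 / M ^ 4 = 256 * q\<^sup>2" by (simp add: q_def power_divide flip: power_mult)
        also have "256 * q\<^sup>2 / \<delta> j < C3 / \<delta> j" using dj q1 by (intro divide_strict_right_mono) (auto simp: C3_def)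
        finally show ?thesis .
      next
        case False
        then have "\<delta> j \<le> 8 * q" by (simp add: q_def)
        then have "3 * q * \<delta> j \<le> 3 * q * (8 * q)" using q1 by (intro mult_left_mono) auto
        also have "\<dots> \<le> C3" using q1 by (simp add: C3_def power2_eq_square)
        finally have "3 * q \<le> C3 / \<delta> j" using dj by (simp add: pos_le_divide_eq)
        then show ?thesis using bound1[OF x] by linarith
      qed
      then show "K.R j x \<in> nbhd (C3 / \<delta> j) {1}" by (simp add: in_nbhd_iff)
    qed
  qed
  show ?thesis
    by (intro exI[of _ C1] exI[of _ C2] exI[of _ C3] conjI allI impI C1 C2 C3) (elim conjE, rule main)
qed

end
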